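(* Let $A$ be an $n$-by-$n$ complex matrix with $p(A)\ge a(A)-1$. Then the following conditions are equivalent: (a) $W(A)$ is a circular disc centered at the origin. (b) $A$ is unitarily similar to a direct sum of (nilpotent) Jordan blocks $J_{k_1}\oplus\cdots\oplus J_{k_s}$. (c) $A$ has no unitary part and $A^j$ is a partial isometry for all $j\ge 1$. (d) $A$ has no unitary part and $A,A^2,\ldots,A^\ell$ are partial isometries for some $\ell>a(A)$. In this case, $W(A)=\{z\in\mathbb{C}:|z|\le\cos(\pi/(a(A)+1))\}$ and $p(A)=\infty$.
   Context: An $n$-by-$n$ complex matrix $A$ is a partial isometry if $\|Ax\|=\|x\|$ for every $x\in(\ker A)^\perp$ (standard norm on $\mathbb{C}^n$). The ascent $a(A)$ is the minimal integer $k\ge 0$ with $\ker A^k=\ker A^{k+1}$ (where $A^0=I_n$). The power partial isometry index is $p(A)=\sup\{k\ge 0: I,A,A^2,\ldots,A^k\text{ are all partial isometries}\}\in\{0,1,2,\ldots\}\cup\{\infty\}$. The numerical range is $W(A)=\{\langle Ax,x\rangle:x\in\mathbb{C}^n,\|x\|=1\}$. A circular disc is closed, and radius $0$ (a single point) is permitted. $J_j$ is the $j$-by-$j$ nilpotent Jordan block, with $1$'s on the first superdiagonal and $0$'s elsewhere. A matrix has no unitary part if it is not unitarily similar to a direct sum having a unitary matrix (of size at least $1$) as a summand (in particular, it is not itself unitary). *)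

theory Defs
  imports
    "HOL-Analysis.Elementary_Metric_Spaces"
    "HOL-Library.Extended_Nat"
    "Jordan_Normal_Form.Matrix_Kernel"
    "Jordan_Normal_Form.Schur_Decomposition"
    "Jordan_Normal_Form.Jordan_Normal_Form"
begin

definition vec_norm :: "complex vec \<Rightarrow> real" where
  "vec_norm v = sqrt (\<Sum>i<dim_vec v. (cmod (vec_index v i))\<^sup>2)"

definition orth_complement :: "nat \<Rightarrow> complex vec set \<Rightarrow> complex vec set" where
  "orth_complement n S = {x \<in> carrier_vec n. \<forall>y\<in>S. x \<bullet>c y = 0}"

definition partial_isometry :: "complex mat \<Rightarrow> bool" where
  "partial_isometry A \<longleftrightarrow>
     (\<forall>x \<in> orth_complement (dim_col A) (mat_kernel A). vec_norm (A *\<^sub>v x) = vec_norm x)"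

definition ascent :: "complex mat \<Rightarrow> nat" where
  "ascent A = (LEAST k. mat_kernel (A ^\<^sub>m k) = mat_kernel (A ^\<^sub>m (k + 1)))"

definition ppi_index :: "complex mat \<Rightarrow> enat" where
  "ppi_index A = Sup {enat k | k. \<forall>j\<le>k. partial_isometry (A ^\<^sub>m j)}"

definition numerical_range :: "complex mat \<Rightarrow> complex set" where
  "numerical_range A = {(A *\<^sub>v x) \<bullet>c x | x. x \<in> carrier_vec (dim_col A) \<and> vec_norm x = 1}"

definition unitary_mat :: "complex mat \<Rightarrow> bool" where
  "unitary_mat U \<longleftrightarrow> square_mat U \<and> inverts_mat (mat_adjoint U) U \<and> inverts_mat U (mat_adjoint U)"

definition unitarily_similar :: "complex mat \<Rightarrow> complex mat \<Rightarrow> bool" where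
  "unitarily_similar A B \<longleftrightarrow> (\<exists>U. unitary_mat U \<and> similar_mat_wit A B U (mat_adjoint U))"

(* The list of summands may be a singleton, so a (nonempty) unitary matrix itself has a unitary part. *)
definition has_unitary_part :: "complex mat \<Rightarrow> bool" where
  "has_unitary_part A \<longleftrightarrow>
     (\<exists>Bs. (\<forall>B\<in>set Bs. square_mat B) \<and>
           (\<exists>U\<in>set Bs. unitary_mat U \<and> dim_row U \<ge> 1) \<and>
           unitarily_similar A (diag_block_mat Bs))"

end

theory Submission
  imports Defs "Jordan_Normal_Form.Spectral_Radius"
begin

text \<open>
  Write $a$ for the ascent of $A$, $N = \ker A^a$ and $H_j = \ker A^j \cap (\ker A^{j-1})^\perp$ for
  $j \le a$. For $h \in H_j$ the vectors $h, Ah, \dots, A^{j-1}h$ form an orthogonal chain on which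
  $A^*$ acts as the backward shift.

  If $W(A)$ is a disc of radius $r$ centred at $0$, then for every unimodular $z$ there is
  $x \ne 0$ with $2rzx = z^2Ax + A^*x$. Pairing this equation with a chain gives a Chebyshev
  recursion; if $r > \cos(\pi/(a+1))$ it can be solved for the component of $x$ in $N$, and $x$ lies
  in the kernel of a matrix $T(z)$ that is polynomial in $z$. So $\det T$ vanishes identically, whereas
  $T(0)$ is invertible by the definition of the ascent. Hence $r \le \cos(\pi/(a+1))$, and sine
  vectors along a chain of length $a$ give equality and $A^* H_a = 0$. If $N$ were a proper
  subspace, an eigenvector of the compression of $A$ to $N^\perp$ together with a sine vector would
  violate the supporting line inequality. So $A$ is nilpotent, and the chains of maximal length can
  be split off one at a time as Jordan blocks.

  If instead the powers up to the exponent $a+1$ are partial isometries, $A$ maps $N^\perp$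
  isometrically onto itself, which gives a unitary part unless $N$ is the whole space.
\<close>

section \<open>Inner products and adjoints\<close>

text \<open>The hypothesis p(A) >= a - 1 controls the powers A^j with j < a, just what chains of
  length at most a use. It says nothing about A^a, so A need not preserve the orthogonal complement
  of N and need not split into a nilpotent and an invertible summand; the disc itself has to exclude
  the second part. The determinant is the way around this: on the unit circle cnj z = 1/z, so the
  equation of a vector touched by a supporting line becomes polynomial in z after multiplication by
  z, and its solvability can be carried from the circle to z = 0, where only the compression of the
  adjoint to the complement of N remains, next to the identity on N. The constant cos(pi/(a+1)) is
  the largest eigenvalue of the real part of J_a and the largest zero of the Chebyshev polynomial
  U_a; above it every U_k with k <= a is positive and may be divided by. The same angle drives the
  last contradiction: the eigenvector v of the compression and the remainder w = A v - mu v imitate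
  the first two links of a chain of length a with an extra diagonal entry mu in front.\<close>

lemma ip_add_left:
  fixes x :: "complex vec"
  assumes "dim_vec x = dim_vec z" "dim_vec y = dim_vec z"
  shows "(x + y) \<bullet>c z = x \<bullet>c z + y \<bullet>c z"
  using assms by (simp add: scalar_prod_def sum.distrib distrib_right)

lemma ip_add_right:
  fixes x :: "complex vec"
  assumes "dim_vec x = dim_vec z" "dim_vec y = dim_vec z"
  shows "z \<bullet>c (x + y) = z \<bullet>c x + z \<bullet>c y"
  using assms by (simp add: scalar_prod_def sum.distrib distrib_left)

lemma ip_diff_left:
  fixes x :: "complex vec"
  assumes "dim_vec x = dim_vec z" "dim_vec y = dim_vec z"
  shows "(x - y) \<bullet>c z = x \<bullet>c z - y \<bullet>c z"
  using assms by (simp add: scalar_prod_def sum_subtractf left_diff_distrib)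

lemma ip_diff_right:
  fixes x :: "complex vec"
  assumes "dim_vec x = dim_vec z" "dim_vec y = dim_vec z"
  shows "z \<bullet>c (x - y) = z \<bullet>c x - z \<bullet>c y"
  using assms by (simp add: scalar_prod_def sum_subtractf right_diff_distrib)

lemma ip_smult_left:
  fixes x :: "complex vec"
  assumes "dim_vec x = dim_vec z"
  shows "(k \<cdot>\<^sub>v x) \<bullet>c z = k * (x \<bullet>c z)"
  using assms by (simp add: scalar_prod_def sum_distrib_left mult.assoc)

lemma ip_smult_right:
  fixes x :: "complex vec"
  assumes "dim_vec x = dim_vec z"
  shows "z \<bullet>c (k \<cdot>\<^sub>v x) = cnj k * (z \<bullet>c x)"
  using assms by (simp add: scalar_prod_def sum_distrib_left algebra_simps)

lemma ip_cnj:
  fixes x :: "complex vec"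
  assumes "dim_vec x = dim_vec y"
  shows "cnj (x \<bullet>c y) = y \<bullet>c x"
  using assms by (simp add: scalar_prod_def mult.commute)

lemma ip_zero_left [simp]: "0\<^sub>v n \<bullet>c (x :: complex vec) = 0" if "dim_vec x = n"
  using that by (simp add: scalar_prod_def)

lemma ip_zero_right [simp]: "(x :: complex vec) \<bullet>c 0\<^sub>v n = 0"
  by (simp add: scalar_prod_def)

lemmas ip_linear = ip_add_left ip_add_right ip_diff_left ip_diff_right ip_smult_left ip_smult_right

text \<open>The squared norm. Working with it instead of \<open>vec_norm\<close> turns isometry
  statements into identities of inner products without square roots.\<close>

definition nsq :: "complex vec \<Rightarrow> real" where
  "nsq x = (\<Sum>i<dim_vec x. (cmod (vec_index x i))\<^sup>2)"

lemma ip_self: "x \<bullet>c x = complex_of_real (nsq x)"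
  by (simp add: scalar_prod_def nsq_def lessThan_atLeast0 flip: complex_norm_square of_real_power)

lemma nsq_nonneg [simp]: "nsq x \<ge> 0"
  by (simp add: nsq_def sum_nonneg)

lemma vec_norm_nsq: "vec_norm x = sqrt (nsq x)"
  by (simp add: vec_norm_def nsq_def)

lemma vec_norm_eq_iff: "vec_norm x = vec_norm y \<longleftrightarrow> nsq x = nsq y"
  by (simp add: vec_norm_nsq)

lemma vec_norm_eq_1_iff: "vec_norm x = 1 \<longleftrightarrow> nsq x = 1"
  by (simp add: vec_norm_nsq)

lemma nsq_eq_0_iff: "x \<in> carrier_vec n \<Longrightarrow> nsq x = 0 \<longleftrightarrow> x = 0\<^sub>v n"
  unfolding nsq_def by (subst sum_nonneg_eq_0_iff) auto

lemma nsq_smult: "nsq (k \<cdot>\<^sub>v x) = (cmod k)\<^sup>2 * nsq x"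
  by (simp add: nsq_def norm_mult power_mult_distrib sum_distrib_left)

lemma nsq_normalize:
  assumes "x \<in> carrier_vec n" "x \<noteq> 0\<^sub>v n"
  obtains c :: real where "c > 0" "nsq (complex_of_real c \<cdot>\<^sub>v x) = 1"
proof
  have "nsq x > 0"
    using assms nsq_eq_0_iff[of x n] nsq_nonneg[of x] by linarith
  then show "1 / sqrt (nsq x) > 0" "nsq (complex_of_real (1 / sqrt (nsq x)) \<cdot>\<^sub>v x) = 1"
    by (auto simp: nsq_smult norm_divide power_divide)
qed

text \<open>The difference \<open>x - y\<close> is itself a test vector. Identities that involve an
  adjoint are proved in this weak form.\<close>

lemma vec_eq_by_ip:
  assumes "x \<in> carrier_vec n" "y \<in> carrier_vec n"
    and "\<And>w. w \<in> carrier_vec n \<Longrightarrow> (x :: complex vec) \<bullet>c w = y \<bullet>c w"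
  shows "x = y"
proof -
  have "(x - y) \<bullet>c (x - y) = 0"
    using assms(3)[of "x - y"] assms(1,2) by (subst ip_diff_left) auto
  then have "x - y = 0\<^sub>v n"
    using assms(1,2) nsq_eq_0_iff[of "x - y" n] by (simp add: ip_self)
  show ?thesis
  proof (rule eq_vecI)
    fix i assume "i < dim_vec y"
    then show "x $ i = y $ i"
      using arg_cong[OF \<open>x - y = 0\<^sub>v n\<close>, of "\<lambda>v. v $ i"] assms(1,2) by auto
  qed (use assms in auto)
qed

lemma mat_eq_by_vec:
  fixes A B :: "complex mat"
  assumes A: "A \<in> carrier_mat m n" and B: "B \<in> carrier_mat m n"
    and eq: "\<And>x. x \<in> carrier_vec n \<Longrightarrow> A *\<^sub>v x = B *\<^sub>v x"
  shows "A = B"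
proof (rule eq_matI)
  fix k i assume "k < dim_row B" "i < dim_col B"
  then have k: "k < m" and i: "i < n" using B by auto
  show "A $$ (k, i) = B $$ (k, i)"
    using arg_cong[OF eq[of "unit_vec n i"], of "\<lambda>v. v $ k"] A B i k
    by (auto simp: scalar_prod_right_unit)
qed (use A B in auto)

abbreviation adj :: "complex mat \<Rightarrow> complex mat" where
  "adj \<equiv> mat_adjoint"

lemma dim_adj [simp]: "dim_row (adj A) = dim_col A" "dim_col (adj A) = dim_row A"
  by (auto simp: mat_adjoint_def)

lemma adj_carrier [simp]: "A \<in> carrier_mat m n \<Longrightarrow> adj A \<in> carrier_mat n m"
  by auto

lemma adj_index [simp]:
  "i < dim_col A \<Longrightarrow> j < dim_row A \<Longrightarrow> adj A $$ (i, j) = cnj (A $$ (j, i))"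
  by (simp add: mat_adjoint_def mat_of_rows_index)

lemma adj_adj [simp]: "adj (adj A) = A"
  by (rule eq_matI) auto

lemma ip_adj:
  assumes "dim_col A = dim_vec x" "dim_row A = dim_vec y"
  shows "(A *\<^sub>v x) \<bullet>c y = x \<bullet>c (adj A *\<^sub>v y)"
proof -
  have "(A *\<^sub>v x) \<bullet>c y = (\<Sum>i<dim_vec y. \<Sum>j<dim_vec x. A $$ (i,j) * x $ j * cnj (y $ i))"
    using assms by (simp add: scalar_prod_def row_def sum_distrib_right lessThan_atLeast0)
  also have "\<dots> = (\<Sum>j<dim_vec x. \<Sum>i<dim_vec y. A $$ (i,j) * x $ j * cnj (y $ i))"
    by (rule sum.swap)
  also have "\<dots> = x \<bullet>c (adj A *\<^sub>v y)"
    using assms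
    by (simp add: scalar_prod_def row_def sum_distrib_left lessThan_atLeast0 algebra_simps)
  finally show ?thesis .
qed

lemma ip_adj':
  assumes "dim_row A = dim_vec x" "dim_col A = dim_vec y"
  shows "(adj A *\<^sub>v x) \<bullet>c y = x \<bullet>c (A *\<^sub>v y)"
  using ip_adj[of "adj A" x y] assms by simp

lemma adj_mult: 
  assumes "dim_col A = dim_row B"
  shows "adj (A * B) = adj B * adj A"
  by (rule eq_matI) (use assms in \<open>auto simp: scalar_prod_def mult.commute\<close>)

lemma adj_one [simp]: "adj (1\<^sub>m n) = 1\<^sub>m n"
  by (rule eq_matI) auto

section \<open>Powers of a matrix acting on vectors\<close>

lemma pow_mat_Suc_left:
  assumes "A \<in> carrier_mat n n"
  shows "A ^\<^sub>m Suc k = A * A ^\<^sub>m k"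
proof (induction k)
  case (Suc k)
  have "A ^\<^sub>m Suc (Suc k) = (A * A ^\<^sub>m k) * A"
    using Suc by simp
  also have "\<dots> = A * A ^\<^sub>m Suc k"
    using assms by (simp add: assoc_mult_mat[of _ n n _ n _ n])
  finally show ?case .
qed (use assms in simp)

lemma pow_mat_plus:
  assumes "A \<in> carrier_mat n n"
  shows "A ^\<^sub>m (i + j) = A ^\<^sub>m i * A ^\<^sub>m j"
proof (induction j)
  case (Suc j)
  then show ?case
    using assms by (simp add: assoc_mult_mat[of _ n n _ n _ n])
qed (use assms in simp)

lemma pow_mat_mult_vec:
  assumes "A \<in> carrier_mat n n" "x \<in> carrier_vec n"
  shows "A ^\<^sub>m (i + j) *\<^sub>v x = A ^\<^sub>m i *\<^sub>v (A ^\<^sub>m j *\<^sub>v x)"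
  using assms by (simp add: pow_mat_plus assoc_mult_mat_vec[of _ n n _ n])

lemma pow_mat_mult_vec_Suc:
  assumes "A \<in> carrier_mat n n" "x \<in> carrier_vec n"
  shows "A ^\<^sub>m Suc k *\<^sub>v x = A *\<^sub>v (A ^\<^sub>m k *\<^sub>v x)"
  using assms by (simp only: pow_mat_Suc_left) (simp add: assoc_mult_mat_vec[of _ n n _ n])

section \<open>Orthonormal bases of subspaces\<close>

text \<open>One closure clause suffices: sums are the case \<open>c = 1\<close>, multiples the case
  where \<open>x\<close> is the zero vector.\<close>

definition subsp :: "nat \<Rightarrow> complex vec set \<Rightarrow> bool" where
  "subsp n S \<longleftrightarrow> S \<subseteq> carrier_vec n \<and> 0\<^sub>v n \<in> S \<and>
     (\<forall>x\<in>S. \<forall>y\<in>S. \<forall>c. x + c \<cdot>\<^sub>v y \<in> S)"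

text \<open>The columns are orthonormal in C^n. Such a \<open>V\<close> encodes a subspace together
  with a basis: \<open>V * adj V\<close> is the orthogonal projection onto its range.\<close>

definition isom_mat :: "nat \<Rightarrow> nat \<Rightarrow> complex mat \<Rightarrow> bool" where
  "isom_mat n m V \<longleftrightarrow> V \<in> carrier_mat n m \<and> adj V * V = 1\<^sub>m m"

lemma subspD:
  assumes "subsp n S"
  shows "x \<in> S \<Longrightarrow> x \<in> carrier_vec n" "0\<^sub>v n \<in> S"
    "x \<in> S \<Longrightarrow> y \<in> S \<Longrightarrow> x + c \<cdot>\<^sub>v y \<in> S"
  using assms by (auto simp: subsp_def)

lemma subsp_smult:
  assumes "subsp n S" "x \<in> S"
  shows "c \<cdot>\<^sub>v x \<in> S"
proof -
  have "0\<^sub>v n + c \<cdot>\<^sub>v x \<in> S"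
    by (rule subspD[OF assms(1)] assms)+
  then show ?thesis using subspD(1)[OF assms] by simp
qed

lemma subsp_diff:
  assumes "subsp n S" "x \<in> S" "y \<in> S"
  shows "x - y \<in> S"
proof -
  have "x + (-1) \<cdot>\<^sub>v y \<in> S" "x \<in> carrier_vec n" "y \<in> carrier_vec n"
    using subspD[OF assms(1)] assms by auto
  moreover from this have "x + (-1) \<cdot>\<^sub>v y = x - y"
    by auto
  ultimately show ?thesis by simp
qed

lemma mult_mat_vec_in_carrier [simp]: "A *\<^sub>v x \<in> carrier_vec n \<longleftrightarrow> dim_row A = n"
  unfolding carrier_vec_def by simp

lemma zero_mv [simp]: "dim_vec x = n \<Longrightarrow> 0\<^sub>m m n *\<^sub>v x = 0\<^sub>v m" for x :: "complex vec"
  by (intro eq_vecI) (auto simp: scalar_prod_def)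

lemma one_mv [simp]: "dim_vec x = n \<Longrightarrow> 1\<^sub>m n *\<^sub>v x = x" for x :: "complex vec"
  by (intro one_mult_mat_vec carrier_vecI)

lemma mv_zero [simp]: "dim_col A = n \<Longrightarrow> A *\<^sub>v 0\<^sub>v n = 0\<^sub>v (dim_row A)" for A :: "complex mat"
  by (intro eq_vecI) (auto simp: scalar_prod_def)

lemma smult_zero_vec [simp]: "(c :: complex) \<cdot>\<^sub>v 0\<^sub>v n = 0\<^sub>v n"
  by (intro eq_vecI) auto

lemma isom_matD:
  assumes "isom_mat n m V"
  shows "V \<in> carrier_mat n m" "dim_row V = n" "dim_col V = m"
    "c \<in> carrier_vec m \<Longrightarrow> adj V *\<^sub>v (V *\<^sub>v c) = c"
proof -
  show V: "V \<in> carrier_mat n m" and "dim_row V = n" "dim_col V = m"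
    using assms by (auto simp: isom_mat_def)
  assume c: "c \<in> carrier_vec m"
  have "adj V *\<^sub>v (V *\<^sub>v c) = (adj V * V) *\<^sub>v c"
    by (rule assoc_mult_mat_vec[symmetric, OF adj_carrier[OF V] V c])
  then show "adj V *\<^sub>v (V *\<^sub>v c) = c"
    using assms c by (simp add: isom_mat_def)
qed

lemma isom_matI:
  assumes V: "V \<in> carrier_mat n m"
    and "\<And>i j. i < m \<Longrightarrow> j < m \<Longrightarrow> col V i \<bullet>c col V j = (if i = j then 1 else 0)"
  shows "isom_mat n m V"
  unfolding isom_mat_def
proof (intro conjI eq_matI)
  fix i j assume "i < dim_row (1\<^sub>m m)" "j < dim_col (1\<^sub>m m)"
  then have ij: "i < m" "j < m" by auto
  have "(adj V * V) $$ (i, j) = col V j \<bullet>c col V i"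
    using V ij by (auto simp: scalar_prod_def mult.commute intro!: sum.cong)
  then show "(adj V * V) $$ (i, j) = 1\<^sub>m m $$ (i, j)"
    using assms(2)[of j i] ij by auto
qed (use V in auto)

lemma isom_mat_col_ip:
  assumes "isom_mat n m V" "i < m" "j < m"
  shows "col V i \<bullet>c col V j = (if i = j then 1 else 0)"
proof -
  have "(adj V * V) $$ (j, i) = col V i \<bullet>c col V j"
    using assms isom_matD[OF assms(1)] by (auto simp: scalar_prod_def mult.commute intro!: sum.cong)
  then show ?thesis
    using assms by (auto simp: isom_mat_def)
qed

lemma isom_mat_ip:
  assumes V: "isom_mat n m V" and c: "c \<in> carrier_vec m" "d \<in> carrier_vec m"
  shows "(V *\<^sub>v c) \<bullet>c (V *\<^sub>v d) = c \<bullet>c d"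
proof -
  note D = isom_matD(2,3)[OF V]
  have "(V *\<^sub>v c) \<bullet>c (V *\<^sub>v d) = c \<bullet>c (adj V *\<^sub>v (V *\<^sub>v d))"
    by (rule ip_adj) (use D c in auto)
  then show ?thesis by (simp only: isom_matD(4)[OF V c(2)])
qed

lemma isom_mat_nsq:
  assumes "isom_mat n m V" "c \<in> carrier_vec m"
  shows "nsq (V *\<^sub>v c) = nsq c"
  using isom_mat_ip[OF assms(1) assms(2) assms(2)] unfolding ip_self of_real_eq_iff .

text \<open>The normal equation: as \<open>adj V * V\<close> is the identity,
  \<open>V * adj V\<close> projects orthogonally onto the range of \<open>V\<close>.\<close>

lemma isom_mat_orth_residual:
  assumes V: "isom_mat n m V" and x: "x \<in> carrier_vec n" and c: "c \<in> carrier_vec m"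
  shows "(x - V *\<^sub>v (adj V *\<^sub>v x)) \<bullet>c (V *\<^sub>v c) = 0"
proof -
  note D = isom_matD(2,3)[OF V]
  have "(V *\<^sub>v (adj V *\<^sub>v x)) \<bullet>c (V *\<^sub>v c) = (adj V *\<^sub>v x) \<bullet>c c"
    by (rule isom_mat_ip[OF V]) (use D c in auto)
  also have "\<dots> = x \<bullet>c (V *\<^sub>v c)"
    using D x c by (intro ip_adj') auto
  finally show ?thesis
    using D x by (simp add: ip_diff_left)
qed

lemma isom_mat_bessel:
  assumes V: "isom_mat n m V" and x: "x \<in> carrier_vec n"
  shows "nsq (adj V *\<^sub>v x) \<le> nsq x"
proof -
  define y where "y = V *\<^sub>v (adj V *\<^sub>v x)"
  have y: "y \<in> carrier_vec n"
    using isom_matD[OF V] by (simp add: y_def)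
  have d: "dim_row V = n" "dim_col V = m" "adj V *\<^sub>v x \<in> carrier_vec m" "dim_vec x = n"
    using isom_matD(2,3)[OF V] x by auto
  have "(x - y) \<bullet>c y = 0"
    unfolding y_def by (rule isom_mat_orth_residual[OF V x]) (use d in auto)
  moreover have "nsq y = nsq (adj V *\<^sub>v x)"
    using isom_mat_nsq[OF V, of "adj V *\<^sub>v x"] d by (simp add: y_def)
  moreover have "x \<bullet>c y = y \<bullet>c y" "y \<bullet>c x = x \<bullet>c y"
    using \<open>(x - y) \<bullet>c y = 0\<close> x y ip_cnj[of x y] by (auto simp: ip_diff_left ip_self)
  ultimately have "(x - y) \<bullet>c (x - y) = x \<bullet>c x - y \<bullet>c y"
    using x y by (simp add: ip_linear)
  then have "nsq (x - y) = nsq x - nsq y"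
    unfolding ip_self of_real_diff[symmetric] of_real_eq_iff .
  then show ?thesis
    using nsq_nonneg[of "x - y"] \<open>nsq y = _\<close> by simp
qed

text \<open>Double count of the squared entries: every column contributes 1, and every row at most 1
  by Bessel applied to a unit vector. The bound supplies the finiteness in
  \<open>subsp_basis\<close> and \<open>ascent_exists\<close>.\<close>

lemma isom_mat_le:
  assumes V: "isom_mat n m V"
  shows "m \<le> n"
proof -
  note D = isom_matD[OF V]
  have row: "(\<Sum>j<m. (cmod (V $$ (i, j)))\<^sup>2) \<le> 1" if i: "i < n" for i
  proof -
    have "nsq (adj V *\<^sub>v unit_vec n i) \<le> nsq (unit_vec n i)"
      by (rule isom_mat_bessel[OF V]) simp
    moreover have "nsq (unit_vec n i) = (\<Sum>k<n. if k = i then 1 else 0)"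
      unfolding nsq_def using i by (intro sum.cong) auto
    moreover have "nsq (adj V *\<^sub>v unit_vec n i) = (\<Sum>j<m. (cmod (V $$ (i, j)))\<^sup>2)"
      unfolding nsq_def using D i by (auto intro!: sum.cong simp: scalar_prod_right_unit)
    ultimately show ?thesis using i by simp
  qed
  have col: "(\<Sum>i<n. (cmod (V $$ (i, j)))\<^sup>2) = 1" if j: "j < m" for j
    using isom_mat_col_ip[OF V j j] D j
    by (simp add: ip_self nsq_def flip: of_real_power of_real_sum)
  have "real m = (\<Sum>j<m. \<Sum>i<n. (cmod (V $$ (i, j)))\<^sup>2)"
    using col by simp
  also have "\<dots> = (\<Sum>i<n. \<Sum>j<m. (cmod (V $$ (i, j)))\<^sup>2)"
    by (rule sum.swap)
  also have "\<dots> \<le> (\<Sum>i<n. 1)"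
    by (rule sum_mono) (use row in auto)
  finally show ?thesis by simp
qed

text \<open>One Gram-Schmidt step. The formula for \<open>W *\<^sub>v c\<close> is kept because
  callers must see in which subspace the enlarged range lies.\<close>

lemma isom_mat_snoc:
  assumes V: "isom_mat n m V" and u: "u \<in> carrier_vec n" "nsq u = 1" "adj V *\<^sub>v u = 0\<^sub>v m"
  obtains W where "isom_mat n (Suc m) W"
    "\<And>c. c \<in> carrier_vec (Suc m) \<Longrightarrow>
       W *\<^sub>v c = V *\<^sub>v vec m (\<lambda>j. c $ j) + c $ m \<cdot>\<^sub>v u"
proof
  note D = isom_matD[OF V]
  define W where "W = mat n (Suc m) (\<lambda>(i, j). if j < m then V $$ (i, j) else u $ i)"
  have col: "col W j = (if j < m then col V j else u)" if "j < Suc m" for j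
    using that D u by (auto simp: W_def)
  have uV: "u \<bullet>c col V j = 0" "col V j \<bullet>c u = 0" if "j < m" for j
  proof -
    have "(adj V *\<^sub>v u) $ j = u \<bullet>c col V j"
      using that D(1-3) u(1) by (auto simp: scalar_prod_def mult.commute intro!: sum.cong)
    then show "u \<bullet>c col V j = 0" using u that by simp
    then show "col V j \<bullet>c u = 0" 
      using ip_cnj[of "u" "col V j"] D u that by auto
  qed
  show "isom_mat n (Suc m) W"
  proof (rule isom_matI)
    fix i j assume "i < Suc m" "j < Suc m"
    then show "col W i \<bullet>c col W j = (if i = j then 1 else 0)"
      using isom_mat_col_ip[OF V] uV u(2) by (cases "i < m"; cases "j < m") (auto simp: col ip_self)
  qed (auto simp: W_def)
  show "W *\<^sub>v c = V *\<^sub>v vec m (\<lambda>j. c $ j) + c $ m \<cdot>\<^sub>v u" if "c \<in> carrier_vec (Suc m)" for c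
  proof (rule eq_vecI)
    fix i assume "i < dim_vec (V *\<^sub>v vec m (($) c) + c $ m \<cdot>\<^sub>v u)"
    then have "i < n" using u by simp
    then show "(W *\<^sub>v c) $ i = (V *\<^sub>v vec m (($) c) + c $ m \<cdot>\<^sub>v u) $ i"
      using D u that by (simp add: W_def scalar_prod_def)
  next
    show "dim_vec (W *\<^sub>v c) = dim_vec (V *\<^sub>v vec m (($) c) + c $ m \<cdot>\<^sub>v u)"
      using u(1) by (simp add: W_def)
  qed
qed

lemma isom_mat_0: "isom_mat n 0 (0\<^sub>m n 0)"
  by (rule isom_matI) auto

text \<open>A largest orthonormal family inside \<open>S\<close> spans \<open>S\<close>: if some x
  in \<open>S\<close> had a nonzero residual, the normalized residual would be one more orthonormal
  vector in \<open>S\<close>.\<close>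

theorem subsp_basis:
  assumes S: "subsp n S"
  obtains m V where "isom_mat n m V" "\<forall>c\<in>carrier_vec m. V *\<^sub>v c \<in> S"
    "\<forall>x\<in>S. V *\<^sub>v (adj V *\<^sub>v x) = x"
proof -
  define P where "P m \<longleftrightarrow> (\<exists>V. isom_mat n m V \<and> (\<forall>c\<in>carrier_vec m. V *\<^sub>v c \<in> S))" for m
  have "P 0"
    unfolding P_def
  proof (intro exI conjI ballI)
    show "isom_mat n 0 (0\<^sub>m n 0)" by (rule isom_mat_0)
    show "0\<^sub>m n 0 *\<^sub>v c \<in> S" if "c \<in> carrier_vec 0" for c
      using subspD(2)[OF S] that by simp
  qed
  moreover have "\<And>m. P m \<Longrightarrow> m \<le> n"
    using isom_mat_le by (auto simp: P_def)
  ultimately have "\<exists>m. P m \<and> (\<forall>k. P k \<longrightarrow> k \<le> m)"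
    by (intro ex_has_greatest_nat[of P 0 "\<lambda>m. m" "Suc n"]) (auto simp: less_Suc_eq_le)
  then obtain m where m: "P m" "\<And>k. P k \<Longrightarrow> k \<le> m"
    by auto
  from m(1) obtain V where V: "isom_mat n m V" and VS': "\<forall>c\<in>carrier_vec m. V *\<^sub>v c \<in> S"
    unfolding P_def by blast
  from VS' have VS: "\<And>c. c \<in> carrier_vec m \<Longrightarrow> V *\<^sub>v c \<in> S" by simp
  note D = isom_matD[OF V]
  have proj: "V *\<^sub>v (adj V *\<^sub>v x) = x" if x: "x \<in> S" for x
  proof (rule ccontr)
    assume neq: "V *\<^sub>v (adj V *\<^sub>v x) \<noteq> x"
    have xc: "x \<in> carrier_vec n" by (rule subspD(1)[OF S x])
    define d where "d = x - V *\<^sub>v (adj V *\<^sub>v x)"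
    have ax: "adj V *\<^sub>v x \<in> carrier_vec m" using D xc by auto
    have d: "d \<in> carrier_vec n" using xc D by (auto simp: d_def)
    have dS: "d \<in> S" unfolding d_def by (intro subsp_diff[OF S] x VS ax)
    have d0: "d \<noteq> 0\<^sub>v n"
    proof
      assume "d = 0\<^sub>v n"
      then have "x - V *\<^sub>v (adj V *\<^sub>v x) = 0\<^sub>v n" by (simp add: d_def)
      then have "(x - V *\<^sub>v (adj V *\<^sub>v x)) + V *\<^sub>v (adj V *\<^sub>v x) = 0\<^sub>v n + V *\<^sub>v (adj V *\<^sub>v x)"
        by simp
      moreover have "(x - V *\<^sub>v (adj V *\<^sub>v x)) + V *\<^sub>v (adj V *\<^sub>v x) = x"
        using xc D(2) by (intro eq_vecI) simp_all
      ultimately have "V *\<^sub>v (adj V *\<^sub>v x) = x"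
        using D(2) by simp
      then show False using neq by simp
    qed
    obtain c where c: "nsq (complex_of_real c \<cdot>\<^sub>v d) = 1"
      using nsq_normalize[OF d d0] by blast
    define u where "u = complex_of_real c \<cdot>\<^sub>v d"
    have Vd: "adj V *\<^sub>v d = 0\<^sub>v m"
    proof (rule vec_eq_by_ip)
      fix w :: "complex vec" assume w: "w \<in> carrier_vec m"
      show "(adj V *\<^sub>v d) \<bullet>c w = 0\<^sub>v m \<bullet>c w"
        using isom_mat_orth_residual[OF V xc w] D d w
        by (simp add: ip_adj' flip: d_def)
    qed (use D d in auto)
    have u: "u \<in> carrier_vec n" "nsq u = 1" "u \<in> S"
      using d c subsp_smult[OF S dS] by (auto simp: u_def)
    have "adj V *\<^sub>v u = 0\<^sub>v m"
      using Vd d mult_mat_vec[of "adj V" m n d] adj_carrier[OF D(1)] by (simp add: u_def)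
    from isom_mat_snoc[OF V u(1,2) this] obtain W where W: "isom_mat n (Suc m) W"
      "\<And>c. c \<in> carrier_vec (Suc m) \<Longrightarrow> W *\<^sub>v c = V *\<^sub>v vec m (\<lambda>j. c $ j) + c $ m \<cdot>\<^sub>v u"
      by blast
    have "P (Suc m)"
      unfolding P_def
    proof (intro exI conjI ballI)
      show "isom_mat n (Suc m) W" by (rule W(1))
    next
      fix c :: "complex vec" assume "c \<in> carrier_vec (Suc m)"
      then show "W *\<^sub>v c \<in> S"
        using subspD(3)[OF S VS u(3)] W(2)[of c] by simp
    qed
    then show False using m(2) by force
  qed
  then show thesis using that[OF V VS'] by simp
qed

lemma subsp_carrier: "subsp n (carrier_vec n)"
  by (auto simp: subsp_def)

lemma subsp_kernel:
  assumes "A \<in> carrier_mat m n"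
  shows "subsp n (mat_kernel A)"
  unfolding subsp_def
proof (intro conjI ballI allI)
  show "mat_kernel A \<subseteq> carrier_vec n" by (rule mat_kernel_carrier[OF assms])
  show "0\<^sub>v n \<in> mat_kernel A" by (rule mat_kernelI[OF assms]) (use assms in auto)
  fix x y c assume x: "x \<in> mat_kernel A" and y: "y \<in> mat_kernel A"
  from mat_kernelD[OF assms x] mat_kernelD[OF assms y] show "x + c \<cdot>\<^sub>v y \<in> mat_kernel A"
    by (intro mat_kernelI[OF assms])
       (simp_all add: mult_add_distrib_mat_vec[OF assms] mult_mat_vec[OF assms])
qed

section \<open>Partial isometries, kernels of powers and the ascent\<close>

lemma nsq_add:
  assumes "dim_vec x = dim_vec y"
  shows "nsq (x + y) = nsq x + nsq y + 2 * Re (x \<bullet>c y)"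
proof -
  have "complex_of_real (nsq (x + y)) = complex_of_real (nsq x) + complex_of_real (nsq y) + (x \<bullet>c y + cnj (x \<bullet>c y))"
    using assms ip_cnj[of x y] by (simp add: ip_linear flip: ip_self)
  then have "Re (complex_of_real (nsq (x + y))) = Re (complex_of_real (nsq x) + complex_of_real (nsq y) + (x \<bullet>c y + cnj (x \<bullet>c y)))"
    by (rule arg_cong)
  then show ?thesis by simp
qed

lemma orth_complementD:
  assumes "x \<in> orth_complement n S"
  shows "x \<in> carrier_vec n" "y \<in> S \<Longrightarrow> x \<bullet>c y = 0"
  using assms by (auto simp: orth_complement_def)

lemma orth_complementI:
  "x \<in> carrier_vec n \<Longrightarrow> (\<And>y. y \<in> S \<Longrightarrow> x \<bullet>c y = 0) \<Longrightarrow> x \<in> orth_complement n S"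
  by (auto simp: orth_complement_def)

lemma orth_complement_antimono: "S \<subseteq> T \<Longrightarrow> orth_complement n T \<subseteq> orth_complement n S"
  by (auto simp: orth_complement_def)

lemma subsp_orth_complement:
  assumes "S \<subseteq> carrier_vec n"
  shows "subsp n (orth_complement n S)"
  unfolding subsp_def
proof (intro conjI ballI allI)
  show "orth_complement n S \<subseteq> carrier_vec n" by (auto simp: orth_complement_def)
  show "0\<^sub>v n \<in> orth_complement n S"
    using assms by (intro orth_complementI) auto
  fix x y c assume x: "x \<in> orth_complement n S" and y: "y \<in> orth_complement n S"
  have "x \<in> carrier_vec n" "y \<in> carrier_vec n"
    using x y by (auto simp: orth_complement_def)
  then show "x + c \<cdot>\<^sub>v y \<in> orth_complement n S"
    using x y assms by (intro orth_complementI) (auto simp: orth_complement_def ip_linear)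
qed

lemma subsp_projection:
  assumes S: "subsp n S"
  obtains Q where "Q \<in> carrier_mat n n" "adj Q = Q"
    "\<forall>x\<in>carrier_vec n. Q *\<^sub>v x \<in> S"
    "\<forall>x\<in>S. Q *\<^sub>v x = x"
    "\<forall>x\<in>carrier_vec n. x - Q *\<^sub>v x \<in> orth_complement n S"
    "\<forall>x\<in>orth_complement n S. Q *\<^sub>v x = 0\<^sub>v n"
proof -
  obtain m V where V: "isom_mat n m V" "\<forall>c\<in>carrier_vec m. V *\<^sub>v c \<in> S"
    "\<forall>x\<in>S. V *\<^sub>v (adj V *\<^sub>v x) = x"
    by (rule subsp_basis[OF S])
  note D = isom_matD(1-3)[OF V(1)]
  define Q where "Q = V * adj V"
  have Q: "Q \<in> carrier_mat n n" "adj Q = Q"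
    using D by (auto simp: Q_def adj_mult)
  have Qx: "Q *\<^sub>v x = V *\<^sub>v (adj V *\<^sub>v x)" if "x \<in> carrier_vec n" for x
    unfolding Q_def using that D by (intro assoc_mult_mat_vec[of _ n m _ n]) auto
  have QS: "Q *\<^sub>v x \<in> S" if "x \<in> carrier_vec n" for x
    unfolding Qx[OF that] using D V(2) by simp
  have Qid: "Q *\<^sub>v x = x" if "x \<in> S" for x
    using Qx[OF subspD(1)[OF S that]] V(3) that by simp
  have Qip: "(Q *\<^sub>v x) \<bullet>c s = x \<bullet>c s" if "x \<in> carrier_vec n" "s \<in> S" for x s
    using ip_adj[of Q x s] Q that subspD(1)[OF S that(2)] Qid[OF that(2)] by simp
  show thesis
  proof (rule that[OF Q]; intro ballI)
    show "Q *\<^sub>v x \<in> S" if "x \<in> carrier_vec n" for x by (rule QS[OF that])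
    show "Q *\<^sub>v x = x" if "x \<in> S" for x by (rule Qid[OF that])
    fix x :: "complex vec" assume x: "x \<in> carrier_vec n"
    show "x - Q *\<^sub>v x \<in> orth_complement n S"
    proof (rule orth_complementI)
      fix s assume s: "s \<in> S"
      show "(x - Q *\<^sub>v x) \<bullet>c s = 0"
        using x Q subspD(1)[OF S s] Qip[OF x s] by (simp add: ip_diff_left)
    qed (use x Q in simp)
  next
    fix x assume x: "x \<in> orth_complement n S"
    then have xc: "x \<in> carrier_vec n" by (rule orth_complementD)
    have "(Q *\<^sub>v x) \<bullet>c (Q *\<^sub>v x) = 0"
      using Qip[OF xc QS[OF xc]] orth_complementD(2)[OF x QS[OF xc]] by simp
    then show "Q *\<^sub>v x = 0\<^sub>v n"
      using nsq_eq_0_iff[of "Q *\<^sub>v x" n] Q by (simp add: ip_self)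
  qed
qed

lemma vec_diff_add_cancel:
  "x \<in> carrier_vec n \<Longrightarrow> y \<in> carrier_vec n \<Longrightarrow> y + (x - y) = (x :: complex vec)"
  by (intro eq_vecI) auto

lemma orth_decomp:
  assumes "subsp n S" "x \<in> carrier_vec n"
  obtains k u where "k \<in> S" "u \<in> orth_complement n S" "x = k + u" "k \<bullet>c u = 0"
proof -
  obtain Q where Q: "Q \<in> carrier_mat n n" "Q *\<^sub>v x \<in> S" "x - Q *\<^sub>v x \<in> orth_complement n S"
    using subsp_projection[OF assms(1)] assms(2) by metis
  have "x = Q *\<^sub>v x + (x - Q *\<^sub>v x)"
    using vec_diff_add_cancel[OF assms(2), of "Q *\<^sub>v x"] Q by simp
  moreover have "(Q *\<^sub>v x) \<bullet>c (x - Q *\<^sub>v x) = 0"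
    using orth_complementD(2)[OF Q(3,2)] ip_cnj[of "x - Q *\<^sub>v x" "Q *\<^sub>v x"] Q(1) assms(2) by simp
  ultimately show thesis using that Q by blast
qed

text \<open>Applied to the kernels of consecutive powers, this yields the generators of
  chains.\<close>

lemma unit_vec_between:
  assumes S: "subsp n S" and T: "subsp n T" and "S \<subseteq> T" "S \<noteq> T"
  obtains u where "u \<in> T" "nsq u = 1" "u \<in> orth_complement n S"
proof -
  obtain x where x: "x \<in> T" "x \<notin> S" using assms by auto
  have xc: "x \<in> carrier_vec n" by (rule subspD(1)[OF T x(1)])
  obtain k u where ku: "k \<in> S" "u \<in> orth_complement n S" "x = k + u"
    using orth_decomp[OF S xc] by blast
  have k: "k \<in> carrier_vec n" by (rule subspD(1)[OF S ku(1)])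
  have u: "u \<in> carrier_vec n" by (rule orth_complementD(1)[OF ku(2)])
  have "u \<noteq> 0\<^sub>v n" using ku x k by auto
  then obtain c where c: "nsq (complex_of_real c \<cdot>\<^sub>v u) = 1"
    using nsq_normalize[OF u] by blast
  have "u = x - k" using ku(3) k u by auto
  then have "u \<in> T" using subsp_diff[OF T x(1)] ku(1) assms(3) by auto
  show thesis
  proof (rule that[OF _ c])
    show "complex_of_real c \<cdot>\<^sub>v u \<in> T" by (rule subsp_smult[OF T \<open>u \<in> T\<close>])
    have "S \<subseteq> carrier_vec n" using subspD(1)[OF S] by auto
    then show "complex_of_real c \<cdot>\<^sub>v u \<in> orth_complement n S"
      by (intro subsp_smult[OF subsp_orth_complement] ku(2))
  qed
qed

lemma partial_isometryD:
  assumes "partial_isometry A" "A \<in> carrier_mat n n" "x \<in> orth_complement n (mat_kernel A)"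
  shows "nsq (A *\<^sub>v x) = nsq x"
  using assms unfolding partial_isometry_def by (auto simp: vec_norm_eq_iff)

lemma partial_isometryI:
  assumes "A \<in> carrier_mat n n"
    and "\<And>x. x \<in> orth_complement n (mat_kernel A) \<Longrightarrow> nsq (A *\<^sub>v x) = nsq x"
  shows "partial_isometry A"
  using assms unfolding partial_isometry_def by (auto simp: vec_norm_eq_iff)

text \<open>Polarization with a well chosen vector. The defect z = adj A A y - y is again orthogonal
  to the kernel, so norms are preserved at y, z and y + z. Comparison gives Re <Ay, Az> = Re <y, z>,
  while by the choice of z these inner products differ by <z, z>.\<close>

lemma partial_isometry_adj:
  assumes PI: "partial_isometry A" and A: "A \<in> carrier_mat n n"
    and y: "y \<in> orth_complement n (mat_kernel A)"
  shows "adj A *\<^sub>v (A *\<^sub>v y) = y"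
proof -
  have yc: "y \<in> carrier_vec n" by (rule orth_complementD[OF y])
  have d: "dim_row A = n" "dim_col A = n" "dim_vec y = n" using A yc by auto
  define z where "z = adj A *\<^sub>v (A *\<^sub>v y) - y"
  have zc: "z \<in> carrier_vec n" using d yc by (simp add: z_def)
  have zk: "z \<in> orth_complement n (mat_kernel A)"
  proof (rule orth_complementI[OF zc])
    fix k assume k: "k \<in> mat_kernel A"
    note k' = mat_kernelD[OF A k]
    have "z \<bullet>c k = (A *\<^sub>v y) \<bullet>c (A *\<^sub>v k) - y \<bullet>c k"
      unfolding z_def using d k' ip_adj'[of A "A *\<^sub>v y" k] by (simp add: ip_diff_left)
    then show "z \<bullet>c k = 0" using k' d orth_complementD(2)[OF y k] by simp
  qed
  have "subsp n (orth_complement n (mat_kernel A))"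
    by (intro subsp_orth_complement mat_kernel_carrier[OF A])
  then have yz: "y + z \<in> orth_complement n (mat_kernel A)"
    using subspD(3)[OF _ y zk, of n 1] by simp
  have "A *\<^sub>v (y + z) = A *\<^sub>v y + A *\<^sub>v z"
    by (rule mult_add_distrib_mat_vec[OF A yc zc])
  then have "nsq (A *\<^sub>v y) + nsq (A *\<^sub>v z) + 2 * Re ((A *\<^sub>v y) \<bullet>c (A *\<^sub>v z)) = nsq y + nsq z + 2 * Re (y \<bullet>c z)"
    using partial_isometryD[OF PI A yz] nsq_add[of y z] nsq_add[of "A *\<^sub>v y" "A *\<^sub>v z"] yc zc
    by simp
  then have "Re ((A *\<^sub>v y) \<bullet>c (A *\<^sub>v z)) = Re (y \<bullet>c z)"
    using partial_isometryD[OF PI A y] partial_isometryD[OF PI A zk] by simp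
  moreover have "(A *\<^sub>v y) \<bullet>c (A *\<^sub>v z) - y \<bullet>c z = z \<bullet>c z"
  proof -
    have "z \<bullet>c z = (adj A *\<^sub>v (A *\<^sub>v y)) \<bullet>c z - y \<bullet>c z"
      using d zc by (subst (1) z_def, subst ip_diff_left) auto
    then show ?thesis using d zc ip_adj'[of A "A *\<^sub>v y" z] by simp
  qed
  ultimately have "Re (z \<bullet>c z) = 0"
    by (metis minus_complex.sel(1) right_minus_eq)
  then have "z = 0\<^sub>v n"
    using nsq_eq_0_iff[OF zc] by (simp add: ip_self)
  have "y + z = adj A *\<^sub>v (A *\<^sub>v y)"
    unfolding z_def using d by (intro vec_diff_add_cancel[of _ n] yc) simp
  then show ?thesis using \<open>z = 0\<^sub>v n\<close> yc by simp
qed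

lemma partial_isometry_nsq_decomp:
  assumes PI: "partial_isometry A" and A: "A \<in> carrier_mat n n" and x: "x \<in> carrier_vec n"
  obtains k where "k \<in> mat_kernel A" "nsq x = nsq k + nsq (A *\<^sub>v x)"
    "x - k \<in> orth_complement n (mat_kernel A)"
proof -
  obtain k u where ku: "k \<in> mat_kernel A" "u \<in> orth_complement n (mat_kernel A)" "x = k + u" "k \<bullet>c u = 0"
    by (rule orth_decomp[OF subsp_kernel[OF A] x])
  have k: "k \<in> carrier_vec n" "A *\<^sub>v k = 0\<^sub>v n" by (rule mat_kernelD[OF A ku(1)])+
  have u: "u \<in> carrier_vec n" by (rule orth_complementD(1)[OF ku(2)])
  have "A *\<^sub>v x = A *\<^sub>v u"
    using mult_add_distrib_mat_vec[OF A k(1) u] k A u by (simp add: ku(3))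
  then have "nsq x = nsq k + nsq (A *\<^sub>v x)"
    using nsq_add[of k u] k u ku(4) partial_isometryD[OF PI A ku(2)] by (simp add: ku(3))
  moreover have "x - k = u" using ku(3) k u by auto
  ultimately show thesis using that[OF ku(1)] ku(2) by simp
qed

text \<open>The squared norm lost under a partial isometry is that of the kernel component, so
  equality of norms detects membership in the complement. This converse carries orthogonality along
  a chain.\<close>

lemma partial_isometry_orth:
  assumes "partial_isometry A" "A \<in> carrier_mat n n" "x \<in> carrier_vec n" "nsq (A *\<^sub>v x) = nsq x"
  shows "x \<in> orth_complement n (mat_kernel A)"
proof -
  obtain k where k: "k \<in> mat_kernel A" "nsq x = nsq k + nsq (A *\<^sub>v x)"
    "x - k \<in> orth_complement n (mat_kernel A)"
    by (rule partial_isometry_nsq_decomp[OF assms(1-3)])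
  then have "k = 0\<^sub>v n"
    using assms(4) nsq_eq_0_iff mat_kernelD(1)[OF assms(2) k(1)] by auto
  then show ?thesis using k(3) assms(3) by simp
qed

section \<open>Kernels of powers, chains and the ascent\<close>

lemma pow_kernel_mono:
  assumes A: "A \<in> carrier_mat n n" and "i \<le> j"
  shows "mat_kernel (A ^\<^sub>m i) \<subseteq> mat_kernel (A ^\<^sub>m j)"
proof -
  have "A ^\<^sub>m j = A ^\<^sub>m (j - i) * A ^\<^sub>m i"
    using pow_mat_plus[OF A, of "j - i" i] assms(2) by simp
  then show ?thesis
    using mat_kernel_mult_subset[of "A ^\<^sub>m i" n n "A ^\<^sub>m (j - i)" n] A by simp
qed

lemma pow_kernel_iff:
  assumes "A \<in> carrier_mat n n"
  shows "x \<in> mat_kernel (A ^\<^sub>m i) \<longleftrightarrow> x \<in> carrier_vec n \<and> A ^\<^sub>m i *\<^sub>v x = 0\<^sub>v n"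
  using mat_kernel[of "A ^\<^sub>m i" n n] assms by simp

lemma pow_kernel_shift:
  assumes "A \<in> carrier_mat n n" "x \<in> mat_kernel (A ^\<^sub>m (i + j))"
  shows "A ^\<^sub>m j *\<^sub>v x \<in> mat_kernel (A ^\<^sub>m i)"
  using assms pow_mat_mult_vec[OF assms(1), of x i j] by (simp add: pow_kernel_iff)

text \<open>A chain of length m + 1 involves the powers up to \<open>m\<close> only: its generator
  is orthogonal to ker A^m and lies in ker A^(m+1).\<close>

locale power_pi =
  fixes n :: nat and A :: "complex mat" and m :: nat
  assumes A [simp]: "A \<in> carrier_mat n n"
    and pi: "j \<le> m \<Longrightarrow> partial_isometry (A ^\<^sub>m j)"
begin

lemma dims [simp]: "dim_row A = n" "dim_col A = n"
  using carrier_matD[OF A] by auto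

lemma orth_mono:
  "i \<le> j \<Longrightarrow> h \<in> orth_complement n (mat_kernel (A ^\<^sub>m j)) \<Longrightarrow> h \<in> orth_complement n (mat_kernel (A ^\<^sub>m i))"
  using orth_complement_antimono[OF pow_kernel_mono[OF A]] by blast

lemma nsq_pow:
  assumes "h \<in> orth_complement n (mat_kernel (A ^\<^sub>m m))" "i \<le> m"
  shows "nsq (A ^\<^sub>m i *\<^sub>v h) = nsq h"
  by (rule partial_isometryD[OF pi[OF assms(2)] _ orth_mono[OF assms(2,1)]]) simp

text \<open>A^k preserves the norm of A^i h, because A^(k+i) and A^i both preserve that of h. Then
  \<open>partial_isometry_orth\<close> applies to A^k.\<close>

lemma pow_orth:
  assumes h: "h \<in> orth_complement n (mat_kernel (A ^\<^sub>m m))" and "i + k \<le> m"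
  shows "A ^\<^sub>m i *\<^sub>v h \<in> orth_complement n (mat_kernel (A ^\<^sub>m k))"
proof (rule partial_isometry_orth)
  have "h \<in> carrier_vec n" by (rule orth_complementD[OF h])
  then have "A ^\<^sub>m k *\<^sub>v (A ^\<^sub>m i *\<^sub>v h) = A ^\<^sub>m (k + i) *\<^sub>v h"
    by (simp add: pow_mat_mult_vec[OF A])
  then show "nsq (A ^\<^sub>m k *\<^sub>v (A ^\<^sub>m i *\<^sub>v h)) = nsq (A ^\<^sub>m i *\<^sub>v h)"
    using nsq_pow[OF h] assms(2) by simp
qed (use pi assms in auto)

text \<open>Since i + 1 <= m, the vector A^i h is orthogonal to ker A and
  \<open>partial_isometry_adj\<close> applies. Nothing is claimed about the value of
  \<open>adj A\<close> at h itself; this free end is the source of the boundary term met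
  later.\<close>

lemma adj_pow_Suc:
  assumes h: "h \<in> orth_complement n (mat_kernel (A ^\<^sub>m m))" and "i < m"
  shows "adj A *\<^sub>v (A ^\<^sub>m Suc i *\<^sub>v h) = A ^\<^sub>m i *\<^sub>v h"
proof -
  have hc: "h \<in> carrier_vec n" by (rule orth_complementD[OF h])
  have "A ^\<^sub>m 1 = A" by (simp add: left_mult_one_mat)
  then have "partial_isometry A" "A ^\<^sub>m i *\<^sub>v h \<in> orth_complement n (mat_kernel A)"
    using pi[of 1] pow_orth[OF h, of i 1] assms(2) by auto
  then show ?thesis
    unfolding pow_mat_mult_vec_Suc[OF A hc] by (intro partial_isometry_adj[OF _ A])
qed

end

text \<open>If every inclusion were strict, each power would add a unit vector orthogonal to the
  previous kernel, giving more than n orthonormal vectors. Without existence the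
  \<open>LEAST\<close> in \<open>ascent\<close> would carry no information.\<close>

lemma ascent_exists:
  fixes A :: "complex mat"
  assumes A: "A \<in> carrier_mat n n"
  shows "\<exists>k. mat_kernel (A ^\<^sub>m k) = mat_kernel (A ^\<^sub>m (k + 1))"
proof (rule ccontr)
  assume neq: "\<not> ?thesis"
  have Ak: "A ^\<^sub>m k \<in> carrier_mat n n" for k using A by simp
  have "\<exists>V. isom_mat n k V \<and> (\<forall>c\<in>carrier_vec k. V *\<^sub>v c \<in> mat_kernel (A ^\<^sub>m k))" for k
  proof (induction k)
    case 0
    show ?case
    proof (intro exI conjI ballI)
      show "isom_mat n 0 (0\<^sub>m n 0)" by (rule isom_mat_0)
      show "0\<^sub>m n 0 *\<^sub>v c \<in> mat_kernel (A ^\<^sub>m 0)" if "c \<in> carrier_vec 0" for c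
        using subspD(2)[OF subsp_kernel[OF Ak[of 0]]] that by simp
    qed
  next
    case (Suc k)
    then obtain V where V: "isom_mat n k V" "\<And>c. c \<in> carrier_vec k \<Longrightarrow> V *\<^sub>v c \<in> mat_kernel (A ^\<^sub>m k)"
      by auto
    have sub: "mat_kernel (A ^\<^sub>m k) \<subseteq> mat_kernel (A ^\<^sub>m Suc k)"
      by (rule pow_kernel_mono[OF A]) simp
    obtain u where u: "u \<in> mat_kernel (A ^\<^sub>m Suc k)" "nsq u = 1"
      "u \<in> orth_complement n (mat_kernel (A ^\<^sub>m k))"
      using unit_vec_between[OF subsp_kernel[OF Ak] subsp_kernel[OF Ak] sub] neq by auto
    have uc: "u \<in> carrier_vec n" by (rule orth_complementD[OF u(3)])
    note D = isom_matD(2,3)[OF V(1)]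
    have "adj V *\<^sub>v u = 0\<^sub>v k"
    proof (rule vec_eq_by_ip)
      fix w :: "complex vec" assume w: "w \<in> carrier_vec k"
      show "(adj V *\<^sub>v u) \<bullet>c w = 0\<^sub>v k \<bullet>c w"
        using ip_adj'[of V u w] D w uc orth_complementD(2)[OF u(3) V(2)[OF w]] by simp
    qed (use D in auto)
    from isom_mat_snoc[OF V(1) uc u(2) this] obtain W where W: "isom_mat n (Suc k) W"
      "\<And>c. c \<in> carrier_vec (Suc k) \<Longrightarrow> W *\<^sub>v c = V *\<^sub>v vec k (\<lambda>j. c $ j) + c $ k \<cdot>\<^sub>v u"
      by blast
    have "W *\<^sub>v c \<in> mat_kernel (A ^\<^sub>m Suc k)" if "c \<in> carrier_vec (Suc k)" for c
      unfolding W(2)[OF that]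
      by (intro subspD(3)[OF subsp_kernel[OF Ak]] u(1) subsetD[OF sub] V(2)) simp
    with W(1) show ?case by blast
  qed
  then obtain V where "isom_mat n (Suc n) V" by blast
  from isom_mat_le[OF this] show False by simp
qed

text \<open>With j = k - a, the power A^j moves ker A^(k+1) into ker A^(a+1), which is ker
  A^a.\<close>

lemma ascent_kernel_eq:
  assumes A: "A \<in> carrier_mat n n" and "ascent A \<le> k"
  shows "mat_kernel (A ^\<^sub>m k) = mat_kernel (A ^\<^sub>m ascent A)"
  using assms(2)
proof (induction k rule: dec_induct)
  case (step k)
  have *: "mat_kernel (A ^\<^sub>m ascent A) = mat_kernel (A ^\<^sub>m (ascent A + 1))"
    unfolding ascent_def using LeastI_ex[OF ascent_exists[OF A]] .
  have "mat_kernel (A ^\<^sub>m Suc k) \<subseteq> mat_kernel (A ^\<^sub>m k)"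
  proof
    fix x assume x: "x \<in> mat_kernel (A ^\<^sub>m Suc k)"
    define j where "j = k - ascent A"
    have k: "k = ascent A + j" using step by (simp add: j_def)
    have "A ^\<^sub>m j *\<^sub>v x \<in> mat_kernel (A ^\<^sub>m ascent A)"
      unfolding * by (rule pow_kernel_shift[OF A]) (use x k in simp)
    then show "x \<in> mat_kernel (A ^\<^sub>m k)"
      using x pow_mat_mult_vec[OF A, of x "ascent A" j] unfolding pow_kernel_iff[OF A] k by simp
  qed
  then show ?case using step pow_kernel_mono[OF A, of k "Suc k"] by auto
qed auto

lemma ascent_le:
  assumes "mat_kernel (A ^\<^sub>m k) = mat_kernel (A ^\<^sub>m (k + 1))"
  shows "ascent A \<le> k"
  unfolding ascent_def by (rule Least_le) (rule assms)

lemma ascent_unit_vec: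
  assumes A: "A \<in> carrier_mat n n" and "ascent A = Suc k"
  obtains h where "h \<in> mat_kernel (A ^\<^sub>m Suc k)" "nsq h = 1"
    "h \<in> orth_complement n (mat_kernel (A ^\<^sub>m k))"
proof -
  have Ak: "A ^\<^sub>m k \<in> carrier_mat n n" for k using A by simp
  have "mat_kernel (A ^\<^sub>m k) \<noteq> mat_kernel (A ^\<^sub>m Suc k)"
    using ascent_le[of A k] assms(2) by auto
  then show thesis
    using unit_vec_between[OF subsp_kernel[OF Ak] subsp_kernel[OF Ak] pow_kernel_mono[OF A, of k "Suc k"]] that
    by auto
qed

section \<open>Quadratic matrix pencils\<close>

lemma mv_add:
  fixes A B :: "complex mat"
  assumes "dim_row A = dim_row B" "dim_col A = dim_col B" "dim_vec x = dim_col B"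
  shows "(A + B) *\<^sub>v x = A *\<^sub>v x + B *\<^sub>v x"
  using add_mult_distrib_mat_vec[of A "dim_row B" "dim_col B" B x] assms
  by (metis carrier_matI carrier_vecI)

lemma mv_minus:
  fixes A B :: "complex mat"
  assumes "dim_row A = dim_row B" "dim_col A = dim_col B" "dim_vec x = dim_col B"
  shows "(A - B) *\<^sub>v x = A *\<^sub>v x - B *\<^sub>v x"
  using minus_mult_distrib_mat_vec[of A "dim_row B" "dim_col B" B x] assms
  by (metis carrier_matI carrier_vecI)

lemma mv_mult:
  fixes A B :: "complex mat"
  assumes "dim_col A = dim_row B" "dim_vec x = dim_col B"
  shows "(A * B) *\<^sub>v x = A *\<^sub>v (B *\<^sub>v x)"
  using assoc_mult_mat_vec[of A "dim_row A" "dim_row B" B "dim_col B" x] assms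
  by (metis carrier_matI carrier_vecI)

lemma mv_smult:
  fixes A :: "complex mat"
  assumes "dim_vec x = dim_col A"
  shows "(c \<cdot>\<^sub>m A) *\<^sub>v x = c \<cdot>\<^sub>v (A *\<^sub>v x)"
  using assms by (intro eq_vecI) (simp_all add: scalar_prod_def sum_distrib_left mult.assoc)

lemma mv_vec_add:
  fixes A :: "complex mat"
  assumes "dim_vec x = dim_col A" "dim_vec y = dim_col A"
  shows "A *\<^sub>v (x + y) = A *\<^sub>v x + A *\<^sub>v y"
  using mult_add_distrib_mat_vec[of A "dim_row A" "dim_col A" x y] assms
  by (metis carrier_matI carrier_vecI)

lemma mv_vec_minus:
  fixes A :: "complex mat"
  assumes "dim_vec x = dim_col A" "dim_vec y = dim_col A"
  shows "A *\<^sub>v (x - y) = A *\<^sub>v x - A *\<^sub>v y"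
  using mult_minus_distrib_mat_vec[of A "dim_row A" "dim_col A" x y] assms
  by (metis carrier_matI carrier_vecI)

lemma mv_vec_smult:
  fixes A :: "complex mat"
  assumes "dim_vec x = dim_col A"
  shows "A *\<^sub>v (c \<cdot>\<^sub>v x) = c \<cdot>\<^sub>v (A *\<^sub>v x)"
  using mult_mat_vec[of A "dim_row A" "dim_col A" x c] assms
  by (metis carrier_matI carrier_vecI)

lemmas mv_linear = mv_add mv_minus mv_mult mv_smult mv_vec_add mv_vec_minus mv_vec_smult

text \<open>The determinant of the pencil is a polynomial in z. Infinitely many zeros make it vanish
  identically, in particular at z = 0, a point that need not belong to \<open>Z\<close>.\<close>

lemma quadratic_pencil_det_0:
  fixes M0 M1 M2 :: "complex mat"
  assumes M: "M0 \<in> carrier_mat n n" "M1 \<in> carrier_mat n n" "M2 \<in> carrier_mat n n"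
    and "infinite Z"
    and singular: "\<And>z. z \<in> Z \<Longrightarrow> \<exists>x. x \<in> carrier_vec n \<and> x \<noteq> 0\<^sub>v n \<and>
      M0 *\<^sub>v x + z \<cdot>\<^sub>v (M1 *\<^sub>v x) + z\<^sup>2 \<cdot>\<^sub>v (M2 *\<^sub>v x) = 0\<^sub>v n"
  shows "det M0 = 0"
proof -
  define P where "P = mat n n (\<lambda>ij. [:M0 $$ ij, M1 $$ ij, M2 $$ ij:])"
  have P: "P \<in> carrier_mat n n" by (simp add: P_def)
  have eval: "poly (det P) z = det (M0 + z \<cdot>\<^sub>m M1 + z\<^sup>2 \<cdot>\<^sub>m M2)" for z
  proof -
    have ev: "comm_ring_hom (\<lambda>p :: complex poly. poly p z)"
      by unfold_locales auto
    have "map_mat (\<lambda>p. poly p z) P = M0 + z \<cdot>\<^sub>m M1 + z\<^sup>2 \<cdot>\<^sub>m M2"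
      by (rule eq_matI) (use M in \<open>auto simp: P_def power2_eq_square algebra_simps\<close>)
    then show ?thesis using comm_ring_hom.hom_det[OF ev, of P] by simp
  qed
  have "poly (det P) z = 0" if z: "z \<in> Z" for z
  proof -
    obtain x where x: "x \<in> carrier_vec n" "x \<noteq> 0\<^sub>v n"
      "M0 *\<^sub>v x + z \<cdot>\<^sub>v (M1 *\<^sub>v x) + z\<^sup>2 \<cdot>\<^sub>v (M2 *\<^sub>v x) = 0\<^sub>v n"
      using singular[OF z] by blast
    have "M0 + z \<cdot>\<^sub>m M1 + z\<^sup>2 \<cdot>\<^sub>m M2 \<in> carrier_mat n n" using M by auto
    moreover have "(M0 + z \<cdot>\<^sub>m M1 + z\<^sup>2 \<cdot>\<^sub>m M2) *\<^sub>v x = 0\<^sub>v n"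
      using x M by (simp add: mv_linear)
    ultimately show ?thesis
      unfolding eval using x by (subst det_0_iff_vec_prod_zero) auto
  qed
  then have "det P = 0"
    using poly_roots_finite[of "det P"] \<open>infinite Z\<close> rev_finite_subset by blast
  then have "det (M0 + 0 \<cdot>\<^sub>m M1 + 0\<^sup>2 \<cdot>\<^sub>m M2) = 0" using eval[of 0] by simp
  moreover have "M0 + 0 \<cdot>\<^sub>m M1 + 0\<^sup>2 \<cdot>\<^sub>m M2 = M0"
    by (rule eq_matI) (use M in auto)
  ultimately show ?thesis by simp
qed

lemma det_adj_eq_0:
  assumes "G \<in> carrier_mat n n" "det (adj G) = 0"
  shows "det G = 0"
proof -
  have c: "comm_ring_hom cnj" by unfold_locales auto
  have "adj G = transpose_mat (map_mat cnj G)"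
    by (rule eq_matI) auto
  then have "det (adj G) = cnj (det G)"
    using det_transpose[of "map_mat cnj G" n] assms(1) comm_ring_hom.hom_det[OF c, of G] by simp
  then show ?thesis using assms(2) by simp
qed

text \<open>Index shift: \<open>cheb r (Suc k)\<close> is the Chebyshev polynomial $U_k$ at $r$.\<close>

fun cheb :: "real \<Rightarrow> nat \<Rightarrow> real" where
  "cheb r 0 = 0"
| "cheb r (Suc 0) = 1"
| "cheb r (Suc (Suc k)) = 2 * r * cheb r (Suc k) - cheb r k"

lemma cheb_cos: "cheb (cos \<phi>) k * sin \<phi> = sin (real k * \<phi>)"
proof (induction "cos \<phi>" k rule: cheb.induct)
  case (3 k)
  have "sin (real (Suc (Suc k)) * \<phi>) + sin (real k * \<phi>) = 2 * cos \<phi> * sin (real (Suc k) * \<phi>)"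
    using sin_plus_sin[of "real (Suc (Suc k)) * \<phi>" "real k * \<phi>"]
    by (simp add: algebra_simps add_divide_distrib)
  then show ?case using 3 by (simp add: algebra_simps)
qed auto

text \<open>Covers r >= 1, out of reach of the sine formula, which at r = 1 degenerates to 0 = 0.
  The induction needs the stronger claim that successive values grow by at least 1.\<close>

lemma cheb_mono: "r \<ge> 1 \<Longrightarrow> 0 \<le> cheb r k \<and> cheb r k + 1 \<le> cheb r (Suc k)"
proof (induction k)
  case (Suc k)
  have "2 * cheb r (Suc k) \<le> 2 * r * cheb r (Suc k)"
    using Suc mult_right_mono[of 1 r "cheb r (Suc k)"] by simp
  moreover have "0 \<le> cheb r k" "cheb r k + 1 \<le> cheb r (Suc k)" using Suc by auto
  ultimately show ?case unfolding cheb.simps by linarith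
qed simp

text \<open>With r = cos phi the hypothesis reads phi < pi/(m+1), so j phi stays strictly between 0
  and pi and both sines in \<open>cheb_cos\<close> are positive.\<close>

lemma cheb_pos:
  assumes r: "r > cos (pi / (real m + 1))" and j: "0 < j" "j \<le> Suc m"
  shows "cheb r j > 0"
proof (cases "r \<ge> 1")
  case True
  then show ?thesis using cheb_mono[of r "j - 1"] j by simp
next
  case False
  define \<phi> where "\<phi> = arccos r"
  have bnd: "0 \<le> pi / (real m + 1)" "pi / (real m + 1) \<le> pi" by (auto simp: field_simps)
  have "r > -1" using r cos_ge_minus_one[of "pi / (real m + 1)"] by linarith
  with False have c: "cos \<phi> = r" unfolding \<phi>_def by (intro cos_arccos) auto
  have "\<phi> < arccos (cos (pi / (real m + 1)))"
    unfolding \<phi>_def using r False by (intro arccos_less_arccos) auto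
  then have ub: "\<phi> < pi / (real m + 1)" using arccos_cos[OF bnd] by simp
  have lb: "\<phi> > 0" unfolding \<phi>_def using arccos_less_arccos[of r 1] False \<open>r > -1\<close> by simp
  have "real j * \<phi> \<le> (real m + 1) * \<phi>" using j lb by (intro mult_right_mono) auto
  also have "\<dots> < pi" using ub by (simp add: field_simps)
  finally have "sin (real j * \<phi>) > 0" using j lb by (intro sin_gt_zero) auto
  moreover have "sin \<phi> > 0" using lb ub bnd by (intro sin_gt_zero) auto
  ultimately show ?thesis using cheb_cos[of \<phi> j] c by (metis zero_less_mult_pos2)
qed

text \<open>The rescaled numbers z^k d_k obey the recursion of \<open>cheb\<close>, so each is
  \<open>cheb r (Suc k)\<close> times d_0. The conclusion compares the last two, cross-multiplied so
  that the unknown d_0 drops out.\<close>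

lemma cheb_recursion:
  fixes d :: "nat \<Rightarrow> complex"
  assumes z: "z \<noteq> 0"
    and d0: "z\<^sup>2 * d 1 = 2 * of_real r * z * d 0"
    and d: "\<And>k. Suc k \<le> m \<Longrightarrow> z\<^sup>2 * d (Suc (Suc k)) + d k = 2 * of_real r * z * d (Suc k)"
  shows "of_real (cheb r (Suc (Suc m))) * d m = z * of_real (cheb r (Suc m)) * d (Suc m)"
proof -
  have eq: "z ^ k * d k = of_real (cheb r (Suc k)) * d 0" if "k \<le> Suc m" for k
    using that
  proof (induction k rule: induct_nat_012)
    case 1
    have "z * (z * d 1) = z * (2 * of_real r * d 0)" using d0 by (simp add: power2_eq_square mult.assoc)
    then have "z * d 1 = 2 * of_real r * d 0" using z mult_left_cancel by blast
    then show ?case by simp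
  next
    case (ge2 k)
    have "z ^ Suc (Suc k) * d (Suc (Suc k)) = z ^ k * (z\<^sup>2 * d (Suc (Suc k)))"
      by (simp add: power2_eq_square)
    also have "z\<^sup>2 * d (Suc (Suc k)) = 2 * of_real r * z * d (Suc k) - d k"
      using d[of k] ge2 by (simp add: eq_diff_eq)
    also have "z ^ k * \<dots> = 2 * of_real r * (z ^ Suc k * d (Suc k)) - z ^ k * d k"
      by (simp add: algebra_simps)
    also have "\<dots> = 2 * of_real r * (of_real (cheb r (Suc (Suc k))) * d 0) - of_real (cheb r (Suc k)) * d 0"
      using ge2 by (simp only: Suc_leD)
    also have "\<dots> = of_real (cheb r (Suc (Suc (Suc k)))) * d 0"
      by (simp add: algebra_simps)
    finally show ?case .
  qed simp
  have "z ^ m * (of_real (cheb r (Suc (Suc m))) * d m) = of_real (cheb r (Suc (Suc m))) * (z ^ m * d m)"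
    by simp
  also have "\<dots> = of_real (cheb r (Suc m)) * (z ^ Suc m * d (Suc m))"
    using eq[of m] eq[of "Suc m"] by (simp del: cheb.simps power_Suc)
  also have "\<dots> = z ^ m * (z * of_real (cheb r (Suc m)) * d (Suc m))"
    by simp
  finally show ?thesis using z by simp
qed

text \<open>The equation 2 r x = z A x + cnj z adj A x of a vector at which a supporting line is
  touched, multiplied by z. As z cnj z = 1 on the unit circle, the conjugate disappears and the
  condition becomes polynomial in z.\<close>

definition pencil :: "complex mat \<Rightarrow> real \<Rightarrow> complex \<Rightarrow> complex vec \<Rightarrow> bool" where
  "pencil A r z x \<longleftrightarrow> x \<in> carrier_vec (dim_row A) \<and>
     (2 * of_real r * z) \<cdot>\<^sub>v x = z\<^sup>2 \<cdot>\<^sub>v (A *\<^sub>v x) + adj A *\<^sub>v x"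

lemma pencil_ip:
  assumes "pencil A r z x" "A \<in> carrier_mat n n" "y \<in> carrier_vec n"
  shows "z\<^sup>2 * ((A *\<^sub>v x) \<bullet>c y) + x \<bullet>c (A *\<^sub>v y) = 2 * of_real r * z * (x \<bullet>c y)"
proof -
  have x: "x \<in> carrier_vec n" and
    eq: "(2 * of_real r * z) \<cdot>\<^sub>v x = z\<^sup>2 \<cdot>\<^sub>v (A *\<^sub>v x) + adj A *\<^sub>v x"
    using assms by (auto simp: pencil_def)
  have d: "dim_row A = n" "dim_col A = n" "dim_vec x = n" "dim_vec y = n"
    using x assms by auto
  show ?thesis
    using arg_cong[OF eq, of "\<lambda>v. v \<bullet>c y"] d by (simp add: ip_linear ip_adj' mult.assoc)
qed

context power_pi
begin

text \<open>Pairing the pencil with the chain gives m + 1 equations for m + 2 numbers. They form a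
  three-term recursion, and what it leaves is one relation between the last two numbers, <x, h> and
  <A x, h>.\<close>

lemma pencil_chain:
  assumes x: "pencil A r z x" and z: "z \<noteq> 0"
    and h: "h \<in> orth_complement n (mat_kernel (A ^\<^sub>m m))" "h \<in> mat_kernel (A ^\<^sub>m Suc m)"
  shows "of_real (cheb r (Suc (Suc m))) * (x \<bullet>c h) = z * of_real (cheb r (Suc m)) * ((A *\<^sub>v x) \<bullet>c h)"
proof -
  have hc: "h \<in> carrier_vec n" by (rule orth_complementD[OF h(1)])
  have xc: "x \<in> carrier_vec n" using x by (simp add: pencil_def)
  have ipe: "z\<^sup>2 * ((A *\<^sub>v x) \<bullet>c (A ^\<^sub>m e *\<^sub>v h)) + x \<bullet>c (A ^\<^sub>m Suc e *\<^sub>v h) = 2 * of_real r * z * (x \<bullet>c (A ^\<^sub>m e *\<^sub>v h))" for e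
    using pencil_ip[OF x A, of "A ^\<^sub>m e *\<^sub>v h"] A unfolding pow_mat_mult_vec_Suc[OF A hc] by simp
  have shift: "(A *\<^sub>v x) \<bullet>c (A ^\<^sub>m Suc e *\<^sub>v h) = x \<bullet>c (A ^\<^sub>m e *\<^sub>v h)" if "e < m" for e
  proof -
    have "(A *\<^sub>v x) \<bullet>c (A ^\<^sub>m Suc e *\<^sub>v h) = x \<bullet>c (adj A *\<^sub>v (A ^\<^sub>m Suc e *\<^sub>v h))"
      by (rule ip_adj) (use xc in auto)
    then show ?thesis using adj_pow_Suc[OF h(1) that] by simp
  qed
  have last: "A ^\<^sub>m Suc m *\<^sub>v h = 0\<^sub>v n" using h(2) unfolding pow_kernel_iff[OF A] by simp
  have h0: "A ^\<^sub>m 0 *\<^sub>v h = h" using hc by simp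
  \<comment> \<open>The chain is read backwards: index 0 belongs to A^m h, whose image under A is
    zero, and index m + 1 stands for <x, adj A h>, which is not controlled by the chain.\<close>
  define d where "d k = (if k \<le> m then x \<bullet>c (A ^\<^sub>m (m - k) *\<^sub>v h) else (A *\<^sub>v x) \<bullet>c h)" for k
  have dS: "(A *\<^sub>v x) \<bullet>c (A ^\<^sub>m (m - k) *\<^sub>v h) = d (Suc k)" if "k \<le> m" for k
  proof (cases "k = m")
    case True then show ?thesis using h0 by (simp add: d_def del: pow_mat.simps)
  next
    case False
    then have "m - k = Suc (m - Suc k)" "m - Suc k < m" using that by auto
    then show ?thesis using shift[of "m - Suc k"] False that by (simp add: d_def del: pow_mat.simps)
  qed
  have "of_real (cheb r (Suc (Suc m))) * d m = z * of_real (cheb r (Suc m)) * d (Suc m)"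
  proof (rule cheb_recursion[OF z])
    show "z\<^sup>2 * d 1 = 2 * of_real r * z * d 0"
      using ipe[of m] dS[of 0] last xc by (simp add: d_def del: pow_mat.simps)
    show "z\<^sup>2 * d (Suc (Suc k)) + d k = 2 * of_real r * z * d (Suc k)" if "Suc k \<le> m" for k
    proof -
      have "Suc (m - Suc k) = m - k" using that by simp
      then show ?thesis
        using ipe[of "m - Suc k"] dS[of "Suc k"] that by (simp add: d_def del: pow_mat.simps)
    qed
  qed
  then show ?thesis using h0 by (simp add: d_def del: pow_mat.simps cheb.simps)
qed

end

section \<open>The upper bound for the radius\<close>

definition proj_onto :: "nat \<Rightarrow> complex vec set \<Rightarrow> complex mat \<Rightarrow> bool" where
  "proj_onto n S Q \<longleftrightarrow> Q \<in> carrier_mat n n \<and> adj Q = Q \<and>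
    (\<forall>x\<in>carrier_vec n. Q *\<^sub>v x \<in> S) \<and> (\<forall>x\<in>S. Q *\<^sub>v x = x)"

lemma proj_onto_exists:
  assumes "subsp n S"
  obtains Q where "proj_onto n S Q"
  using subsp_projection[OF assms] unfolding proj_onto_def by metis

lemma proj_ontoD:
  assumes "proj_onto n S Q"
  shows "Q \<in> carrier_mat n n" "dim_row Q = n" "dim_col Q = n" "adj Q = Q"
    "x \<in> carrier_vec n \<Longrightarrow> Q *\<^sub>v x \<in> S" "x \<in> S \<Longrightarrow> Q *\<^sub>v x = x"
  using assms by (auto simp: proj_onto_def)

lemma proj_onto_ip:
  assumes Q: "proj_onto n S Q" and x: "x \<in> carrier_vec n" and s: "s \<in> S" "s \<in> carrier_vec n"
  shows "(Q *\<^sub>v x) \<bullet>c s = x \<bullet>c s"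
  using ip_adj[of Q x s] proj_ontoD[OF Q] x s by simp

text \<open>Start of the induction on the exponent; it also settles ascent 0, where no chain
  exists.\<close>

lemma pencil_projection_0:
  assumes A: "A \<in> carrier_mat n n"
  shows "\<exists>Q K. proj_onto n (mat_kernel (A ^\<^sub>m 0)) Q \<and> K \<in> carrier_mat n n \<and>
    (\<forall>z x. z \<noteq> 0 \<longrightarrow> pencil A r z x \<longrightarrow> Q *\<^sub>v x = z \<cdot>\<^sub>v (K *\<^sub>v (A *\<^sub>v x)))"
proof -
  have ker0: "mat_kernel (A ^\<^sub>m 0) = {0\<^sub>v n}"
    unfolding pow_kernel_iff[OF A] set_eq_iff using A by auto
  show ?thesis unfolding ker0
  proof (intro exI conjI allI impI)
    show "proj_onto n {0\<^sub>v n} (0\<^sub>m n n)"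
      unfolding proj_onto_def by (auto intro!: eq_matI)
    fix z x assume "pencil A r z x"
    then have "x \<in> carrier_vec n" "A *\<^sub>v x \<in> carrier_vec n" using A by (auto simp: pencil_def)
    then show "0\<^sub>m n n *\<^sub>v x = z \<cdot>\<^sub>v (0\<^sub>m n n *\<^sub>v (A *\<^sub>v x))" by simp
  qed simp
qed

context power_pi
begin

lemma sub_pi: "k \<le> m \<Longrightarrow> power_pi n A k"
  using pi by unfold_locales auto

text \<open>Passing from ker A^k to ker A^(k+1) adds the projection onto the generators of chains of
  length k + 1, and \<open>pencil_chain\<close> fixes this component of x as z times a multiple of
  the same component of A x. That K is independent of z and x keeps the later elimination polynomial
  in z.\<close>

lemma pencil_projection:
  assumes r: "r > cos (pi / (real (Suc m) + 1))" and "k \<le> Suc m"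
  shows "\<exists>Q K. proj_onto n (mat_kernel (A ^\<^sub>m k)) Q \<and> K \<in> carrier_mat n n \<and>
    (\<forall>z x. z \<noteq> 0 \<longrightarrow> pencil A r z x \<longrightarrow> Q *\<^sub>v x = z \<cdot>\<^sub>v (K *\<^sub>v (A *\<^sub>v x)))"
  using assms(2)
proof (induction k)
  case 0
  show ?case by (rule pencil_projection_0[OF A])
next
  case (Suc k)
  let ?S = "mat_kernel (A ^\<^sub>m k)" and ?T = "mat_kernel (A ^\<^sub>m Suc k)"
  from Suc obtain Q K where Q: "proj_onto n ?S Q" and K: "K \<in> carrier_mat n n"
    and QK: "\<And>z x. z \<noteq> 0 \<Longrightarrow> pencil A r z x \<Longrightarrow> Q *\<^sub>v x = z \<cdot>\<^sub>v (K *\<^sub>v (A *\<^sub>v x))"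
    by auto
  have Ak: "A ^\<^sub>m j \<in> carrier_mat n n" for j by simp
  note S = subsp_kernel[OF Ak[of k]] and T = subsp_kernel[OF Ak[of "Suc k"]]
  have ST: "?S \<subseteq> ?T" by (rule pow_kernel_mono[OF A]) simp
  obtain Q' where Q': "proj_onto n ?T Q'" by (rule proj_onto_exists[OF T])
  note QD = proj_ontoD[OF Q] and QD' = proj_ontoD[OF Q']
  define P where "P = orth_complement n ?S"
  have P: "subsp n P" unfolding P_def by (intro subsp_orth_complement mat_kernel_carrier[OF Ak])
  have diffO: "Q' *\<^sub>v x - Q *\<^sub>v x \<in> ?T" "Q' *\<^sub>v x - Q *\<^sub>v x \<in> P" if x: "x \<in> carrier_vec n" for x
  proof -
    show "Q' *\<^sub>v x - Q *\<^sub>v x \<in> ?T"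
      by (intro subsp_diff[OF T] QD'(5)[OF x] subsetD[OF ST QD(5)[OF x]])
    show "Q' *\<^sub>v x - Q *\<^sub>v x \<in> P"
      unfolding P_def
    proof (rule orth_complementI)
      fix s assume s: "s \<in> ?S"
      then have sc: "s \<in> carrier_vec n" by (rule subspD(1)[OF S])
      show "(Q' *\<^sub>v x - Q *\<^sub>v x) \<bullet>c s = 0"
        using proj_onto_ip[OF Q x s sc] proj_onto_ip[OF Q' x subsetD[OF ST s] sc] sc QD QD'
        by (simp add: ip_diff_left)
    qed (use QD QD' in simp)
  qed
  have diff_ip: "(Q' *\<^sub>v x - Q *\<^sub>v x) \<bullet>c d = x \<bullet>c d" if x: "x \<in> carrier_vec n" and d: "d \<in> ?T" "d \<in> P" for x d
  proof -
    have dc: "d \<in> carrier_vec n" by (rule subspD(1)[OF T d(1)])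
    have "(Q *\<^sub>v x) \<bullet>c d = cnj (d \<bullet>c (Q *\<^sub>v x))"
      using ip_cnj[of d "Q *\<^sub>v x"] dc QD by simp
    also have "\<dots> = 0" using orth_complementD(2)[OF d(2)[unfolded P_def] QD(5)[OF x]] by simp
    finally show ?thesis
      using proj_onto_ip[OF Q' x d(1) dc] dc QD QD' by (simp add: ip_diff_left)
  qed
  \<comment> \<open>These are U_(k+1) and U_k at r. The first is the divisor, positive by the bound
    on r.\<close>
  define s t where "s = cheb r (Suc (Suc k))" and "t = cheb r (Suc k)"
  have s: "s > 0" unfolding s_def using cheb_pos[OF r, of "Suc (Suc k)"] Suc.prems by simp
  define K' where "K' = K + complex_of_real (t / s) \<cdot>\<^sub>m (Q' - Q)"
  show ?case
  proof (intro exI conjI allI impI)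
    show "proj_onto n ?T Q'" by (rule Q')
    show "K' \<in> carrier_mat n n" using K QD QD' by (auto simp: K'_def)
    fix z x assume z: "z \<noteq> 0" and x: "pencil A r z x"
    have xc: "x \<in> carrier_vec n" using x by (simp add: pencil_def)
    have Axc: "A *\<^sub>v x \<in> carrier_vec n" by simp
    define u w where "u = Q' *\<^sub>v x - Q *\<^sub>v x" and "w = Q' *\<^sub>v (A *\<^sub>v x) - Q *\<^sub>v (A *\<^sub>v x)"
    have uw: "u \<in> ?T" "u \<in> P" "w \<in> ?T" "w \<in> P"
      unfolding u_def w_def by (intro diffO xc Axc)+
    have uwc: "u \<in> carrier_vec n" "w \<in> carrier_vec n"
      using subspD(1)[OF T] uw by auto
    \<comment> \<open>The discrepancy d is itself a chain generator, so \<open>pencil_chain\<close>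
      can be applied with h = d and yields <d, d> = 0.\<close>
    define d where "d = complex_of_real s \<cdot>\<^sub>v u - (z * complex_of_real t) \<cdot>\<^sub>v w"
    have d: "d \<in> ?T" "d \<in> P"
      unfolding d_def by (intro subsp_diff[OF T] subsp_diff[OF P] subsp_smult[OF T] subsp_smult[OF P] uw)+
    have dc: "d \<in> carrier_vec n" by (rule subspD(1)[OF T d(1)])
    interpret k: power_pi n A k using sub_pi Suc.prems by simp
    have "of_real s * (x \<bullet>c d) = z * of_real t * ((A *\<^sub>v x) \<bullet>c d)"
      unfolding s_def t_def using k.pencil_chain[OF x z] d unfolding P_def by simp
    then have "d \<bullet>c d = 0"
      using uwc dc diff_ip[OF xc d] diff_ip[OF Axc d]
      by (subst (1) d_def) (simp add: ip_diff_left ip_smult_left flip: u_def w_def)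
    then have "d = 0\<^sub>v n" using nsq_eq_0_iff[OF dc] by (simp add: ip_self)
    have u: "u = (z * complex_of_real (t / s)) \<cdot>\<^sub>v w"
    proof (rule eq_vecI)
      fix i assume "i < dim_vec ((z * complex_of_real (t / s)) \<cdot>\<^sub>v w)"
      then have "i < n" using uwc by simp
      then have "complex_of_real s * u $ i = z * complex_of_real t * w $ i"
        using arg_cong[OF \<open>d = 0\<^sub>v n\<close>, of "\<lambda>v. v $ i"] uwc by (simp add: d_def)
      then show "u $ i = ((z * complex_of_real (t / s)) \<cdot>\<^sub>v w) $ i"
        using s uwc \<open>i < n\<close> by (simp add: field_simps)
    qed (use uwc in simp)
    have Qx: "Q *\<^sub>v x \<in> carrier_vec n" "Q' *\<^sub>v x \<in> carrier_vec n" using QD QD' by auto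
    have "Q' *\<^sub>v x = Q *\<^sub>v x + u"
      unfolding u_def using vec_diff_add_cancel[OF Qx(2,1)] by simp
    also have "\<dots> = z \<cdot>\<^sub>v (K *\<^sub>v (A *\<^sub>v x)) + (z * complex_of_real (t / s)) \<cdot>\<^sub>v w"
      by (simp only: QK[OF z x] u)
    also have "\<dots> = z \<cdot>\<^sub>v (K *\<^sub>v (A *\<^sub>v x) + complex_of_real (t / s) \<cdot>\<^sub>v w)"
    proof -
      have "K *\<^sub>v (A *\<^sub>v x) \<in> carrier_vec n" using K by simp
      then show ?thesis using uwc by (intro eq_vecI) (simp_all add: algebra_simps)
    qed
    also have "K *\<^sub>v (A *\<^sub>v x) + complex_of_real (t / s) \<cdot>\<^sub>v w = K' *\<^sub>v (A *\<^sub>v x)"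
      unfolding K'_def w_def using carrier_matD[OF K] QD(2,3) QD'(2,3)
      by (simp add: mv_add mv_smult mv_minus)
    finally show "Q' *\<^sub>v x = z \<cdot>\<^sub>v (K' *\<^sub>v (A *\<^sub>v x))" .
  qed
qed

end

text \<open>The part y of x orthogonal to \<open>S\<close> satisfies A y in \<open>S\<close>, hence
  A^(a+1) y = 0, and the stabilization of the kernels at the ascent puts y into
  \<open>S\<close>.\<close>

lemma compression_injective:
  assumes A: "A \<in> carrier_mat n n" and S: "S = mat_kernel (A ^\<^sub>m ascent A)"
    and Q: "proj_onto n S Q" and x: "x \<in> carrier_vec n"
    and eq: "(1\<^sub>m n - Q) *\<^sub>v (A *\<^sub>v ((1\<^sub>m n - Q) *\<^sub>v x)) = 0\<^sub>v n"
  shows "x \<in> S"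
proof -
  note QD = proj_ontoD[OF Q]
  have d: "dim_row A = n" "dim_col A = n" "dim_vec x = n" using A x by auto
  define y where "y = x - Q *\<^sub>v x"
  have y: "(1\<^sub>m n - Q) *\<^sub>v x = y" unfolding y_def using QD d by (simp add: mv_minus)
  have yc: "y \<in> carrier_vec n" unfolding y_def using QD x by simp
  have Ay: "A *\<^sub>v y \<in> carrier_vec n" using d by simp
  have e: "A *\<^sub>v y - Q *\<^sub>v (A *\<^sub>v y) = 0\<^sub>v n"
    using eq unfolding y using QD d Ay by (simp add: mv_minus)
  have QAy: "Q *\<^sub>v (A *\<^sub>v y) \<in> carrier_vec n" using QD by simp
  have "Q *\<^sub>v (A *\<^sub>v y) + (A *\<^sub>v y - Q *\<^sub>v (A *\<^sub>v y)) = A *\<^sub>v y"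
    by (rule vec_diff_add_cancel[OF Ay QAy])
  then have "Q *\<^sub>v (A *\<^sub>v y) = A *\<^sub>v y"
    unfolding e right_zero_vec[OF QAy] .
  then have "A *\<^sub>v y \<in> S" using QD(5)[OF Ay] by simp
  then have "A ^\<^sub>m Suc (ascent A) *\<^sub>v y = 0\<^sub>v n"
    using pow_mat_mult_vec[OF A yc, of "ascent A" 1] A unfolding S pow_kernel_iff[OF A]
    by (simp add: left_mult_one_mat[OF A])
  then have "y \<in> S"
    using ascent_kernel_eq[OF A, of "Suc (ascent A)"] yc unfolding S by (auto simp: pow_kernel_iff[OF A] simp del: pow_mat.simps)
  moreover have sS: "subsp n S" unfolding S by (rule subsp_kernel[OF pow_carrier_mat[OF A]])
  ultimately have "Q *\<^sub>v x + 1 \<cdot>\<^sub>v y \<in> S" by (intro subspD(3)[OF sS] QD(5) x)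
  moreover have "Q *\<^sub>v x + 1 \<cdot>\<^sub>v y = x"
    unfolding y_def using vec_diff_add_cancel[OF x, of "Q *\<^sub>v x"] QD by simp
  ultimately show ?thesis by simp
qed

theorem pencil_radius_le:
  assumes A: "A \<in> carrier_mat n n"
    and pi: "\<And>j. j < ascent A \<Longrightarrow> partial_isometry (A ^\<^sub>m j)"
    and sing: "\<And>z. cmod z = 1 \<Longrightarrow> \<exists>x. x \<noteq> 0\<^sub>v n \<and> pencil A r z x"
  shows "r \<le> cos (pi / (real (ascent A) + 1))"
proof (rule ccontr)
  assume "\<not> ?thesis"
  then have r: "r > cos (pi / (real (ascent A) + 1))" by simp
  let ?S = "mat_kernel (A ^\<^sub>m ascent A)"
  have "\<exists>Q K. proj_onto n ?S Q \<and> K \<in> carrier_mat n n \<and>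
    (\<forall>z x. z \<noteq> 0 \<longrightarrow> pencil A r z x \<longrightarrow> Q *\<^sub>v x = z \<cdot>\<^sub>v (K *\<^sub>v (A *\<^sub>v x)))"
  proof (cases "ascent A")
    case 0
    show ?thesis unfolding 0 by (rule pencil_projection_0[OF A])
  next
    case (Suc m)
    interpret power_pi n A m using A pi Suc by unfold_locales auto
    show ?thesis unfolding Suc by (rule pencil_projection) (use r Suc in simp_all)
  qed
  then obtain Q K where Q: "proj_onto n ?S Q" and K: "K \<in> carrier_mat n n"
    and QK: "\<And>z x. z \<noteq> 0 \<Longrightarrow> pencil A r z x \<Longrightarrow> Q *\<^sub>v x = z \<cdot>\<^sub>v (K *\<^sub>v (A *\<^sub>v x))"
    by blast
  note QD = proj_ontoD(1-4)[OF Q]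
  define R where "R = 1\<^sub>m n - Q"
  have R: "R \<in> carrier_mat n n" "dim_row R = n" "dim_col R = n" using QD by (auto simp: R_def)
  have dA: "dim_row A = n" "dim_col A = n" and dK: "dim_row K = n" "dim_col K = n" using A K by auto
  have Rx: "R *\<^sub>v x = x - Q *\<^sub>v x" if "x \<in> carrier_vec n" for x
    unfolding R_def using that QD by (simp add: mv_minus)
  have adjR: "adj R = R"
  proof (rule eq_matI)
    fix i j assume "i < dim_row R" "j < dim_col R"
    moreover from this have "cnj (Q $$ (j, i)) = Q $$ (i, j)"
      using adj_index[of i Q j, unfolded QD(4)] QD(2,3) R by simp
    ultimately show "adj R $$ (i, j) = R $$ (i, j)" using QD R by (auto simp: R_def)
  qed (use R in auto)
  \<comment> \<open>$T(z) = G^* + z T_1 + z^2 T_2$ annihilates $x$, and $G$ is injective because $N$ is the whole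
    generalized kernel.\<close>
  define G where "G = Q + R * A * R"
  have G: "G \<in> carrier_mat n n" "dim_row G = n" "dim_col G = n" using QD R dA by (auto simp: G_def)
  have Gx: "G *\<^sub>v x = Q *\<^sub>v x + R *\<^sub>v (A *\<^sub>v (R *\<^sub>v x))" if "x \<in> carrier_vec n" for x
    unfolding G_def using that QD R dA by (simp add: mv_linear)
  have adjG: "adj G = Q + R * adj A * R"
  proof (rule mat_eq_by_vec[of _ n n])
    fix x :: "complex vec" assume x: "x \<in> carrier_vec n"
    have e: "(Q + R * adj A * R) *\<^sub>v x = Q *\<^sub>v x + R *\<^sub>v (adj A *\<^sub>v (R *\<^sub>v x))"
      using x QD R dA by (simp add: mv_linear)
    show "adj G *\<^sub>v x = (Q + R * adj A * R) *\<^sub>v x"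
      unfolding e
    proof (rule vec_eq_by_ip)
      fix w :: "complex vec" assume w: "w \<in> carrier_vec n"
      have "(adj G *\<^sub>v x) \<bullet>c w = x \<bullet>c (Q *\<^sub>v w + R *\<^sub>v (A *\<^sub>v (R *\<^sub>v w)))"
        using G x w by (simp add: ip_adj' Gx)
      also have "\<dots> = x \<bullet>c (Q *\<^sub>v w) + x \<bullet>c (R *\<^sub>v (A *\<^sub>v (R *\<^sub>v w)))"
        using x w QD R by (simp add: ip_add_right)
      also have "x \<bullet>c (Q *\<^sub>v w) = (Q *\<^sub>v x) \<bullet>c w"
        using ip_adj'[of Q x w] QD x w by simp
      also have "x \<bullet>c (R *\<^sub>v (A *\<^sub>v (R *\<^sub>v w))) = (R *\<^sub>v (adj A *\<^sub>v (R *\<^sub>v x))) \<bullet>c w"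
        using ip_adj'[of R x "A *\<^sub>v (R *\<^sub>v w)"] ip_adj'[of A "R *\<^sub>v x" "R *\<^sub>v w"]
          ip_adj'[of R "adj A *\<^sub>v (R *\<^sub>v x)" w] R dA x w adjR by simp
      finally show "(adj G *\<^sub>v x) \<bullet>c w = (Q *\<^sub>v x + R *\<^sub>v (adj A *\<^sub>v (R *\<^sub>v x))) \<bullet>c w"
        using x w QD R by (simp add: ip_add_left)
    qed (use G QD R in auto)
  qed (use G QD R dA in auto)
  \<comment> \<open>Add the equation Q x = z K A x to the pencil equation compressed by R, after
    replacing Q x by z K A x inside the adjoint term. \<open>T1\<close> and \<open>T2\<close>
    collect the resulting coefficients of z and z^2.\<close>
  define T1 where "T1 = (- 2 * complex_of_real r) \<cdot>\<^sub>m R - K * A + R * adj A * K * A"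
  define T2 where "T2 = R * A"
  have T: "T1 \<in> carrier_mat n n" "T2 \<in> carrier_mat n n" using R dA dK by (auto simp: T1_def T2_def)
  have "det (adj G) = 0"
  proof (rule quadratic_pencil_det_0[OF _ T])
    show "adj G \<in> carrier_mat n n" using G by simp
    \<comment> \<open>An arc of the circle suffices: cos is injective on [0, 1] because 1 <
      pi.\<close>
    have "infinite (cis ` {0..1})"
    proof
      assume "finite (cis ` {0..1})"
      moreover have "inj_on cis {0..1}"
      proof (rule inj_onI)
        fix s t assume st: "s \<in> {0..1}" "t \<in> {0..1}" "cis s = cis t"
        then have "cos s = cos t" by (metis cis.sel(1))
        then show "s = t" using st pi_ge_two by (intro cos_inj_pi[of s t]) auto
      qed
      ultimately have "finite {0..1::real}" by (rule finite_imageD)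
      then show False by (simp add: infinite_Icc)
    qed
    then show "infinite (cis ` {0..1})" .
    fix z assume "z \<in> cis ` {0..1}"
    then have z: "cmod z = 1" by auto
    then obtain x where x0: "x \<noteq> 0\<^sub>v n" and x: "pencil A r z x" using sing by blast
    have xc: "x \<in> carrier_vec n" using x dA by (simp add: pencil_def)
    have eq: "(2 * of_real r * z) \<cdot>\<^sub>v x = z\<^sup>2 \<cdot>\<^sub>v (A *\<^sub>v x) + adj A *\<^sub>v x"
      using x by (simp add: pencil_def)
    have adjA: "adj A *\<^sub>v x = (2 * of_real r * z) \<cdot>\<^sub>v x - z\<^sup>2 \<cdot>\<^sub>v (A *\<^sub>v x)"
      unfolding eq using dA xc by (intro eq_vecI) auto
    have Qx: "Q *\<^sub>v x = z \<cdot>\<^sub>v (K *\<^sub>v (A *\<^sub>v x))" using QK[OF _ x] z by (metis norm_zero zero_neq_one)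
    have "adj A *\<^sub>v (R *\<^sub>v x) = adj A *\<^sub>v x - z \<cdot>\<^sub>v (adj A *\<^sub>v (K *\<^sub>v (A *\<^sub>v x)))"
      unfolding Rx[OF xc] Qx using xc dA dK by (simp add: mv_linear)
    then have RAR: "R *\<^sub>v (adj A *\<^sub>v (R *\<^sub>v x)) =
      (2 * of_real r * z) \<cdot>\<^sub>v (R *\<^sub>v x) - z\<^sup>2 \<cdot>\<^sub>v (R *\<^sub>v (A *\<^sub>v x)) - z \<cdot>\<^sub>v (R *\<^sub>v (adj A *\<^sub>v (K *\<^sub>v (A *\<^sub>v x))))"
      unfolding adjA using xc dA dK R by (simp add: mv_linear)
    define p q s t where "p = K *\<^sub>v (A *\<^sub>v x)" and "q = R *\<^sub>v x"
      and "s = R *\<^sub>v (A *\<^sub>v x)" and "t = R *\<^sub>v (adj A *\<^sub>v (K *\<^sub>v (A *\<^sub>v x)))"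
    have dims: "dim_vec p = n" "dim_vec q = n" "dim_vec s = n" "dim_vec t = n"
      using R dK by (auto simp: p_def q_def s_def t_def)
    have "adj G *\<^sub>v x = z \<cdot>\<^sub>v p + ((2 * of_real r * z) \<cdot>\<^sub>v q - z\<^sup>2 \<cdot>\<^sub>v s - z \<cdot>\<^sub>v t)"
      unfolding adjG p_def q_def s_def t_def RAR[symmetric] Qx[symmetric]
      using QD R dA xc by (simp add: mv_linear)
    moreover have "T1 *\<^sub>v x = (- 2 * complex_of_real r) \<cdot>\<^sub>v q - p + t"
      unfolding T1_def p_def q_def t_def using QD R dA dK xc by (simp add: mv_linear)
    moreover have "T2 *\<^sub>v x = s"
      unfolding T2_def s_def using R dA xc by (simp add: mv_linear)
    ultimately have "adj G *\<^sub>v x + z \<cdot>\<^sub>v (T1 *\<^sub>v x) + z\<^sup>2 \<cdot>\<^sub>v (T2 *\<^sub>v x) = 0\<^sub>v n"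
      using dims by (intro eq_vecI) (simp_all add: algebra_simps)
    then show "\<exists>x. x \<in> carrier_vec n \<and> x \<noteq> 0\<^sub>v n \<and>
      adj G *\<^sub>v x + z \<cdot>\<^sub>v (T1 *\<^sub>v x) + z\<^sup>2 \<cdot>\<^sub>v (T2 *\<^sub>v x) = 0\<^sub>v n"
      using x0 xc by blast
  qed
  then have "det G = 0" by (rule det_adj_eq_0[OF G(1)])
  then obtain x where x: "x \<in> carrier_vec n" "x \<noteq> 0\<^sub>v n" "G *\<^sub>v x = 0\<^sub>v n"
    using det_0_iff_vec_prod_zero[OF G(1)] by blast
  have QQ: "Q *\<^sub>v (Q *\<^sub>v v) = Q *\<^sub>v v" if "v \<in> carrier_vec n" for v
    using proj_ontoD(5,6)[OF Q] that by simp
  \<comment> \<open>Q R = 0 splits G x = 0 into Q x = 0 and R A R x = 0.\<close>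
  have QR: "Q *\<^sub>v (R *\<^sub>v v) = 0\<^sub>v n" if "v \<in> carrier_vec n" for v
    unfolding Rx[OF that] using QQ[OF that] QD that by (simp add: mv_linear)
  have "Q *\<^sub>v (G *\<^sub>v x) = Q *\<^sub>v x"
    unfolding Gx[OF x(1)] using QQ[OF x(1)] QR[of "A *\<^sub>v (R *\<^sub>v x)"] QD R dA x by (simp add: mv_linear)
  then have Qx0: "Q *\<^sub>v x = 0\<^sub>v n" using x QD by simp
  then have "R *\<^sub>v (A *\<^sub>v (R *\<^sub>v x)) = 0\<^sub>v n"
    using x(3) Gx[OF x(1)] R by simp
  then have "x \<in> ?S" unfolding R_def by (intro compression_injective[OF A refl Q x(1)])
  then show False using proj_ontoD(6)[OF Q] Qx0 x by simp
qed

section \<open>Supporting lines of a disc\<close>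

text \<open>At a zero of a nonnegative form the first variation vanishes: otherwise a small move
  from x in the direction - L x would make the form negative.\<close>

lemma psd_kernel:
  assumes L: "L \<in> carrier_mat n n" "adj L = L"
    and psd: "\<And>x. x \<in> carrier_vec n \<Longrightarrow> Re ((L *\<^sub>v x) \<bullet>c x) \<ge> 0"
    and x: "x \<in> carrier_vec n" "Re ((L *\<^sub>v x) \<bullet>c x) = 0"
  shows "L *\<^sub>v x = 0\<^sub>v n"
proof -
  define y where "y = L *\<^sub>v x"
  have y: "y \<in> carrier_vec n" using L by (simp add: y_def)
  define q where "q = Re ((L *\<^sub>v y) \<bullet>c y)"
  have q: "q \<ge> 0" unfolding q_def by (rule psd[OF y])
  have d: "dim_row L = n" "dim_col L = n" "dim_vec x = n" "dim_vec y = n" using L x y by auto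
  have Lyx: "(L *\<^sub>v y) \<bullet>c x = y \<bullet>c y"
    using ip_adj[of L y x] d L(2) by (simp add: y_def)
  have form: "0 \<le> t\<^sup>2 * q - 2 * t * nsq y" for t :: real
  proof -
    define u where "u = x - complex_of_real t \<cdot>\<^sub>v y"
    have u: "u \<in> carrier_vec n" using x y by (simp add: u_def)
    have "L *\<^sub>v u = y - complex_of_real t \<cdot>\<^sub>v (L *\<^sub>v y)"
      unfolding u_def using d by (simp add: mv_linear flip: y_def)
    then have "(L *\<^sub>v u) \<bullet>c u = y \<bullet>c x - of_real t * (y \<bullet>c y) - of_real t * (y \<bullet>c y) + of_real (t\<^sup>2) * ((L *\<^sub>v y) \<bullet>c y)"
      unfolding u_def using d by (simp add: ip_linear Lyx power2_eq_square algebra_simps)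
    then have "Re ((L *\<^sub>v u) \<bullet>c u) = Re (y \<bullet>c x) - 2 * t * nsq y + t\<^sup>2 * q"
      unfolding ip_self q_def by (simp flip: of_real_mult)
    then show ?thesis using psd[OF u] x(2) by (simp add: y_def)
  qed
  have "nsq y = 0"
  proof (rule ccontr)
    assume "nsq y \<noteq> 0"
    then have Y: "nsq y > 0" using nsq_nonneg[of y] by linarith
    \<comment> \<open>The quadratic is smallest at |y|^2 / q; adding 1 to the denominator keeps the
      choice legal when q = 0.\<close>
    define t where "t = nsq y / (q + 1)"
    have t: "t > 0" using Y q by (simp add: t_def)
    have "t * q \<le> nsq y" using q Y by (simp add: t_def divide_simps)
    then have "t * (t * q - 2 * nsq y) < 0" using t Y by (intro mult_pos_neg) auto
    then show False using form[of t] by (simp add: power2_eq_square algebra_simps)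
  qed
  then show ?thesis using nsq_eq_0_iff[OF y] by (simp add: y_def)
qed

text \<open>This is $2(r - \mathrm{Re}(\zeta A))$; its positivity says that $W(A)$ lies on the correct side of a
  supporting line of the disc.\<close>

definition supp_mat :: "complex mat \<Rightarrow> real \<Rightarrow> complex \<Rightarrow> complex mat" where
  "supp_mat A r \<zeta> = (2 * of_real r) \<cdot>\<^sub>m 1\<^sub>m (dim_row A) - \<zeta> \<cdot>\<^sub>m A - cnj \<zeta> \<cdot>\<^sub>m adj A"

lemma supp_mat_carrier: "A \<in> carrier_mat n n \<Longrightarrow> supp_mat A r \<zeta> \<in> carrier_mat n n"
  by (auto simp: supp_mat_def)

lemma adj_supp_mat:
  assumes "A \<in> carrier_mat n n"
  shows "adj (supp_mat A r \<zeta>) = supp_mat A r \<zeta>"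
  by (rule eq_matI) (use assms in \<open>auto simp: supp_mat_def\<close>)

lemma supp_mat_mv:
  assumes "A \<in> carrier_mat n n" "x \<in> carrier_vec n"
  shows "supp_mat A r \<zeta> *\<^sub>v x =
    (2 * of_real r) \<cdot>\<^sub>v x - \<zeta> \<cdot>\<^sub>v (A *\<^sub>v x) - cnj \<zeta> \<cdot>\<^sub>v (adj A *\<^sub>v x)"
proof -
  have "dim_row A = n" "dim_col A = n" "dim_vec x = n" using assms by auto
  then show ?thesis by (simp add: supp_mat_def mv_linear)
qed

lemma supp_mat_form:
  assumes "A \<in> carrier_mat n n" "x \<in> carrier_vec n"
  shows "Re ((supp_mat A r \<zeta> *\<^sub>v x) \<bullet>c x) = 2 * r * nsq x - 2 * Re (\<zeta> * ((A *\<^sub>v x) \<bullet>c x))"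
proof -
  have d: "dim_row A = n" "dim_col A = n" "dim_vec x = n" using assms by auto
  have "(adj A *\<^sub>v x) \<bullet>c x = cnj ((A *\<^sub>v x) \<bullet>c x)"
    using d ip_cnj[of "A *\<^sub>v x" x] by (simp add: ip_adj')
  then have "(supp_mat A r \<zeta> *\<^sub>v x) \<bullet>c x = 2 * of_real r * of_real (nsq x) - \<zeta> * ((A *\<^sub>v x) \<bullet>c x) - cnj (\<zeta> * ((A *\<^sub>v x) \<bullet>c x))"
    unfolding supp_mat_mv[OF assms] using d by (simp add: ip_linear flip: ip_self)
  then show ?thesis by simp
qed

lemma numerical_range_scaled:
  assumes A: "A \<in> carrier_mat n n" and x: "x \<in> carrier_vec n"
    and bnd: "\<And>w. w \<in> numerical_range A \<Longrightarrow> cmod w \<le> r"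
  shows "cmod ((A *\<^sub>v x) \<bullet>c x) \<le> r * nsq x"
proof (cases "x = 0\<^sub>v n")
  case True
  then show ?thesis using A nsq_eq_0_iff[OF x] by simp
next
  case False
  obtain c where c: "c > 0" "nsq (complex_of_real c \<cdot>\<^sub>v x) = 1"
    by (rule nsq_normalize[OF x False])
  define u where "u = complex_of_real c \<cdot>\<^sub>v x"
  have u: "u \<in> carrier_vec n" using x by (simp add: u_def)
  have d: "dim_row A = n" "dim_col A = n" "dim_vec x = n" using A x by auto
  have "(A *\<^sub>v u) \<bullet>c u \<in> numerical_range A"
    unfolding numerical_range_def vec_norm_eq_1_iff using u c d by (auto simp: u_def)
  moreover have "(A *\<^sub>v u) \<bullet>c u = of_real (c\<^sup>2) * ((A *\<^sub>v x) \<bullet>c x)"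
    using d by (simp add: u_def mv_linear ip_linear power2_eq_square)
  ultimately have "c\<^sup>2 * cmod ((A *\<^sub>v x) \<bullet>c x) \<le> r"
    using bnd[of "(A *\<^sub>v u) \<bullet>c u"] by (simp add: norm_mult norm_power)
  moreover have "c\<^sup>2 * nsq x = 1" using c(2) by (simp add: nsq_smult)
  ultimately have "c\<^sup>2 * cmod ((A *\<^sub>v x) \<bullet>c x) \<le> c\<^sup>2 * (r * nsq x)"
    by (metis mult.commute mult.left_commute mult.right_neutral)
  then show ?thesis using c(1) by simp
qed

locale disc_range =
  fixes n :: nat and A :: "complex mat" and r :: real
  assumes A [simp]: "A \<in> carrier_mat n n" and r: "r \<ge> 0"
    and range: "numerical_range A = cball 0 r"
begin

lemma dims [simp]: "dim_row A = n" "dim_col A = n"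
  using carrier_matD[OF A] by auto

lemma bound: "x \<in> carrier_vec n \<Longrightarrow> cmod ((A *\<^sub>v x) \<bullet>c x) \<le> r * nsq x"
  by (rule numerical_range_scaled[OF A]) (auto simp: range)

lemma supp_psd:
  assumes "cmod \<zeta> = 1" "x \<in> carrier_vec n"
  shows "Re ((supp_mat A r \<zeta> *\<^sub>v x) \<bullet>c x) \<ge> 0"
proof -
  have "Re (\<zeta> * ((A *\<^sub>v x) \<bullet>c x)) \<le> cmod (\<zeta> * ((A *\<^sub>v x) \<bullet>c x))" by (rule complex_Re_le_cmod)
  also have "\<dots> \<le> r * nsq x" using bound[OF assms(2)] assms(1) by (simp add: norm_mult)
  finally show ?thesis unfolding supp_mat_form[OF A assms(2)] by simp
qed

lemma supp_kernel:
  assumes "cmod \<zeta> = 1" "x \<in> carrier_vec n" "Re ((supp_mat A r \<zeta> *\<^sub>v x) \<bullet>c x) = 0"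
  shows "supp_mat A r \<zeta> *\<^sub>v x = 0\<^sub>v n"
  by (rule psd_kernel[OF supp_mat_carrier[OF A] adj_supp_mat[OF A]]) (use supp_psd assms in auto)

text \<open>The disc is closed, so the boundary point r cnj z is a value <A x, x> at a unit vector.
  There the nonnegative form of \<open>supp_mat A r z\<close> vanishes, and
  \<open>supp_kernel\<close> turns this into a linear equation for x.\<close>

lemma pencil_exists:
  assumes z: "cmod z = 1"
  shows "\<exists>x. x \<noteq> 0\<^sub>v n \<and> pencil A r z x"
proof -
  have zz: "z * cnj z = 1" using z complex_norm_square[of z] by simp
  have "of_real r * cnj z \<in> numerical_range A"
    unfolding range using z r by (simp add: norm_mult)
  then obtain x where x: "x \<in> carrier_vec n" "nsq x = 1" "(A *\<^sub>v x) \<bullet>c x = of_real r * cnj z"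
    unfolding numerical_range_def vec_norm_eq_1_iff by auto
  have "Re (z * ((A *\<^sub>v x) \<bullet>c x)) = r"
  proof -
    have "z * ((A *\<^sub>v x) \<bullet>c x) = of_real r * (z * cnj z)" unfolding x(3) by simp
    then show ?thesis unfolding zz by simp
  qed
  then have "supp_mat A r z *\<^sub>v x = 0\<^sub>v n"
    by (intro supp_kernel[OF z x(1)]) (simp add: supp_mat_form[OF A x(1)] x(2))
  then have eq: "(2 * of_real r) \<cdot>\<^sub>v x - z \<cdot>\<^sub>v (A *\<^sub>v x) - cnj z \<cdot>\<^sub>v (adj A *\<^sub>v x) = 0\<^sub>v n"
    unfolding supp_mat_mv[OF A x(1)] .
  have "(2 * of_real r * z) \<cdot>\<^sub>v x = z\<^sup>2 \<cdot>\<^sub>v (A *\<^sub>v x) + adj A *\<^sub>v x"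
  proof (rule eq_vecI)
    fix i assume "i < dim_vec (z\<^sup>2 \<cdot>\<^sub>v (A *\<^sub>v x) + adj A *\<^sub>v x)"
    then have i: "i < n" by simp
    define p q s where "p = x $ i" and "q = (A *\<^sub>v x) $ i" and "s = (adj A *\<^sub>v x) $ i"
    have "2 * of_real r * p - z * q - cnj z * s = 0"
      using arg_cong[OF eq, of "\<lambda>v. v $ i"] i x(1) unfolding p_def q_def s_def
      by (simp del: index_mult_mat_vec)
    then have "z * (2 * of_real r * p) = z * (z * q + cnj z * s)" by (simp add: algebra_simps)
    also have "\<dots> = z\<^sup>2 * q + (z * cnj z) * s" by (simp add: algebra_simps power2_eq_square)
    finally have "z * (2 * of_real r * p) = z\<^sup>2 * q + s" using zz by simp
    then show "((2 * of_real r * z) \<cdot>\<^sub>v x) $ i = (z\<^sup>2 \<cdot>\<^sub>v (A *\<^sub>v x) + adj A *\<^sub>v x) $ i"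
      using i x(1) unfolding p_def q_def s_def by (simp del: index_mult_mat_vec add: mult_ac)
  qed (use x in simp)
  moreover have "x \<noteq> 0\<^sub>v n" using nsq_eq_0_iff[OF x(1)] x(2) by auto
  ultimately show ?thesis using x(1) by (auto simp: pencil_def)
qed

end

section \<open>Sine vectors along a chain\<close>

primrec lc :: "nat \<Rightarrow> (nat \<Rightarrow> complex) \<Rightarrow> (nat \<Rightarrow> complex vec) \<Rightarrow> nat \<Rightarrow> complex vec" where
  "lc n c e 0 = 0\<^sub>v n"
| "lc n c e (Suc N) = lc n c e N + c N \<cdot>\<^sub>v e N"

lemma lc_dim [simp]: "(\<And>k. dim_vec (e k) = n) \<Longrightarrow> dim_vec (lc n c e N) = n"
  by (induction N) auto

lemma lc_index: "(\<And>k. dim_vec (e k) = n) \<Longrightarrow> i < n \<Longrightarrow> lc n c e N $ i = (\<Sum>k<N. c k * e k $ i)"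
  by (induction N) auto

lemma lc_mv:
  assumes "\<And>k. dim_vec (e k) = n" "B \<in> carrier_mat n n"
  shows "B *\<^sub>v lc n c e N = lc n c (\<lambda>k. B *\<^sub>v e k) N"
proof -
  have "dim_row B = n" "dim_col B = n" using assms by auto
  then show ?thesis using assms(1) by (induction N) (auto simp: mv_linear)
qed

lemma lc_ip:
  assumes "\<And>k. dim_vec (e k) = n" "dim_vec y = n"
  shows "lc n c e N \<bullet>c y = (\<Sum>k<N. c k * (e k \<bullet>c y))"
  using assms by (induction N) (auto simp: ip_linear)

text \<open>The identity sin((k-1) theta + phi) + sin((k+1) theta + phi) = 2 cos theta sin(k theta +
  phi), twisted by powers of zeta. One end closes because the next sine vanishes; the other leaves
  two boundary terms. In the application g k is a coordinate of A^k h and g' k that of adj A A^k h.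
  The phase phi stays free because the values theta and 2 theta both occur later.\<close>

lemma supp_sum:
  fixes g g' :: "nat \<Rightarrow> complex" and \<zeta> :: complex
  assumes \<zeta>: "\<zeta> * cnj \<zeta> = 1" and end0: "sin (real (Suc M) * \<theta> + \<phi>) = 0"
    and g: "g (Suc M) = 0" and g': "\<And>k. k < M \<Longrightarrow> g' (Suc k) = g k"
  defines "c \<equiv> \<lambda>k. of_real (sin (real k * \<theta> + \<phi>)) * \<zeta> ^ k"
  shows "2 * of_real r * (\<Sum>k<Suc M. c k * g k) - \<zeta> * (\<Sum>k<Suc M. c k * g (Suc k))
       - cnj \<zeta> * (\<Sum>k<Suc M. c k * g' k)
     = of_real (2 * (r - cos \<theta>)) * (\<Sum>k<Suc M. c k * g k)
       + of_real (sin (\<phi> - \<theta>)) * g 0 - of_real (sin \<phi>) * cnj \<zeta> * g' 0"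
proof -
  \<comment> \<open>\<open>D k\<close> and \<open>E k\<close> are the coefficients that
    \<open>g k\<close> receives from the forward and the backward shift. The forward shift
    contributes nothing to \<open>g 0\<close>, so the term with \<open>D 0\<close> is added and
    subtracted.\<close>
  define D where "D k = of_real (sin (real k * \<theta> + \<phi> - \<theta>)) * \<zeta> ^ k" for k
  define E where "E k = of_real (sin (real (Suc k) * \<theta> + \<phi>)) * \<zeta> ^ k" for k
  have "(\<Sum>k<Suc M. D k * g k) = D 0 * g 0 + (\<Sum>k<M. D (Suc k) * g (Suc k))"
    by (rule sum.lessThan_Suc_shift)
  also have "(\<Sum>k<M. D (Suc k) * g (Suc k)) = (\<Sum>k<M. \<zeta> * (c k * g (Suc k)))"
    by (intro sum.cong) (auto simp: D_def c_def algebra_simps)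
  also have "\<dots> = \<zeta> * (\<Sum>k<Suc M. c k * g (Suc k))"
    using g by (simp add: sum_distrib_left)
  finally have 1: "\<zeta> * (\<Sum>k<Suc M. c k * g (Suc k)) = (\<Sum>k<Suc M. D k * g k) - D 0 * g 0"
    by simp
  have \<zeta>S: "cnj \<zeta> * (\<zeta> * x) = x" for x
  proof -
    have "cnj \<zeta> * (\<zeta> * x) = (\<zeta> * cnj \<zeta>) * x" by (simp only: mult_ac)
    then show ?thesis unfolding \<zeta> by simp
  qed
  have "cnj \<zeta> * (\<Sum>k<Suc M. c k * g' k) = cnj \<zeta> * (c 0 * g' 0) + (\<Sum>k<M. cnj \<zeta> * (c (Suc k) * g' (Suc k)))"
    unfolding sum.lessThan_Suc_shift by (simp add: sum_distrib_left distrib_left)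
  also have "(\<Sum>k<M. cnj \<zeta> * (c (Suc k) * g' (Suc k))) = (\<Sum>k<M. E k * g k)"
  proof (rule sum.cong)
    fix k assume "k \<in> {..<M}"
    then have "cnj \<zeta> * (c (Suc k) * g' (Suc k)) = cnj \<zeta> * (\<zeta> * (of_real (sin (real (Suc k) * \<theta> + \<phi>)) * \<zeta> ^ k * g k))"
      using g' by (simp add: c_def mult_ac)
    then show "cnj \<zeta> * (c (Suc k) * g' (Suc k)) = E k * g k"
      unfolding \<zeta>S by (simp add: E_def)
  qed simp
  \<comment> \<open>\<open>E M = 0\<close> by \<open>end0\<close>, so the sum may run one step
    further.\<close>
  also have "\<dots> = (\<Sum>k<Suc M. E k * g k)" using end0 by (simp add: E_def)
  finally have 2: "cnj \<zeta> * (\<Sum>k<Suc M. c k * g' k) = cnj \<zeta> * (c 0 * g' 0) + (\<Sum>k<Suc M. E k * g k)" .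
  have DE: "D k + E k = of_real (2 * cos \<theta>) * c k" for k
  proof -
    have "sin (real k * \<theta> + \<phi> - \<theta>) + sin (real (Suc k) * \<theta> + \<phi>) = 2 * cos \<theta> * sin (real k * \<theta> + \<phi>)"
      using sin_add[of "real k * \<theta> + \<phi>" \<theta>] sin_diff[of "real k * \<theta> + \<phi>" \<theta>]
      by (simp add: algebra_simps)
    from arg_cong[OF this, of "\<lambda>x. complex_of_real x * \<zeta> ^ k"] show ?thesis
      by (simp add: D_def E_def c_def algebra_simps)
  qed
  have "(\<Sum>k<Suc M. D k * g k) + (\<Sum>k<Suc M. E k * g k) = (\<Sum>k<Suc M. (D k + E k) * g k)"
    by (simp only: sum.distrib distrib_right)
  also have "\<dots> = of_real (2 * cos \<theta>) * (\<Sum>k<Suc M. c k * g k)"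
    unfolding DE sum_distrib_left by (simp only: mult.assoc)
  finally have 3: "(\<Sum>k<Suc M. D k * g k) = of_real (2 * cos \<theta>) * (\<Sum>k<Suc M. c k * g k) - (\<Sum>k<Suc M. E k * g k)"
    by (simp only: eq_diff_eq)
  show ?thesis
    unfolding 1 2 3 by (simp add: D_def c_def algebra_simps)
qed

context power_pi
begin

text \<open>Here f is the sum of sin(k theta + phi) zeta^k A^k h over k <= m, treated coordinatewise
  by \<open>supp_sum\<close>. Both inner products follow from h being orthogonal to ker A^m, which
  contains A f and all A^k h with k >= 1.\<close>

lemma supp_mat_chain:
  assumes h: "h \<in> orth_complement n (mat_kernel (A ^\<^sub>m m))" "h \<in> mat_kernel (A ^\<^sub>m Suc m)"
    and \<zeta>: "cmod \<zeta> = 1" and end0: "sin (real (Suc m) * \<theta> + \<phi>) = 0"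
  obtains f where "f \<in> carrier_vec n"
    "supp_mat A r \<zeta> *\<^sub>v f = of_real (2 * (r - cos \<theta>)) \<cdot>\<^sub>v f + of_real (sin (\<phi> - \<theta>)) \<cdot>\<^sub>v h
       - (of_real (sin \<phi>) * cnj \<zeta>) \<cdot>\<^sub>v (adj A *\<^sub>v h)"
    "f \<bullet>c h = of_real (sin \<phi> * nsq h)" "(adj A *\<^sub>v h) \<bullet>c f = 0"
proof -
  have hc: "h \<in> carrier_vec n" by (rule orth_complementD[OF h(1)])
  have \<zeta>1: "\<zeta> * cnj \<zeta> = 1" using \<zeta> complex_norm_square[of \<zeta>] by simp
  define c where "c k = of_real (sin (real k * \<theta> + \<phi>)) * \<zeta> ^ k" for k
  define e where "e k = A ^\<^sub>m k *\<^sub>v h" for k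
  have e [simp]: "dim_vec (e k) = n" for k by (simp add: e_def)
  have eS: "A *\<^sub>v e k = e (Suc k)" for k unfolding e_def pow_mat_mult_vec_Suc[OF A hc] ..
  have eN: "e (Suc m) = 0\<^sub>v n" using h(2) unfolding pow_kernel_iff[OF A] e_def by simp
  have e0: "e 0 = h" using hc by (simp add: e_def)
  define f where "f = lc n c e (Suc m)"
  have fc: "f \<in> carrier_vec n" unfolding f_def by (intro carrier_vecI lc_dim) simp
  have "supp_mat A r \<zeta> *\<^sub>v f = of_real (2 * (r - cos \<theta>)) \<cdot>\<^sub>v f + of_real (sin (\<phi> - \<theta>)) \<cdot>\<^sub>v h
       - (of_real (sin \<phi>) * cnj \<zeta>) \<cdot>\<^sub>v (adj A *\<^sub>v h)" (is "?l = ?r")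
  proof (rule eq_vecI)
    show "dim_vec ?l = dim_vec ?r" using supp_mat_carrier[OF A, of r \<zeta>] by simp
    fix i assume "i < dim_vec ?r"
    then have i: "i < n" by simp
    have 1: "f $ i = (\<Sum>k<Suc m. c k * e k $ i)"
      unfolding f_def by (rule lc_index[OF e i])
    have 2: "(A *\<^sub>v f) $ i = (\<Sum>k<Suc m. c k * e (Suc k) $ i)"
      unfolding f_def lc_mv[OF e A] eS by (rule lc_index) (use i in auto)
    have adjAc: "adj A \<in> carrier_mat n n" by simp
    have 3: "(adj A *\<^sub>v f) $ i = (\<Sum>k<Suc m. c k * (adj A *\<^sub>v e k) $ i)"
      unfolding f_def lc_mv[OF e adjAc] by (rule lc_index) (use i in auto)
    have "2 * of_real r * f $ i - \<zeta> * (A *\<^sub>v f) $ i - cnj \<zeta> * (adj A *\<^sub>v f) $ i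
      = of_real (2 * (r - cos \<theta>)) * f $ i + of_real (sin (\<phi> - \<theta>)) * e 0 $ i
       - of_real (sin \<phi>) * cnj \<zeta> * (adj A *\<^sub>v e 0) $ i"
      unfolding 1 2 3 c_def
    proof (rule supp_sum[OF \<zeta>1 end0])
      show "e (Suc m) $ i = 0" using i by (simp add: eN)
      show "(adj A *\<^sub>v e (Suc k)) $ i = e k $ i" if "k < m" for k
        using adj_pow_Suc[OF h(1) that] by (simp add: e_def)
    qed
    then show "?l $ i = ?r $ i"
      unfolding supp_mat_mv[OF A fc] using i hc fc by (simp del: index_mult_mat_vec add: e0)
  qed
  moreover have "f \<bullet>c h = of_real (sin \<phi> * nsq h)"
  proof -
    have "e (Suc k) \<bullet>c h = 0" for k
    proof -
      have "h \<in> mat_kernel (A ^\<^sub>m (m + Suc k))"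
        using h(2) pow_kernel_mono[OF A, of "Suc m" "m + Suc k"] by auto
      then have "e (Suc k) \<in> mat_kernel (A ^\<^sub>m m)" unfolding e_def by (rule pow_kernel_shift[OF A])
      from orth_complementD(2)[OF h(1) this] show ?thesis
        using ip_cnj[of h "e (Suc k)"] hc by simp
    qed
    then have "f \<bullet>c h = c 0 * (e 0 \<bullet>c h)"
      unfolding f_def using hc by (subst lc_ip) (simp_all add: sum.lessThan_Suc_shift del: sum.lessThan_Suc)
    then show ?thesis by (simp add: c_def e0 ip_self)
  qed
  moreover have "(adj A *\<^sub>v h) \<bullet>c f = 0"
  proof -
    have "A ^\<^sub>m m *\<^sub>v (A *\<^sub>v f) = lc n c (\<lambda>k. A ^\<^sub>m m *\<^sub>v e (Suc k)) (Suc m)"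
      unfolding f_def lc_mv[OF e A] eS by (rule lc_mv) auto
    also have "(\<lambda>k. A ^\<^sub>m m *\<^sub>v e (Suc k)) = (\<lambda>k. 0\<^sub>v n)"
    proof
      fix k
      have "A ^\<^sub>m m *\<^sub>v e (Suc k) = A ^\<^sub>m (k + Suc m) *\<^sub>v h"
        unfolding e_def pow_mat_mult_vec[OF A hc, symmetric] by (simp add: add.commute)
      also have "\<dots> = A ^\<^sub>m k *\<^sub>v e (Suc m)" unfolding e_def by (rule pow_mat_mult_vec[OF A hc])
      also have "\<dots> = 0\<^sub>v n" unfolding eN by simp
      finally show "A ^\<^sub>m m *\<^sub>v e (Suc k) = 0\<^sub>v n" .
    qed
    also have "lc n c (\<lambda>k. 0\<^sub>v n) (Suc m) = 0\<^sub>v n"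
      by (rule eq_vecI) (simp_all add: lc_index)
    finally have "A *\<^sub>v f \<in> mat_kernel (A ^\<^sub>m m)" by (simp add: pow_kernel_iff[OF A])
    from orth_complementD(2)[OF h(1) this] show ?thesis using hc fc by (simp add: ip_adj')
  qed
  ultimately show thesis using that fc by blast
qed

end

section \<open>A disc forces nilpotency\<close>

lemma orth_complement_orth_complement:
  assumes S: "subsp n S" and x: "x \<in> orth_complement n (orth_complement n S)"
  shows "x \<in> S"
proof -
  have xc: "x \<in> carrier_vec n" by (rule orth_complementD[OF x])
  obtain k u where ku: "k \<in> S" "u \<in> orth_complement n S" "x = k + u" "k \<bullet>c u = 0"
    by (rule orth_decomp[OF S xc])
  have kc: "k \<in> carrier_vec n" by (rule subspD(1)[OF S ku(1)])
  have uc: "u \<in> carrier_vec n" by (rule orth_complementD[OF ku(2)])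
  have "u \<bullet>c u = 0"
    using orth_complementD(2)[OF x ku(2)] ku(3,4) kc uc by (simp add: ip_add_left)
  then have "u = 0\<^sub>v n" using nsq_eq_0_iff[OF uc] by (simp add: ip_self)
  then show ?thesis using ku kc by simp
qed

text \<open>An eigenvector of the compression to the complement of \<open>S\<close>, carried back by
  its basis, satisfies the eigenvalue equation up to a vector orthogonal to that complement, that
  is, up to an element of \<open>S\<close>.\<close>

lemma compression_eigenvector:
  assumes A: "A \<in> carrier_mat n n" and S: "subsp n S" and ne: "S \<noteq> carrier_vec n"
  obtains v \<mu> where "v \<in> orth_complement n S" "nsq v \<noteq> 0" "A *\<^sub>v v - \<mu> \<cdot>\<^sub>v v \<in> S"
proof -
  have Sc: "S \<subseteq> carrier_vec n" using subspD(1)[OF S] by auto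
  define M where "M = orth_complement n S"
  have M: "subsp n M" unfolding M_def by (rule subsp_orth_complement[OF Sc])
  obtain k V where V: "isom_mat n k V" and VM: "\<forall>c\<in>carrier_vec k. V *\<^sub>v c \<in> M"
    and MV: "\<forall>x\<in>M. V *\<^sub>v (adj V *\<^sub>v x) = x"
    by (rule subsp_basis[OF M])
  note D = isom_matD(1-3)[OF V]
  have dA: "dim_row A = n" "dim_col A = n" using A by auto
  have "k \<noteq> 0"
  proof
    assume k: "k = 0"
    obtain u where u: "u \<in> carrier_vec n" "nsq u = 1" "u \<in> M"
      using unit_vec_between[OF S subsp_carrier Sc ne] unfolding M_def by blast
    have "V *\<^sub>v (adj V *\<^sub>v u) = 0\<^sub>v n"
      using D k by (intro eq_vecI) (auto simp: scalar_prod_def)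
    then have "u = 0\<^sub>v n" using MV u(3) by simp
    then show False using u(2) nsq_eq_0_iff[OF u(1)] by simp
  qed
  define C where "C = adj V * A * V"
  have C: "C \<in> carrier_mat k k" using D dA by (auto simp: C_def)
  obtain \<mu> where "\<mu> \<in> spectrum C" using spectrum_non_empty[OF C] \<open>k \<noteq> 0\<close> by auto
  then obtain c where c: "c \<in> carrier_vec k" "c \<noteq> 0\<^sub>v k" "C *\<^sub>v c = \<mu> \<cdot>\<^sub>v c"
    using C unfolding spectrum_def eigenvalue_def eigenvector_def by auto
  define v where "v = V *\<^sub>v c"
  have v: "v \<in> M" using VM c(1) by (simp add: v_def)
  have vc: "v \<in> carrier_vec n" using D by (simp add: v_def)
  have nv: "nsq v \<noteq> 0" using isom_mat_nsq[OF V c(1)] nsq_eq_0_iff[OF c(1)] c(2) by (simp add: v_def)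
  have "V *\<^sub>v (C *\<^sub>v c) = V *\<^sub>v (adj V *\<^sub>v (A *\<^sub>v v))"
    unfolding C_def v_def using D dA c(1) by (simp add: mv_linear)
  then have res: "V *\<^sub>v (adj V *\<^sub>v (A *\<^sub>v v)) = \<mu> \<cdot>\<^sub>v v"
    unfolding c(3) v_def using D c(1) by (simp add: mv_linear)
  have Av: "A *\<^sub>v v \<in> carrier_vec n" using dA by simp
  have "A *\<^sub>v v - \<mu> \<cdot>\<^sub>v v \<in> orth_complement n M"
  proof (rule orth_complementI)
    show "A *\<^sub>v v - \<mu> \<cdot>\<^sub>v v \<in> carrier_vec n" using Av vc by simp
    fix y assume y: "y \<in> M"
    have "adj V *\<^sub>v y \<in> carrier_vec k" using D by simp
    from isom_mat_orth_residual[OF V Av this] show "(A *\<^sub>v v - \<mu> \<cdot>\<^sub>v v) \<bullet>c y = 0"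
      unfolding res using MV y by simp
  qed
  then have "A *\<^sub>v v - \<mu> \<cdot>\<^sub>v v \<in> S"
    unfolding M_def by (rule orth_complement_orth_complement[OF S])
  with v nv show thesis unfolding M_def by (intro that)
qed

locale disc_range_pi = disc_range +
  assumes pi: "j < ascent A \<Longrightarrow> partial_isometry (A ^\<^sub>m j)"
begin

definition \<theta> :: real where "\<theta> = pi / (real (ascent A) + 1)"

lemma radius_le: "r \<le> cos \<theta>"
  unfolding \<theta>_def by (rule pencil_radius_le[OF A pi pencil_exists])

text \<open>For ascent 0 the angle is pi and the radius bound would read r <= -1.\<close>

lemma ascent_pos: "ascent A \<noteq> 0"
proof
  assume "ascent A = 0"
  then have "cos \<theta> = -1" by (simp add: \<theta>_def)
  then show False using radius_le r by simp
qed

lemma angle: "0 < \<theta>" "\<theta> \<le> pi / 2" "sin \<theta> > 0"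
proof -
  show "0 < \<theta>" by (simp add: \<theta>_def)
  show "\<theta> \<le> pi / 2" unfolding \<theta>_def using ascent_pos by (intro divide_left_mono) auto
  with \<open>0 < \<theta>\<close> show "sin \<theta> > 0" by (intro sin_gt_zero) auto
qed

lemma end_angle: "real (ascent A) * \<theta> + \<theta> = pi"
proof -
  have "real (ascent A) * \<theta> + \<theta> = (real (ascent A) + 1) * \<theta>" by (simp add: algebra_simps)
  also have "\<dots> = pi" unfolding \<theta>_def by (simp add: add_nonneg_eq_0_iff)
  finally show ?thesis .
qed

lemma top_pi: "ascent A = Suc m \<Longrightarrow> power_pi n A m"
  using pi by unfold_locales auto

text \<open>The phase phi = theta makes the boundary term in h vanish, and for a chain of length a
  the sine after the last weight is sin pi. Only the boundary term with \<open>adj A\<close>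
  survives, and it is orthogonal to f.\<close>

lemma top_form:
  assumes m: "ascent A = Suc m"
    and h: "h \<in> orth_complement n (mat_kernel (A ^\<^sub>m m))" "h \<in> mat_kernel (A ^\<^sub>m Suc m)"
  obtains f where "f \<in> carrier_vec n"
    "supp_mat A r 1 *\<^sub>v f = of_real (2 * (r - cos \<theta>)) \<cdot>\<^sub>v f - of_real (sin \<theta>) \<cdot>\<^sub>v (adj A *\<^sub>v h)"
    "f \<bullet>c h = of_real (sin \<theta> * nsq h)"
    "(supp_mat A r 1 *\<^sub>v f) \<bullet>c f = of_real (2 * (r - cos \<theta>) * nsq f)"
proof -
  interpret p: power_pi n A m by (rule top_pi[OF m])
  have hc: "h \<in> carrier_vec n" by (rule orth_complementD[OF h(1)])
  have e: "sin (real (Suc m) * \<theta> + \<theta>) = 0" using end_angle m by simp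
  obtain f where f: "f \<in> carrier_vec n"
    "supp_mat A r 1 *\<^sub>v f = of_real (2 * (r - cos \<theta>)) \<cdot>\<^sub>v f + of_real (sin (\<theta> - \<theta>)) \<cdot>\<^sub>v h
       - (of_real (sin \<theta>) * cnj 1) \<cdot>\<^sub>v (adj A *\<^sub>v h)"
    "f \<bullet>c h = of_real (sin \<theta> * nsq h)" "(adj A *\<^sub>v h) \<bullet>c f = 0"
    by (rule p.supp_mat_chain[OF h norm_one e])
  have L: "supp_mat A r 1 *\<^sub>v f = of_real (2 * (r - cos \<theta>)) \<cdot>\<^sub>v f - of_real (sin \<theta>) \<cdot>\<^sub>v (adj A *\<^sub>v h)"
    unfolding f(2) using f(1) hc by (intro eq_vecI) simp_all
  show thesis
  proof (rule that[OF f(1) L f(3)])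
    show "(supp_mat A r 1 *\<^sub>v f) \<bullet>c f = of_real (2 * (r - cos \<theta>) * nsq f)"
      unfolding L using f by (simp add: ip_linear ip_self)
  qed
qed

text \<open>The sine vector f is nonzero, as <f, h> = sin theta for a unit generator h; positivity
  of the form at f then forces r >= cos theta.\<close>

lemma radius_eq: "r = cos \<theta>"
proof (rule antisym[OF radius_le])
  obtain m where m: "ascent A = Suc m" using ascent_pos not0_implies_Suc by blast
  obtain h where h: "h \<in> mat_kernel (A ^\<^sub>m Suc m)" "nsq h = 1"
    "h \<in> orth_complement n (mat_kernel (A ^\<^sub>m m))"
    by (rule ascent_unit_vec[OF A m])
  have hc: "h \<in> carrier_vec n" by (rule orth_complementD[OF h(3)])
  obtain f where f: "f \<in> carrier_vec n" "f \<bullet>c h = of_real (sin \<theta> * nsq h)"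
    "(supp_mat A r 1 *\<^sub>v f) \<bullet>c f = of_real (2 * (r - cos \<theta>) * nsq f)"
    by (rule top_form[OF m h(3,1)])
  have "f \<noteq> 0\<^sub>v n" using f(2) h(2) angle(3) hc by auto
  then have "nsq f > 0" using nsq_eq_0_iff[OF f(1)] nsq_nonneg[of f] by linarith
  moreover have "0 \<le> 2 * (r - cos \<theta>) * nsq f"
    using supp_psd[of 1 f] f(1) unfolding f(3) by simp
  ultimately show "cos \<theta> \<le> r" by (simp add: zero_le_mult_iff)
qed

text \<open>At r = cos theta the nonnegative form vanishes at f, so f lies in the kernel of the
  supporting matrix. Of its image only - sin theta times the vector in question is left.\<close>

lemma adj_top_eq_0:
  assumes m: "ascent A = Suc m"
    and h: "h \<in> orth_complement n (mat_kernel (A ^\<^sub>m m))" "h \<in> mat_kernel (A ^\<^sub>m Suc m)"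
  shows "adj A *\<^sub>v h = 0\<^sub>v n"
proof -
  obtain f where f: "f \<in> carrier_vec n"
    "supp_mat A r 1 *\<^sub>v f = of_real (2 * (r - cos \<theta>)) \<cdot>\<^sub>v f - of_real (sin \<theta>) \<cdot>\<^sub>v (adj A *\<^sub>v h)"
    "(supp_mat A r 1 *\<^sub>v f) \<bullet>c f = of_real (2 * (r - cos \<theta>) * nsq f)"
    by (rule top_form[OF m h])
  have "Re ((supp_mat A r 1 *\<^sub>v f) \<bullet>c f) = 0" unfolding f(3) by (simp add: radius_eq)
  then have "supp_mat A r 1 *\<^sub>v f = 0\<^sub>v n" by (intro supp_kernel f(1)) auto
  then have eq: "of_real (2 * (r - cos \<theta>)) \<cdot>\<^sub>v f - of_real (sin \<theta>) \<cdot>\<^sub>v (adj A *\<^sub>v h) = 0\<^sub>v n"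
    unfolding f(2) .
  show ?thesis
  proof (rule eq_vecI)
    fix i assume "i < dim_vec (0\<^sub>v n :: complex vec)"
    then have i: "i < n" by simp
    have "of_real (sin \<theta>) * (adj A *\<^sub>v h) $ i = 0"
      using arg_cong[OF eq, of "\<lambda>v. v $ i"] i f(1) by (simp add: radius_eq del: index_mult_mat_vec)
    then show "(adj A *\<^sub>v h) $ i = 0\<^sub>v n $ i" using angle(3) i by (simp del: index_mult_mat_vec)
  qed simp
qed

text \<open>Let v be an eigenvector of the compression to the complement of N, and w = A v - mu v.
  Because \<open>adj A\<close> kills the generators of the longest chains, w is a generator of
  length a - 1 or zero, so v, w, A w, ... imitate a chain of length a, with mu as an additional
  diagonal entry. A nonzero mu pushes the sine vector beyond a supporting line.\<close>

lemma nilpotent: "mat_kernel (A ^\<^sub>m ascent A) = carrier_vec n"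
proof (rule ccontr)
  let ?N = "mat_kernel (A ^\<^sub>m ascent A)"
  assume ne: "?N \<noteq> carrier_vec n"
  have Ak: "A ^\<^sub>m k \<in> carrier_mat n n" for k by simp
  note N = subsp_kernel[OF Ak[of "ascent A"]]
  obtain v \<mu> where v: "v \<in> orth_complement n ?N" "nsq v \<noteq> 0" and wN: "A *\<^sub>v v - \<mu> \<cdot>\<^sub>v v \<in> ?N"
    by (rule compression_eigenvector[OF A N ne])
  define w where "w = A *\<^sub>v v - \<mu> \<cdot>\<^sub>v v"
  have vc: "v \<in> carrier_vec n" by (rule orth_complementD[OF v(1)])
  have wc: "w \<in> carrier_vec n" using vc by (simp add: w_def)
  have d: "dim_vec v = n" "dim_vec w = n" using vc wc by auto
  have Av: "A *\<^sub>v v = \<mu> \<cdot>\<^sub>v v + w"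
    unfolding w_def using vc by (intro vec_diff_add_cancel[of _ n, symmetric]) auto
  have vw: "v \<bullet>c w = 0" "w \<bullet>c v = 0"
    using orth_complementD(2)[OF v(1) wN] ip_cnj[of v w] d by (simp_all add: w_def[symmetric])
  have V: "nsq v > 0" using v(2) nsq_nonneg[of v] by linarith
  have "\<mu> \<noteq> 0"
  proof
    assume "\<mu> = 0"
    moreover have "0 \<cdot>\<^sub>v v + w = w" using d by (intro eq_vecI) auto
    ultimately have "A *\<^sub>v v \<in> ?N" using Av wN unfolding w_def[symmetric] by simp
    moreover have "A ^\<^sub>m Suc 0 = A" by (simp add: left_mult_one_mat[OF A])
    ultimately have "v \<in> mat_kernel (A ^\<^sub>m Suc (ascent A))"
      using pow_mat_mult_vec[OF A vc, of "ascent A" 1] vc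
      by (simp add: pow_kernel_iff[OF A] del: pow_mat.simps(2))
    then have "v \<in> ?N" using ascent_kernel_eq[OF A, of "Suc (ascent A)"] by simp
    then have "v \<bullet>c v = 0" by (rule orth_complementD(2)[OF v(1)])
    then show False using v(2) by (simp add: ip_self)
  qed
  obtain m where m: "ascent A = Suc m" using ascent_pos not0_implies_Suc by blast
  interpret p: power_pi n A m by (rule top_pi[OF m])
  have Avv: "(A *\<^sub>v v) \<bullet>c v = \<mu> * of_real (nsq v)"
    unfolding Av using d vw by (simp add: ip_linear ip_self)
  show False
  proof (cases m)
    case 0
    \<comment> \<open>For a = 1 the disc is a point, which <A v, v> = mu |v|^2 already
      contradicts.\<close>
    have "r = 0" unfolding radius_eq \<theta>_def m 0 by simp
    then have "(A *\<^sub>v v) \<bullet>c v = 0" using bound[OF vc] by simp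
    then show False using Avv \<open>\<mu> \<noteq> 0\<close> v(2) by simp
  next
    case (Suc l)
    interpret q: power_pi n A l by (rule p.sub_pi) (simp add: Suc)
    have vm: "v \<in> orth_complement n (mat_kernel (A ^\<^sub>m m))"
      by (rule p.orth_mono[of m "ascent A"]) (use v m in auto)
    have A1: "A ^\<^sub>m 1 = A" by (simp add: left_mult_one_mat[OF A])
    have AAv: "adj A *\<^sub>v (A *\<^sub>v v) = v"
      using p.adj_pow_Suc[OF vm, of 0] Suc vc A1 by simp
    have nAv: "nsq (A *\<^sub>v v) = nsq v" using p.nsq_pow[OF vm, of 1] Suc A1 by simp
    have Avl: "A *\<^sub>v v \<in> orth_complement n (mat_kernel (A ^\<^sub>m l))"
      using p.pow_orth[OF vm, of 1 l] Suc A1 by simp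
    have vl: "v \<in> orth_complement n (mat_kernel (A ^\<^sub>m l))"
      by (rule p.orth_mono[OF _ vm]) (simp add: Suc)
    have "subsp n (orth_complement n (mat_kernel (A ^\<^sub>m l)))"
      by (intro subsp_orth_complement mat_kernel_carrier[OF Ak])
    then have wl: "w \<in> orth_complement n (mat_kernel (A ^\<^sub>m l))"
      unfolding w_def by (intro subsp_diff subsp_smult Avl vl)
    \<comment> \<open>The component u of w orthogonal to ker A^m is a generator of maximal length,
      so adj A u = 0. Hence u is orthogonal to A v as well as to v, thus to w, and vanishes.\<close>
    have wm: "w \<in> mat_kernel (A ^\<^sub>m Suc l)"
    proof -
      obtain k u where ku: "k \<in> mat_kernel (A ^\<^sub>m m)" "u \<in> orth_complement n (mat_kernel (A ^\<^sub>m m))"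
        "w = k + u" "k \<bullet>c u = 0"
        by (rule orth_decomp[OF subsp_kernel[OF Ak] wc])
      have kc: "k \<in> carrier_vec n" by (rule subspD(1)[OF subsp_kernel[OF Ak] ku(1)])
      have uc: "u \<in> carrier_vec n" by (rule orth_complementD[OF ku(2)])
      have "u = w - k" using ku(3) kc uc by auto
      moreover have "k \<in> ?N" using ku(1) pow_kernel_mono[OF A, of m "ascent A"] m by auto
      ultimately have uN: "u \<in> ?N" using subsp_diff[OF N wN] by (simp add: w_def)
      have "adj A *\<^sub>v u = 0\<^sub>v n" using adj_top_eq_0[OF m ku(2)] uN m by simp
      then have "(A *\<^sub>v v) \<bullet>c u = 0" using d uc vc by (simp add: ip_adj)
      moreover have "v \<bullet>c u = 0" by (rule orth_complementD(2)[OF v(1) uN])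
      ultimately have "w \<bullet>c u = 0" unfolding w_def using d uc by (simp add: ip_linear)
      then have "u \<bullet>c u = 0" using ku(3,4) kc uc by (simp add: ip_add_left)
      then have "u = 0\<^sub>v n" using nsq_eq_0_iff[OF uc] by (simp add: ip_self)
      then show ?thesis using ku kc Suc by simp
    qed
    \<comment> \<open>The rotation by \<open>\<zeta>\<close> makes the eigenvalue \<open>\<mu>\<close> positive; the vector \<open>x\<close> below then violates
      the supporting line inequality.\<close>
    define \<zeta> where "\<zeta> = cnj \<mu> / of_real (cmod \<mu>)"
    have \<zeta>: "cmod \<zeta> = 1" using \<open>\<mu> \<noteq> 0\<close> by (simp add: \<zeta>_def norm_divide)
    have \<zeta>\<mu>: "\<zeta> * \<mu> = of_real (cmod \<mu>)"
      using \<open>\<mu> \<noteq> 0\<close> complex_norm_square[of \<mu>]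
      by (simp add: \<zeta>_def power2_eq_square field_simps)
    have \<zeta>1: "\<zeta> * cnj \<zeta> = 1" using \<zeta> complex_norm_square[of \<zeta>] by simp
    \<comment> \<open>The phase starts at 2 theta because v takes the first weight sin theta. The
      chain of w has length a - 1, so the final angle is again (a+1) theta = pi.\<close>
    have e: "sin (real (Suc l) * \<theta> + 2 * \<theta>) = 0"
      using end_angle m Suc by (simp add: algebra_simps)
    obtain f where f: "f \<in> carrier_vec n"
      "supp_mat A r \<zeta> *\<^sub>v f = of_real (2 * (r - cos \<theta>)) \<cdot>\<^sub>v f + of_real (sin (2 * \<theta> - \<theta>)) \<cdot>\<^sub>v w
         - (of_real (sin (2 * \<theta>)) * cnj \<zeta>) \<cdot>\<^sub>v (adj A *\<^sub>v w)"
      "f \<bullet>c w = of_real (sin (2 * \<theta>) * nsq w)" "(adj A *\<^sub>v w) \<bullet>c f = 0"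
      by (rule q.supp_mat_chain[OF wl wm \<zeta> e])
    have df: "dim_vec f = n" using f(1) by auto
    define L where "L = supp_mat A r \<zeta>"
    have L: "L \<in> carrier_mat n n" "dim_row L = n" "dim_col L = n" "adj L = L"
      using supp_mat_carrier[OF A, of r \<zeta>] adj_supp_mat[OF A, of r \<zeta>] by (auto simp: L_def)
    define S where "S = sin \<theta>"
    define S2 where "S2 = sin (2 * \<theta>)"
    have Lf: "L *\<^sub>v f = of_real S \<cdot>\<^sub>v w - (of_real S2 * cnj \<zeta>) \<cdot>\<^sub>v (adj A *\<^sub>v w)"
      unfolding L_def f(2) S_def S2_def using d df by (intro eq_vecI) (simp_all add: radius_eq)
    have wf: "w \<bullet>c f = of_real (S2 * nsq w)"
      using f(3) ip_cnj[of f w] d df by (simp add: S2_def)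
    have Lff: "(L *\<^sub>v f) \<bullet>c f = of_real (S * S2 * nsq w)"
      unfolding Lf using d df f(4) wf by (simp add: ip_linear)
    have awv: "(adj A *\<^sub>v w) \<bullet>c v = of_real (nsq w)"
    proof -
      have "(adj A *\<^sub>v w) \<bullet>c v = w \<bullet>c (A *\<^sub>v v)" using d by (intro ip_adj') auto
      then show ?thesis unfolding Av using d vw by (simp add: ip_linear ip_self)
    qed
    have Lfv: "(L *\<^sub>v f) \<bullet>c v = - of_real S2 * cnj \<zeta> * of_real (nsq w)"
      unfolding Lf using d df vw awv by (simp add: ip_linear)
    have Lvf: "(L *\<^sub>v v) \<bullet>c f = cnj ((L *\<^sub>v f) \<bullet>c v)"
      using ip_adj[of L v f] ip_cnj[of "L *\<^sub>v f" v] L d df by simp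
    have Lvv: "Re ((L *\<^sub>v v) \<bullet>c v) = 2 * (r - cmod \<mu>) * nsq v"
    proof -
      have "\<zeta> * ((A *\<^sub>v v) \<bullet>c v) = of_real (cmod \<mu> * nsq v)"
        unfolding Avv using \<zeta>\<mu> by (simp flip: mult.assoc)
      then show ?thesis unfolding L_def supp_mat_form[OF A vc] by (simp add: algebra_simps)
    qed
    \<comment> \<open>The sine vector of J_a, with v in the first place and the chain of w in the
      other a - 1 places.\<close>
    define x where "x = of_real S \<cdot>\<^sub>v v + \<zeta> \<cdot>\<^sub>v f"
    have xc: "x \<in> carrier_vec n" using vc f(1) by (simp add: x_def)
    have "L *\<^sub>v x = of_real S \<cdot>\<^sub>v (L *\<^sub>v v) + \<zeta> \<cdot>\<^sub>v (L *\<^sub>v f)"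
      unfolding x_def using d df L by (simp add: mv_linear)
    then have "(L *\<^sub>v x) \<bullet>c x = of_real (S\<^sup>2) * ((L *\<^sub>v v) \<bullet>c v)
      + of_real S * (cnj \<zeta> * ((L *\<^sub>v v) \<bullet>c f)) + of_real S * (\<zeta> * ((L *\<^sub>v f) \<bullet>c v))
      + (\<zeta> * cnj \<zeta>) * ((L *\<^sub>v f) \<bullet>c f)"
      unfolding x_def using d df L by (simp add: ip_linear power2_eq_square algebra_simps)
    also have "cnj \<zeta> * ((L *\<^sub>v v) \<bullet>c f) = - of_real (S2 * nsq w) * (\<zeta> * cnj \<zeta>)"
      unfolding Lvf Lfv by simp
    also have "\<zeta> * ((L *\<^sub>v f) \<bullet>c v) = - of_real (S2 * nsq w) * (\<zeta> * cnj \<zeta>)"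
      unfolding Lfv by simp
    finally have "Re ((L *\<^sub>v x) \<bullet>c x) = S\<^sup>2 * (2 * (r - cmod \<mu>) * nsq v) - 2 * (S * S2 * nsq w) + S * S2 * nsq w"
      unfolding \<zeta>1 Lff by (simp add: Lvv del: Re_complex_of_real) (simp add: algebra_simps)
    also have "S2 = 2 * S * r" unfolding S2_def S_def radius_eq by (simp add: sin_double)
    also have "S\<^sup>2 * (2 * (r - cmod \<mu>) * nsq v) - 2 * (S * (2 * S * r) * nsq w) + S * (2 * S * r) * nsq w
      = 2 * S\<^sup>2 * ((r - cmod \<mu>) * nsq v - r * nsq w)"
      by (simp add: algebra_simps power2_eq_square)
    finally have form: "Re ((L *\<^sub>v x) \<bullet>c x) = 2 * S\<^sup>2 * ((r - cmod \<mu>) * nsq v - r * nsq w)" .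
    \<comment> \<open>A is isometric at v, and w is orthogonal to v. This identity bounds |mu| by 1
      and eliminates w from the form.\<close>
    have W: "nsq v = (cmod \<mu>)\<^sup>2 * nsq v + nsq w"
      using nAv nsq_add[of "\<mu> \<cdot>\<^sub>v v" w] d vw unfolding Av by (simp add: nsq_smult ip_linear)
    have "(1 - (cmod \<mu>)\<^sup>2) * nsq v \<ge> 0" using W nsq_nonneg[of w] unfolding left_diff_distrib by linarith
    then have l1: "cmod \<mu> \<le> 1" using V by (simp add: zero_le_mult_iff power_le_one_iff)
    have r1: "r < 1" unfolding radius_eq using cos_monotone_0_pi[of 0 \<theta>] angle by simp
    have "r * cmod \<mu> < 1" using l1 r1 r mult_left_mono[OF l1 r] by linarith
    then have neg: "cmod \<mu> * nsq v * (r * cmod \<mu> - 1) < 0"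
      using \<open>\<mu> \<noteq> 0\<close> V by (intro mult_pos_neg mult_pos_pos) auto
    have W': "nsq w = nsq v - (cmod \<mu>)\<^sup>2 * nsq v" using W by simp
    have "(r - cmod \<mu>) * nsq v - r * nsq w = cmod \<mu> * nsq v * (r * cmod \<mu> - 1)"
      unfolding W' by (simp add: algebra_simps power2_eq_square)
    then have "Re ((L *\<^sub>v x) \<bullet>c x) < 0"
      unfolding form using neg angle(3) by (simp add: S_def mult_pos_neg)
    then show False using supp_psd[OF \<zeta> xc] by (simp add: L_def)
  qed
qed

end

section \<open>Block decompositions under unitary similarity\<close>

lemma unitary_mat_iff:
  assumes "U \<in> carrier_mat n n"
  shows "unitary_mat U \<longleftrightarrow> adj U * U = 1\<^sub>m n \<and> U * adj U = 1\<^sub>m n"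
  using carrier_matD[OF assms] by (simp add: unitary_mat_def inverts_mat_def)

lemma unitarily_similarI:
  assumes A: "A \<in> carrier_mat n n" and B: "B \<in> carrier_mat n n" and U: "U \<in> carrier_mat n n"
    and UU: "adj U * U = 1\<^sub>m n" and eq: "A * U = U * B"
  shows "unitarily_similar A B"
proof -
  have U': "adj U \<in> carrier_mat n n" using U by simp
  have UU': "U * adj U = 1\<^sub>m n" by (rule mat_mult_left_right_inverse[OF U' U UU])
  have "A = A * (U * adj U)" using A UU' by simp
  also have "\<dots> = A * U * adj U" by (rule assoc_mult_mat[symmetric, OF A U U'])
  finally have e: "A = U * B * adj U" unfolding eq .
  have "similar_mat_wit A B U (adj U)"
    by (rule similar_mat_witI[OF UU' UU e A B U U'])
  moreover have "unitary_mat U" using UU UU' by (simp add: unitary_mat_iff[OF U])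
  ultimately show ?thesis unfolding unitarily_similar_def by blast
qed

lemma unitarily_similarD:
  assumes "unitarily_similar A B" "A \<in> carrier_mat n n"
  obtains U where "U \<in> carrier_mat n n" "B \<in> carrier_mat n n" "adj U * U = 1\<^sub>m n" "U * adj U = 1\<^sub>m n"
    "A = U * B * adj U" "similar_mat_wit A B U (adj U)"
proof -
  obtain U where w: "similar_mat_wit A B U (adj U)"
    using assms(1) unfolding unitarily_similar_def by blast
  note D = similar_mat_witD2[OF assms(2) w]
  show thesis by (rule that[OF D(6,5,2,1,3) w])
qed

lemma unitarily_similar_wit:
  assumes w: "similar_mat_wit A B U (adj U)"
  shows "unitarily_similar A B"
proof -
  note D = similar_mat_witD[OF refl w]
  have "unitary_mat U" using D(1,2) by (simp add: unitary_mat_iff[OF D(6)])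
  with w show ?thesis unfolding unitarily_similar_def by blast
qed

lemma unitarily_similar_trans:
  assumes "unitarily_similar A B" "unitarily_similar B C"
  shows "unitarily_similar A C"
proof -
  define n where "n = dim_row A"
  obtain U where U: "similar_mat_wit A B U (adj U)"
    using assms(1) unfolding unitarily_similar_def by blast
  obtain V where V: "similar_mat_wit B C V (adj V)"
    using assms(2) unfolding unitarily_similar_def by blast
  note DU = similar_mat_witD[OF n_def U]
  note DV = similar_mat_witD2[OF DU(5) V]
  have "adj (U * V) = adj V * adj U"
    using DU(6) DV(6) by (intro adj_mult) auto
  then show ?thesis
    using similar_mat_wit_trans[OF U V] by (intro unitarily_similar_wit[of _ _ "U * V"]) simp
qed

lemma adj_four_block:
  assumes "P \<in> carrier_mat n n" "Q \<in> carrier_mat m m"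
  shows "adj (four_block_mat P (0\<^sub>m n m) (0\<^sub>m m n) Q) = four_block_mat (adj P) (0\<^sub>m n m) (0\<^sub>m m n) (adj Q)"
proof -
  have "dim_row P = n" "dim_col P = n" "dim_row Q = m" "dim_col Q = m" using assms by auto
  then show ?thesis by (intro eq_matI) simp_all
qed

lemma unitarily_similar_four_block:
  assumes P: "P \<in> carrier_mat n n" and Q: "Q \<in> carrier_mat m m" and QR: "unitarily_similar Q R"
  shows "unitarily_similar (four_block_mat P (0\<^sub>m n m) (0\<^sub>m m n) Q) (four_block_mat P (0\<^sub>m n m) (0\<^sub>m m n) R)"
proof -
  obtain U where U: "U \<in> carrier_mat m m" "similar_mat_wit Q R U (adj U)"
    using unitarily_similarD[OF QR Q] by blast
  have "similar_mat_wit (four_block_mat P (0\<^sub>m n m) (0\<^sub>m m n) Q) (four_block_mat P (0\<^sub>m n m) (0\<^sub>m m n) R)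
    (four_block_mat (1\<^sub>m n) (0\<^sub>m n m) (0\<^sub>m m n) U) (four_block_mat (1\<^sub>m n) (0\<^sub>m n m) (0\<^sub>m m n) (adj U))"
    by (rule similar_mat_wit_four_block[OF similar_mat_wit_refl[OF P] U(2)]) (use P Q U in auto)
  moreover have "adj (four_block_mat (1\<^sub>m n) (0\<^sub>m n m) (0\<^sub>m m n) U)
    = four_block_mat (1\<^sub>m n) (0\<^sub>m n m) (0\<^sub>m m n) (adj U)"
    using adj_four_block[OF one_carrier_mat U(1)] by simp
  ultimately show ?thesis
    by (metis unitarily_similar_wit)
qed

lemma isom_pair_block:
  assumes A: "A \<in> carrier_mat n n"
    and V: "isom_mat n k V" and W: "isom_mat n m W"
    and VW: "\<And>c d. c \<in> carrier_vec k \<Longrightarrow> d \<in> carrier_vec m \<Longrightarrow> (V *\<^sub>v c) \<bullet>c (W *\<^sub>v d) = 0"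
    and span: "\<And>x. x \<in> carrier_vec n \<Longrightarrow> V *\<^sub>v (adj V *\<^sub>v x) + W *\<^sub>v (adj W *\<^sub>v x) = x"
    and X: "X \<in> carrier_mat k k" "A * V = V * X" and Y: "Y \<in> carrier_mat m m" "A * W = W * Y"
  shows "k + m = n" "unitarily_similar A (four_block_mat X (0\<^sub>m k m) (0\<^sub>m m k) Y)"
proof -
  note DV = isom_matD(1-3)[OF V] and DW = isom_matD(1-3)[OF W]
  define U where "U = mat n (k + m) (\<lambda>(i, j). if j < k then V $$ (i, j) else W $$ (i, j - k))"
  have U: "U \<in> carrier_mat n (k + m)" "dim_row U = n" "dim_col U = k + m" by (auto simp: U_def)
  have rowU: "row U i = row V i @\<^sub>v row W i" if "i < n" for i
    by (rule eq_vecI) (use that DV DW in \<open>auto simp: U_def append_vec_def\<close>)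
  have Uap: "U *\<^sub>v (a @\<^sub>v b) = V *\<^sub>v a + W *\<^sub>v b" if "a \<in> carrier_vec k" "b \<in> carrier_vec m" for a b
  proof (rule eq_vecI)
    fix i assume "i < dim_vec (V *\<^sub>v a + W *\<^sub>v b)"
    then have i: "i < n" using DW by simp
    then have "(U *\<^sub>v (a @\<^sub>v b)) $ i = row U i \<bullet> (a @\<^sub>v b)" using U by simp
    also have "\<dots> = row V i \<bullet> a + row W i \<bullet> b"
      unfolding rowU[OF i] by (rule scalar_prod_append) (use that DV DW in auto)
    finally show "(U *\<^sub>v (a @\<^sub>v b)) $ i = (V *\<^sub>v a + W *\<^sub>v b) $ i" using i DV DW by simp
  qed (use U DW in simp)
  have colU: "col U j = (if j < k then V *\<^sub>v unit_vec k j else W *\<^sub>v unit_vec m (j - k))" if "j < k + m" for j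
    by (rule eq_vecI) (use that DV DW in \<open>auto simp: U_def\<close>)
  have iU: "isom_mat n (k + m) U"
  proof (rule isom_matI[OF U(1)])
    fix i j assume ij: "i < k + m" "j < k + m"
    have WV: "(W *\<^sub>v d) \<bullet>c (V *\<^sub>v c) = 0" if "c \<in> carrier_vec k" "d \<in> carrier_vec m" for c d
      using VW[OF that] ip_cnj[of "V *\<^sub>v c" "W *\<^sub>v d"] DV DW by simp
    have conjunit: "conjugate (unit_vec q l) = (unit_vec q l :: complex vec)" for q l
      by (rule eq_vecI) (auto simp: unit_vec_def)
    show "col U i \<bullet>c col U j = (if i = j then 1 else 0)"
      using ij by (auto simp: colU VW WV isom_mat_ip[OF V] isom_mat_ip[OF W] conjunit)
  qed
  have UUx: "U *\<^sub>v (adj U *\<^sub>v x) = x" if x: "x \<in> carrier_vec n" for x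
  proof -
    have "adj U *\<^sub>v x = (adj V *\<^sub>v x) @\<^sub>v (adj W *\<^sub>v x)"
    proof (rule eq_vecI)
      fix i assume "i < dim_vec ((adj V *\<^sub>v x) @\<^sub>v (adj W *\<^sub>v x))"
      then have i: "i < k + m" using DV DW by simp
      show "(adj U *\<^sub>v x) $ i = ((adj V *\<^sub>v x) @\<^sub>v (adj W *\<^sub>v x)) $ i"
        using i U DV DW x by (auto simp: U_def scalar_prod_def append_vec_def intro!: sum.cong)
    qed (use U DV DW in simp)
    then show ?thesis using Uap[of "adj V *\<^sub>v x" "adj W *\<^sub>v x"] span[OF x] DV DW by simp
  qed
  have "U * adj U = 1\<^sub>m n"
    by (rule mat_eq_by_vec[of _ n n]) (use U UUx in \<open>auto simp: mv_mult\<close>)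
  \<comment> \<open>U = [V W] and its adjoint are both isometries, so \<open>isom_mat_le\<close>
    bounds the dimensions in both directions.\<close>
  then have "isom_mat (k + m) n (adj U)" using U by (simp add: isom_mat_def)
  from isom_mat_le[OF this] isom_mat_le[OF iU] show km: "k + m = n" by simp
  show "unitarily_similar A (four_block_mat X (0\<^sub>m k m) (0\<^sub>m m k) Y)" (is "unitarily_similar A ?B")
  proof (rule unitarily_similarI[OF A])
    show B: "?B \<in> carrier_mat n n" using X Y km by auto
    show "U \<in> carrier_mat n n" using U km by simp
    show "adj U * U = 1\<^sub>m n" using iU km by (simp add: isom_mat_def)
    show "A * U = U * ?B"
    proof (rule mat_eq_by_vec[of _ n n])
      fix x :: "complex vec" assume "x \<in> carrier_vec n"
      then have x: "x \<in> carrier_vec (k + m)" using km by simp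
      define a b where "a = vec_first x k" and "b = vec_last x m"
      have ab: "a \<in> carrier_vec k" "b \<in> carrier_vec m" by (auto simp: a_def b_def)
      have xab: "x = a @\<^sub>v b" using vec_first_last_append[OF x] by (simp add: a_def b_def)
      have dX: "dim_row X = k" "dim_col X = k" "dim_row Y = m" "dim_col Y = m" "dim_row A = n" "dim_col A = n"
        "dim_vec a = k" "dim_vec b = m" using X Y A ab by auto
      have AV: "A *\<^sub>v (V *\<^sub>v a) = V *\<^sub>v (X *\<^sub>v a)"
        using arg_cong[OF X(2), of "\<lambda>M. M *\<^sub>v a"] dX DV by (simp add: mv_mult)
      have AW: "A *\<^sub>v (W *\<^sub>v b) = W *\<^sub>v (Y *\<^sub>v b)"
        using arg_cong[OF Y(2), of "\<lambda>M. M *\<^sub>v b"] dX DW by (simp add: mv_mult)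
      have "(A * U) *\<^sub>v x = V *\<^sub>v (X *\<^sub>v a) + W *\<^sub>v (Y *\<^sub>v b)"
        using U km dX DV DW xab Uap[OF ab] AV AW by (simp add: mv_mult mv_vec_add)
      moreover have "?B *\<^sub>v x = (X *\<^sub>v a) @\<^sub>v (Y *\<^sub>v b)"
        unfolding xab
        by (subst four_block_mat_mult_vec[OF X(1) _ _ Y(1) ab]) (use dX in auto)
      then have "(U * ?B) *\<^sub>v x = U *\<^sub>v ((X *\<^sub>v a) @\<^sub>v (Y *\<^sub>v b))"
        using mv_mult[of U ?B x] B U km x by simp
      then have "(U * ?B) *\<^sub>v x = V *\<^sub>v (X *\<^sub>v a) + W *\<^sub>v (Y *\<^sub>v b)"
        using Uap[of "X *\<^sub>v a" "Y *\<^sub>v b"] dX by simp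
      ultimately show "(A * U) *\<^sub>v x = (U * ?B) *\<^sub>v x" by simp
    qed (use A U B km in auto)
  qed
qed

text \<open>The basis \<open>V\<close> of \<open>S\<close> comes from the caller, since a Jordan
  chain has to keep its order; on the complement any orthonormal basis \<open>W\<close> will do.
  Both \<open>A * W = W * Y\<close> and the dual \<open>adj W * A = Y * adj W\<close> are returned:
  the first transports vectors and powers from the block \<open>Y\<close> to \<open>A\<close>, the
  second kernels of powers back to \<open>Y\<close>.\<close>

lemma reducing_block:
  assumes A: "A \<in> carrier_mat n n" and S: "subsp n S"
    and AS: "\<And>x. x \<in> S \<Longrightarrow> A *\<^sub>v x \<in> S"
    and AM: "\<And>x. x \<in> orth_complement n S \<Longrightarrow> A *\<^sub>v x \<in> orth_complement n S"
    and V: "isom_mat n k V" and VS: "\<forall>c\<in>carrier_vec k. V *\<^sub>v c \<in> S"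
    and SV: "\<forall>x\<in>S. V *\<^sub>v (adj V *\<^sub>v x) = x"
  obtains m W Y where "k + m = n" "isom_mat n m W" "Y \<in> carrier_mat m m" "A * W = W * Y"
    "\<forall>c\<in>carrier_vec m. W *\<^sub>v c \<in> orth_complement n S" "Y = adj W * A * W"
    "unitarily_similar A (four_block_mat (adj V * A * V) (0\<^sub>m k m) (0\<^sub>m m k) Y)"
    "adj W * A = Y * adj W"
proof -
  define M where "M = orth_complement n S"
  have M: "subsp n M" unfolding M_def using subspD(1)[OF S] by (intro subsp_orth_complement) auto
  obtain m W where W: "isom_mat n m W" and WM: "\<forall>c\<in>carrier_vec m. W *\<^sub>v c \<in> M"
    and MW: "\<forall>x\<in>M. W *\<^sub>v (adj W *\<^sub>v x) = x"
    by (rule subsp_basis[OF M])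
  note DV = isom_matD(1-3)[OF V] and DW = isom_matD(1-3)[OF W]
  have dA: "dim_row A = n" "dim_col A = n" using A by auto
  define Y where "Y = adj W * A * W"
  have Y: "Y \<in> carrier_mat m m" using DW dA by (auto simp: Y_def)
  have dY: "dim_row Y = m" "dim_col Y = m" using Y by auto
  have MS: "x \<bullet>c y = 0" "y \<bullet>c x = 0" if "x \<in> S" "y \<in> M" for x y
  proof -
    show "y \<bullet>c x = 0" using that orth_complementD(2) by (auto simp: M_def)
    then show "x \<bullet>c y = 0"
      using ip_cnj[of y x] subspD(1)[OF S that(1)] subspD(1)[OF M that(2)] by simp
  qed
  \<comment> \<open>Invariance of \<open>S\<close> under A means invariance of its complement under
    the adjoint; this gives the dual intertwining relation.\<close>
  have adjM: "adj A *\<^sub>v y \<in> M" if y: "y \<in> M" for y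
    unfolding M_def
  proof (rule orth_complementI)
    fix s assume s: "s \<in> S"
    have "y \<in> carrier_vec n" "s \<in> carrier_vec n" using subspD(1)[OF M y] subspD(1)[OF S s] .
    then show "(adj A *\<^sub>v y) \<bullet>c s = 0" using MS(2)[OF AS[OF s] y] dA by (simp add: ip_adj')
  qed (use dA in simp)
  have WY: "A *\<^sub>v (W *\<^sub>v c) = W *\<^sub>v (Y *\<^sub>v c)" if "c \<in> carrier_vec m" for c
  proof -
    have "A *\<^sub>v (W *\<^sub>v c) \<in> M" using AM WM that unfolding M_def by blast
    then have "W *\<^sub>v (adj W *\<^sub>v (A *\<^sub>v (W *\<^sub>v c))) = A *\<^sub>v (W *\<^sub>v c)" using MW by blast
    then show ?thesis unfolding Y_def using DW dA that by (simp add: mv_mult)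
  qed
  have AW: "A * W = W * Y"
    by (rule mat_eq_by_vec[of _ n m]) (use A DW Y dY dA WY in \<open>auto simp: mv_mult\<close>)
  have AV: "A * V = V * (adj V * A * V)"
  proof (rule mat_eq_by_vec[of _ n k])
    fix c :: "complex vec" assume c: "c \<in> carrier_vec k"
    have "A *\<^sub>v (V *\<^sub>v c) \<in> S" using AS VS c by blast
    then have "V *\<^sub>v (adj V *\<^sub>v (A *\<^sub>v (V *\<^sub>v c))) = A *\<^sub>v (V *\<^sub>v c)" using SV by blast
    then show "(A * V) *\<^sub>v c = (V * (adj V * A * V)) *\<^sub>v c" using DV dA c by (simp add: mv_mult)
  qed (use A DV dA in auto)
  have span: "V *\<^sub>v (adj V *\<^sub>v x) + W *\<^sub>v (adj W *\<^sub>v x) = x" if x: "x \<in> carrier_vec n" for x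
  proof -
    obtain s u where su: "s \<in> S" "u \<in> M" "x = s + u"
      using orth_decomp[OF S x] unfolding M_def by blast
    have sc: "s \<in> carrier_vec n" and uc: "u \<in> carrier_vec n"
      by (rule subspD(1)[OF S su(1)], rule subspD(1)[OF M su(2)])
    have Vu: "adj V *\<^sub>v u = 0\<^sub>v k"
    proof (rule vec_eq_by_ip)
      fix c :: "complex vec" assume c: "c \<in> carrier_vec k"
      show "(adj V *\<^sub>v u) \<bullet>c c = 0\<^sub>v k \<bullet>c c"
        using MS(2)[OF VS[rule_format, OF c] su(2)] DV uc c by (simp add: ip_adj')
    qed (use DV in auto)
    have Ws: "adj W *\<^sub>v s = 0\<^sub>v m"
    proof (rule vec_eq_by_ip)
      fix c :: "complex vec" assume c: "c \<in> carrier_vec m"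
      show "(adj W *\<^sub>v s) \<bullet>c c = 0\<^sub>v m \<bullet>c c"
        using MS(1)[OF su(1) WM[rule_format, OF c]] DW sc c by (simp add: ip_adj')
    qed (use DW in auto)
    have "adj V *\<^sub>v x = adj V *\<^sub>v s" using su(3) Vu DV sc uc by (simp add: mv_vec_add)
    moreover have "adj W *\<^sub>v x = adj W *\<^sub>v u" using su(3) Ws DW sc uc by (simp add: mv_vec_add)
    ultimately show ?thesis using SV MW su by simp
  qed
  have VW: "(V *\<^sub>v c) \<bullet>c (W *\<^sub>v d) = 0" if "c \<in> carrier_vec k" "d \<in> carrier_vec m" for c d
    using MS(1) VS WM that by blast
  have X: "adj V * A * V \<in> carrier_mat k k" using DV dA by auto
  have comm: "adj W * A = Y * adj W"
  proof (rule mat_eq_by_vec[of _ m n])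
    fix x :: "complex vec" assume x: "x \<in> carrier_vec n"
    have dx: "dim_vec x = n" using x by auto
    have "adj W *\<^sub>v (A *\<^sub>v x) = Y *\<^sub>v (adj W *\<^sub>v x)"
    proof (rule vec_eq_by_ip)
      fix c :: "complex vec" assume c: "c \<in> carrier_vec m"
      then have dc: "dim_vec c = m" by auto
      have "adj A *\<^sub>v (W *\<^sub>v c) \<in> M" using adjM WM c by blast
      then have e: "W *\<^sub>v (adj W *\<^sub>v (adj A *\<^sub>v (W *\<^sub>v c))) = adj A *\<^sub>v (W *\<^sub>v c)" using MW by blast
      have aY: "adj Y *\<^sub>v c = adj W *\<^sub>v (adj A *\<^sub>v (W *\<^sub>v c))"
        unfolding Y_def using DW dA dc by (simp add: adj_mult mv_mult)
      have "(adj W *\<^sub>v (A *\<^sub>v x)) \<bullet>c c = (A *\<^sub>v x) \<bullet>c (W *\<^sub>v c)"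
        by (rule ip_adj') (use DW dA dc in auto)
      also have "\<dots> = x \<bullet>c (adj A *\<^sub>v (W *\<^sub>v c))"
        by (rule ip_adj) (use DW dA dx in auto)
      also have "\<dots> = x \<bullet>c (W *\<^sub>v (adj Y *\<^sub>v c))"
        unfolding aY e ..
      also have "\<dots> = (adj W *\<^sub>v x) \<bullet>c (adj Y *\<^sub>v c)"
        by (rule ip_adj'[symmetric]) (use DW dx dY in auto)
      also have "\<dots> = (Y *\<^sub>v (adj W *\<^sub>v x)) \<bullet>c c"
        by (rule ip_adj[symmetric]) (use DW dc dY in auto)
      finally show "(adj W *\<^sub>v (A *\<^sub>v x)) \<bullet>c c = (Y *\<^sub>v (adj W *\<^sub>v x)) \<bullet>c c" .
    qed (use DW dY in auto)
    then show "(adj W * A) *\<^sub>v x = (Y * adj W) *\<^sub>v x" using DW dA dY dx by (simp add: mv_mult)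
  qed (use DW A Y dY dA in auto)
  note blk = isom_pair_block[OF A V W VW span X AV Y AW]
  show thesis
    by (rule that[OF blk(1) W Y AW WM[unfolded M_def] Y_def blk(2) comm])
qed

section \<open>Splitting off Jordan blocks and unitary parts\<close>

lemma diag_block_Cons:
  "diag_block_mat (B # Bs) = four_block_mat B (0\<^sub>m (dim_row B) (dim_col (diag_block_mat Bs)))
     (0\<^sub>m (dim_row (diag_block_mat Bs)) (dim_col B)) (diag_block_mat Bs)"
  by (simp add: Let_def)

context power_pi
begin

text \<open>Column j is A^(m-j) h: a block with superdiagonal ones lowers the index while A raises
  the exponent, hence the reversed order. The adjoint relation is conditional because
  \<open>adj A\<close> is known to shift back inside the chain only; its value at h must be assumed
  zero.\<close>

lemma chain_isom:
  assumes h: "h \<in> orth_complement n (mat_kernel (A ^\<^sub>m m))" "h \<in> mat_kernel (A ^\<^sub>m Suc m)"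
    and nh: "nsq h = 1"
  obtains V where "isom_mat n (Suc m) V" "A * V = V * jordan_block (Suc m) 0"
    "adj A *\<^sub>v h = 0\<^sub>v n \<longrightarrow> adj A * V = V * adj (jordan_block (Suc m) 0)"
proof -
  let ?J = "jordan_block (Suc m) 0 :: complex mat"
  have hc: "h \<in> carrier_vec n" by (rule orth_complementD[OF h(1)])
  define e where "e k = A ^\<^sub>m k *\<^sub>v h" for k
  have e [simp]: "e k \<in> carrier_vec n" "dim_vec (e k) = n" for k by (simp_all add: e_def)
  have eS: "A *\<^sub>v e k = e (Suc k)" for k unfolding e_def pow_mat_mult_vec_Suc[OF A hc] ..
  have eN: "e (Suc m) = 0\<^sub>v n" using h(2) unfolding pow_kernel_iff[OF A] e_def by simp
  have e0: "e 0 = h" using hc by (simp add: e_def)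
  have ne: "nsq (e k) = 1" if "k \<le> m" for k using nsq_pow[OF h(1) that] nh by (simp add: e_def)
  \<comment> \<open>The vector e j lies in ker A^(m+1-j), which for i < j is contained in ker
    A^(m-i), and e i is orthogonal to the latter.\<close>
  have ort: "e i \<bullet>c e j = 0" if "i < j" "j \<le> m" for i j
  proof -
    have "h \<in> mat_kernel (A ^\<^sub>m ((m - i) + j))"
      by (rule subsetD[OF pow_kernel_mono[OF A] h(2)]) (use that in simp)
    then have "e j \<in> mat_kernel (A ^\<^sub>m (m - i))" unfolding e_def by (rule pow_kernel_shift[OF A])
    moreover have "e i \<in> orth_complement n (mat_kernel (A ^\<^sub>m (m - i)))"
      unfolding e_def by (rule pow_orth[OF h(1)]) (use that in simp)
    ultimately show ?thesis using orth_complementD(2) by blast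
  qed
  have ort': "e i \<bullet>c e j = (if i = j then 1 else 0)" if "i \<le> m" "j \<le> m" for i j
  proof (cases i j rule: linorder_cases)
    case greater
    then show ?thesis using ort[of j i] ip_cnj[of "e j" "e i"] that by simp
  qed (use ort ne that in \<open>auto simp: ip_self\<close>)
  define V where "V = mat n (Suc m) (\<lambda>(i, j). e (m - j) $ i)"
  have V: "V \<in> carrier_mat n (Suc m)" "dim_row V = n" "dim_col V = Suc m" by (auto simp: V_def)
  have colV: "col V j = e (m - j)" if "j < Suc m" for j
    by (rule eq_vecI) (use that in \<open>auto simp: V_def\<close>)
  have "isom_mat n (Suc m) V"
    by (rule isom_matI[OF V(1)]) (auto simp: colV ort')
  moreover have "A * V = V * ?J"
  proof (rule eq_matI)
    fix i j assume "i < dim_row (V * ?J)" "j < dim_col (V * ?J)"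
    then have ij: "i < n" "j < Suc m" using V by auto
    have "(A * V) $$ (i, j) = (A *\<^sub>v col V j) $ i" using ij V by simp
    then have l: "(A * V) $$ (i, j) = e (Suc (m - j)) $ i" unfolding colV[OF ij(2)] eS .
    have "(V * ?J) $$ (i, j) = (\<Sum>l = 0..<Suc m. V $$ (i, l) * ?J $$ (l, j))"
      using ij V by (simp add: scalar_prod_def)
    also have "\<dots> = (\<Sum>l = 0..<Suc m. if Suc l = j then V $$ (i, l) else 0)"
      using ij by (intro sum.cong) auto
    also have "\<dots> = e (Suc (m - j)) $ i"
    proof (cases j)
      case 0 then show ?thesis using eN ij by simp
    next
      case (Suc l)
      then have "(\<Sum>l' = 0..<Suc m. if Suc l' = j then V $$ (i, l') else 0) = V $$ (i, l)"
        using ij by (simp del: sum.op_ivl_Suc)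
      moreover have "m - l = Suc (m - j)" using Suc ij by simp
      ultimately show ?thesis using ij Suc by (simp add: V_def)
    qed
    finally show "(A * V) $$ (i, j) = (V * ?J) $$ (i, j)" using l by simp
  qed (use V in auto)
  moreover have "adj A * V = V * adj ?J" if h0: "adj A *\<^sub>v h = 0\<^sub>v n"
  proof (rule eq_matI)
    fix i j assume "i < dim_row (V * adj ?J)" "j < dim_col (V * adj ?J)"
    then have ij: "i < n" "j < Suc m" using V by auto
    have l: "(adj A * V) $$ (i, j) = (adj A *\<^sub>v e (m - j)) $ i"
      using ij V colV[OF ij(2)] by simp
    have "(V * adj ?J) $$ (i, j) = (\<Sum>l = 0..<Suc m. V $$ (i, l) * adj ?J $$ (l, j))"
      using ij V by (simp add: scalar_prod_def)
    also have "\<dots> = (\<Sum>l = 0..<Suc m. if l = Suc j then V $$ (i, l) else 0)"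
      using ij by (intro sum.cong) auto
    also have "\<dots> = (if Suc j < Suc m then V $$ (i, Suc j) else 0)"
      by (simp del: sum.op_ivl_Suc)
    also have "\<dots> = (adj A *\<^sub>v e (m - j)) $ i"
    proof (cases "Suc j < Suc m")
      case True
      then have *: "m - j = Suc (m - Suc j)" "m - Suc j < m" by auto
      have "adj A *\<^sub>v e (m - j) = e (m - Suc j)"
        unfolding *(1) e_def by (rule adj_pow_Suc[OF h(1) *(2)])
      then show ?thesis using True ij by (simp add: V_def)
    next
      case False
      then have "m - j = 0" using ij by simp
      then show ?thesis using False h0 ij by (simp add: e0 del: index_mult_mat_vec)
    qed
    finally show "(adj A * V) $$ (i, j) = (V * adj ?J) $$ (i, j)" using l by simp
  qed (use V in auto)
  ultimately show thesis using that by blast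
qed

end

text \<open>Maximality of the chain matters because then A^(m+1) = 0: the range of A lies in ker
  A^m, to which h is orthogonal, so adj A h = 0. This makes the span of the chain invariant under A
  and its adjoint, hence reducing, and the complementary block inherits the hypotheses.\<close>

theorem nilpotent_pi_jordan:
  assumes "A \<in> carrier_mat n n" "\<And>j. partial_isometry (A ^\<^sub>m j)" "mat_kernel (A ^\<^sub>m N) = carrier_vec n"
  shows "\<exists>ks. (\<forall>k\<in>set ks. k \<ge> 1) \<and>
    unitarily_similar A (diag_block_mat (map (\<lambda>k. jordan_block k 0) ks))"
  using assms
proof (induction n arbitrary: A rule: less_induct)
  case (less n)
  note A = less.prems(1) and PI = less.prems(2)
  show ?case
  proof (cases "n = 0")
    case True
    have "unitarily_similar A (diag_block_mat (map (\<lambda>k. jordan_block k 0) []))"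
      by (rule unitarily_similarI[OF A, of _ "1\<^sub>m 0"]) (use A True in \<open>auto intro!: eq_matI\<close>)
    then show ?thesis by (intro exI[of _ "[]"]) simp
  next
    case False
    have Ak: "A ^\<^sub>m k \<in> carrier_mat n n" for k using A by simp
    have dA: "dim_row A = n" "dim_col A = n" using A by auto
    have full: "mat_kernel (A ^\<^sub>m ascent A) = carrier_vec n"
    proof -
      have "carrier_vec n \<subseteq> mat_kernel (A ^\<^sub>m (max N (ascent A)))"
        using pow_kernel_mono[OF A, of N "max N (ascent A)"] less.prems(3) by simp
      then have "carrier_vec n \<subseteq> mat_kernel (A ^\<^sub>m ascent A)"
        using ascent_kernel_eq[OF A, of "max N (ascent A)"] by simp
      then show ?thesis using mat_kernel_carrier[OF Ak[of "ascent A"]] by blast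
    qed
    have "ascent A \<noteq> 0"
    proof
      assume "ascent A = 0"
      then have "unit_vec n 0 \<in> mat_kernel (A ^\<^sub>m 0)" using full by simp
      then have "unit_vec n 0 = (0\<^sub>v n :: complex vec)"
        unfolding pow_kernel_iff[OF A] using dA by simp
      from arg_cong[OF this, of "\<lambda>v. v $ 0"] show False using False by simp
    qed
    then obtain m where m: "ascent A = Suc m" using not0_implies_Suc by blast
    interpret power_pi n A m using A PI by unfold_locales
    obtain h where h: "h \<in> mat_kernel (A ^\<^sub>m Suc m)" "nsq h = 1"
      "h \<in> orth_complement n (mat_kernel (A ^\<^sub>m m))"
      by (rule ascent_unit_vec[OF A m])
    have hc: "h \<in> carrier_vec n" by (rule orth_complementD[OF h(3)])
    let ?J = "jordan_block (Suc m) 0 :: complex mat"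
    obtain V where V: "isom_mat n (Suc m) V" and AV: "A * V = V * ?J"
      and adjV: "adj A *\<^sub>v h = 0\<^sub>v n \<longrightarrow> adj A * V = V * adj ?J"
      by (rule chain_isom[OF h(3,1,2)])
    note D = isom_matD(1-3)[OF V]
    have "adj A *\<^sub>v h = 0\<^sub>v n"
    proof (rule vec_eq_by_ip)
      fix y :: "complex vec" assume y: "y \<in> carrier_vec n"
      have "y \<in> mat_kernel (A ^\<^sub>m (m + 1))" using full m y by simp
      from pow_kernel_shift[OF A this] have "A *\<^sub>v y \<in> mat_kernel (A ^\<^sub>m m)"
        by (simp add: left_mult_one_mat[OF A])
      from orth_complementD(2)[OF h(3) this] show "(adj A *\<^sub>v h) \<bullet>c y = 0\<^sub>v n \<bullet>c y"
        using hc y dA by (simp add: ip_adj')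
    qed (use dA in auto)
    with adjV have aAV: "adj A * V = V * adj ?J" by simp
    define S where "S = {V *\<^sub>v c | c. c \<in> carrier_vec (Suc m)}"
    have S: "subsp n S"
      unfolding subsp_def
    proof (intro conjI ballI allI)
      show "S \<subseteq> carrier_vec n" using D by (auto simp: S_def)
      have "0\<^sub>v n = V *\<^sub>v 0\<^sub>v (Suc m)" using D by simp
      then show "0\<^sub>v n \<in> S" unfolding S_def using zero_carrier_vec by blast
      fix x y c assume "x \<in> S" "y \<in> S"
      then obtain a b where ab: "a \<in> carrier_vec (Suc m)" "b \<in> carrier_vec (Suc m)" "x = V *\<^sub>v a" "y = V *\<^sub>v b"
        unfolding S_def by blast
      have "x + c \<cdot>\<^sub>v y = V *\<^sub>v (a + c \<cdot>\<^sub>v b)" using ab D by (simp add: mv_vec_add mv_vec_smult)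
      moreover have "a + c \<cdot>\<^sub>v b \<in> carrier_vec (Suc m)" using ab(1,2) by simp
      ultimately show "x + c \<cdot>\<^sub>v y \<in> S" unfolding S_def by blast
    qed
    have VS: "\<forall>c\<in>carrier_vec (Suc m). V *\<^sub>v c \<in> S" unfolding S_def by blast
    have SV: "\<forall>x\<in>S. V *\<^sub>v (adj V *\<^sub>v x) = x" unfolding S_def using isom_matD(4)[OF V] by auto
    have inv: "B *\<^sub>v x \<in> S"
      if B: "B \<in> carrier_mat n n" "C \<in> carrier_mat (Suc m) (Suc m)" "B * V = V * C" and xS: "x \<in> S" for B C x
    proof -
      obtain c where c: "c \<in> carrier_vec (Suc m)" "x = V *\<^sub>v c" using xS unfolding S_def by blast
      have "B *\<^sub>v x = V *\<^sub>v (C *\<^sub>v c)"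
        using arg_cong[OF B(3), of "\<lambda>M. M *\<^sub>v c"] c D B(1,2) by (simp add: mv_mult)
      then show ?thesis using VS B(2) by simp
    qed
    have AS: "A *\<^sub>v x \<in> S" if "x \<in> S" for x
      by (rule inv[OF A _ AV that]) simp
    have aS: "adj A *\<^sub>v x \<in> S" if "x \<in> S" for x
      by (rule inv[OF adj_carrier[OF A] _ aAV that]) simp
    have AM: "A *\<^sub>v x \<in> orth_complement n S" if x: "x \<in> orth_complement n S" for x
    proof (rule orth_complementI)
      fix s assume s: "s \<in> S"
      have "x \<in> carrier_vec n" "s \<in> carrier_vec n" using orth_complementD(1)[OF x] subspD(1)[OF S s] .
      then show "(A *\<^sub>v x) \<bullet>c s = 0"
        using orth_complementD(2)[OF x aS[OF s]] dA by (simp add: ip_adj)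
    qed (use dA in simp)
    obtain l W Y where l: "Suc m + l = n" and W: "isom_mat n l W" and Y: "Y \<in> carrier_mat l l"
      and AW: "A * W = W * Y" "adj W * A = Y * adj W"
      and sim: "unitarily_similar A (four_block_mat (adj V * A * V) (0\<^sub>m (Suc m) l) (0\<^sub>m l (Suc m)) Y)"
      by (rule reducing_block[OF A S AS AM V VS SV])
    note DW = isom_matD(1-3)[OF W]
    have dY: "dim_row Y = l" "dim_col Y = l" using Y by auto
    have "adj V * A * V = adj V * (A * V)"
      using D A by (intro assoc_mult_mat[of _ "Suc m" n _ n _ "Suc m"]) auto
    also have "\<dots> = adj V * V * ?J"
      unfolding AV using D by (intro assoc_mult_mat[symmetric, of _ "Suc m" n _ "Suc m" _ "Suc m"]) auto
    also have "\<dots> = ?J" using V by (simp add: isom_mat_def)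
    finally have X: "adj V * A * V = ?J" .
    have Wc: "A *\<^sub>v (W *\<^sub>v c) = W *\<^sub>v (Y *\<^sub>v c)" if "c \<in> carrier_vec l" for c
      using arg_cong[OF AW(1), of "\<lambda>M. M *\<^sub>v c"] that DW dA dY by (simp add: mv_mult)
    have aWx: "adj W *\<^sub>v (A *\<^sub>v x) = Y *\<^sub>v (adj W *\<^sub>v x)" if "x \<in> carrier_vec n" for x
      using arg_cong[OF AW(2), of "\<lambda>M. M *\<^sub>v x"] that DW dA dY by (simp add: mv_mult)
    have Wp: "A ^\<^sub>m j *\<^sub>v (W *\<^sub>v c) = W *\<^sub>v (Y ^\<^sub>m j *\<^sub>v c)" if c: "c \<in> carrier_vec l" for c j
    proof (induction j)
      case (Suc j)
      have Wcc: "W *\<^sub>v c \<in> carrier_vec n" using DW by simp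
      have "Y ^\<^sub>m j *\<^sub>v c \<in> carrier_vec l" using dY by simp
      then show ?case
        unfolding pow_mat_mult_vec_Suc[OF A Wcc] pow_mat_mult_vec_Suc[OF Y c] Suc by (rule Wc)
    qed (use DW dA dY c in simp)
    have aWp: "adj W *\<^sub>v (A ^\<^sub>m j *\<^sub>v x) = Y ^\<^sub>m j *\<^sub>v (adj W *\<^sub>v x)" if x: "x \<in> carrier_vec n" for x j
    proof (induction j)
      case (Suc j)
      have Wxc: "adj W *\<^sub>v x \<in> carrier_vec l" using DW by simp
      have "A ^\<^sub>m j *\<^sub>v x \<in> carrier_vec n" using dA by simp
      then show ?case
        unfolding pow_mat_mult_vec_Suc[OF A x] pow_mat_mult_vec_Suc[OF Y Wxc] Suc[symmetric] by (rule aWx)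
    qed (use DW dA dY x in simp)
    \<comment> \<open>W embeds isometrically and intertwines powers. W x stays orthogonal to ker A^j
      because adj W maps that kernel into ker Y^j.\<close>
    have YPI: "partial_isometry (Y ^\<^sub>m j)" for j
    proof (rule partial_isometryI)
      show "Y ^\<^sub>m j \<in> carrier_mat l l" using Y by simp
      fix x assume x: "x \<in> orth_complement l (mat_kernel (Y ^\<^sub>m j))"
      have xc: "x \<in> carrier_vec l" by (rule orth_complementD[OF x])
      have "W *\<^sub>v x \<in> orth_complement n (mat_kernel (A ^\<^sub>m j))"
      proof (rule orth_complementI)
        fix k assume "k \<in> mat_kernel (A ^\<^sub>m j)"
        then have k: "k \<in> carrier_vec n" "A ^\<^sub>m j *\<^sub>v k = 0\<^sub>v n" by (auto simp: pow_kernel_iff[OF A])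
        have "adj W *\<^sub>v k \<in> mat_kernel (Y ^\<^sub>m j)"
          unfolding pow_kernel_iff[OF Y] aWp[OF k(1), symmetric] k(2) using DW by simp
        from orth_complementD(2)[OF x this] show "(W *\<^sub>v x) \<bullet>c k = 0"
          using DW xc k(1) by (simp add: ip_adj)
      qed (use DW in simp)
      then have "nsq (A ^\<^sub>m j *\<^sub>v (W *\<^sub>v x)) = nsq (W *\<^sub>v x)"
        by (rule partial_isometryD[OF PI Ak])
      then show "nsq (Y ^\<^sub>m j *\<^sub>v x) = nsq x"
        unfolding Wp[OF xc] using isom_mat_nsq[OF W xc] isom_mat_nsq[OF W, of "Y ^\<^sub>m j *\<^sub>v x"] dY by simp
    qed
    have YN: "mat_kernel (Y ^\<^sub>m N) = carrier_vec l"
    proof (intro equalityI subsetI)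
      fix x :: "complex vec" assume x: "x \<in> carrier_vec l"
      have "W *\<^sub>v x \<in> mat_kernel (A ^\<^sub>m N)" unfolding less.prems(3) using DW by simp
      then have "W *\<^sub>v (Y ^\<^sub>m N *\<^sub>v x) = 0\<^sub>v n" unfolding pow_kernel_iff[OF A] Wp[OF x] by simp
      then have "nsq (Y ^\<^sub>m N *\<^sub>v x) = 0"
        using isom_mat_nsq[OF W, of "Y ^\<^sub>m N *\<^sub>v x"] dY nsq_eq_0_iff[of "0\<^sub>v n" n] by simp
      then show "x \<in> mat_kernel (Y ^\<^sub>m N)"
        using x nsq_eq_0_iff[of "Y ^\<^sub>m N *\<^sub>v x" l] dY unfolding pow_kernel_iff[OF Y] by simp
    qed (use pow_kernel_iff[OF Y] in auto)
    have "l < n" using l by simp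
    from less.IH[OF this Y YPI YN] obtain ks where ks: "\<forall>k\<in>set ks. k \<ge> 1"
      "unitarily_similar Y (diag_block_mat (map (\<lambda>k. jordan_block k 0) ks))" by blast
    let ?D = "diag_block_mat (map (\<lambda>k. jordan_block k 0) ks) :: complex mat"
    have Dc: "?D \<in> carrier_mat l l" using unitarily_similarD[OF ks(2) Y] by blast
    have "unitarily_similar A (four_block_mat ?J (0\<^sub>m (Suc m) l) (0\<^sub>m l (Suc m)) ?D)"
      using unitarily_similar_trans[OF sim[unfolded X] unitarily_similar_four_block[OF jordan_block_carrier Y ks(2)]] .
    moreover have "four_block_mat ?J (0\<^sub>m (Suc m) l) (0\<^sub>m l (Suc m)) ?D
      = diag_block_mat (map (\<lambda>k. jordan_block k 0) (Suc m # ks))"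
      unfolding list.map diag_block_Cons using carrier_matD[OF Dc] by simp
    ultimately show ?thesis using ks(1) by (intro exI[of _ "Suc m # ks"]) auto
  qed
qed

text \<open>As ker A^(a+1) = N, a vector of the complement of N is orthogonal to ker A^(a+1), and
  \<open>pow_orth\<close> with 1 + a puts its image under A into the complement of ker A^a, again
  that of N. This is where the exponent a + 1 enters.\<close>

theorem nilpotent_if_no_unitary_part:
  assumes A: "A \<in> carrier_mat n n" and no: "\<not> has_unitary_part A"
    and PI: "\<And>j. j \<le> Suc (ascent A) \<Longrightarrow> partial_isometry (A ^\<^sub>m j)"
  shows "mat_kernel (A ^\<^sub>m ascent A) = carrier_vec n"
proof (rule ccontr)
  let ?N = "mat_kernel (A ^\<^sub>m ascent A)"
  assume ne: "?N \<noteq> carrier_vec n"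
  interpret power_pi n A "Suc (ascent A)" using A PI by unfold_locales
  have Ak: "A ^\<^sub>m k \<in> carrier_mat n n" for k by simp
  have A1: "A ^\<^sub>m Suc 0 = A" by (simp add: left_mult_one_mat[OF A])
  have NS: "mat_kernel (A ^\<^sub>m Suc (ascent A)) = ?N" by (rule ascent_kernel_eq[OF A]) simp
  note N = subsp_kernel[OF Ak[of "ascent A"]]
  have AN: "A *\<^sub>v x \<in> ?N" if "x \<in> ?N" for x
  proof -
    have "x \<in> mat_kernel (A ^\<^sub>m (ascent A + Suc 0))" using that NS by simp
    from pow_kernel_shift[OF A this] show ?thesis unfolding A1 .
  qed
  have M: "A *\<^sub>v x \<in> orth_complement n ?N" "nsq (A *\<^sub>v x) = nsq x" "adj A *\<^sub>v (A *\<^sub>v x) = x"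
    if "x \<in> orth_complement n ?N" for x
  proof -
    have x: "x \<in> orth_complement n (mat_kernel (A ^\<^sub>m Suc (ascent A)))" unfolding NS by (rule that)
    have xc: "x \<in> carrier_vec n" by (rule orth_complementD[OF x])
    show "A *\<^sub>v x \<in> orth_complement n ?N" using pow_orth[OF x, of "Suc 0" "ascent A"] unfolding A1 by simp
    show "nsq (A *\<^sub>v x) = nsq x" using nsq_pow[OF x, of "Suc 0"] unfolding A1 by simp
    show "adj A *\<^sub>v (A *\<^sub>v x) = x" using adj_pow_Suc[OF x, of 0] xc unfolding A1 by simp
  qed
  obtain k V where V: "isom_mat n k V" and VN: "\<forall>c\<in>carrier_vec k. V *\<^sub>v c \<in> ?N"
    and NV: "\<forall>x\<in>?N. V *\<^sub>v (adj V *\<^sub>v x) = x"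
    by (rule subsp_basis[OF N])
  obtain l W Y where l: "k + l = n" and W: "isom_mat n l W" and Y: "Y \<in> carrier_mat l l"
    and AW: "A * W = W * Y" and WM: "\<forall>c\<in>carrier_vec l. W *\<^sub>v c \<in> orth_complement n ?N"
    and Ydef: "Y = adj W * A * W"
    and sim: "unitarily_similar A (four_block_mat (adj V * A * V) (0\<^sub>m k l) (0\<^sub>m l k) Y)"
    by (rule reducing_block[OF A N AN M(1) V VN NV])
  note DV = isom_matD(1-3)[OF V] and DW = isom_matD(1-3)[OF W]
  have dY: "dim_row Y = l" "dim_col Y = l" using Y by auto
  have "l \<noteq> 0"
  proof
    assume "l = 0"
    then have k: "k = n" using l by simp
    have "V * adj V = 1\<^sub>m n"
      by (rule mat_mult_left_right_inverse[of _ n]) (use V DV k in \<open>auto simp: isom_mat_def\<close>)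
    have "carrier_vec n \<subseteq> ?N"
    proof
      fix x :: "complex vec" assume x: "x \<in> carrier_vec n"
      have "V *\<^sub>v (adj V *\<^sub>v x) = (V * adj V) *\<^sub>v x" using DV k x by (simp add: mv_mult)
      also have "\<dots> = x" unfolding \<open>V * adj V = 1\<^sub>m n\<close> using x by simp
      finally show "x \<in> ?N" using VN DV by (metis dim_adj(1) mult_mat_vec_in_carrier)
    qed
    then show False using ne mat_kernel_carrier[OF Ak[of "ascent A"]] by blast
  qed
  \<comment> \<open>The product adj A A fixes every vector in the complement of N, and Y is the
    restriction of A to it in the basis W.\<close>
  have "adj Y * Y = 1\<^sub>m l"
  proof (rule mat_eq_by_vec[of _ l l])
    fix c :: "complex vec" assume c: "c \<in> carrier_vec l"
    have "W *\<^sub>v (Y *\<^sub>v c) = A *\<^sub>v (W *\<^sub>v c)"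
      using arg_cong[OF AW, of "\<lambda>M. M *\<^sub>v c"] c DW dY by (simp add: mv_mult)
    then have 1: "adj A *\<^sub>v (W *\<^sub>v (Y *\<^sub>v c)) = W *\<^sub>v c" using M(3) WM c by simp
    have adjY: "adj Y = adj W * adj A * W"
    proof -
      have "adj Y = adj W * adj (adj W * A)" unfolding Ydef using DW by (subst adj_mult) auto
      also have "adj (adj W * A) = adj A * W" using DW by (subst adj_mult) auto
      also have "adj W * (adj A * W) = adj W * adj A * W"
        using DW by (intro assoc_mult_mat[symmetric, of _ l n _ n _ l]) auto
      finally show ?thesis .
    qed
    have "adj Y *\<^sub>v (Y *\<^sub>v c) = adj W *\<^sub>v (adj A *\<^sub>v (W *\<^sub>v (Y *\<^sub>v c)))"
      unfolding adjY using DW dY c by (simp add: mv_mult)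
    also have "\<dots> = c" unfolding 1 by (rule isom_matD(4)[OF W c])
    finally show "(adj Y * Y) *\<^sub>v c = 1\<^sub>m l *\<^sub>v c" using dY c by (simp add: mv_mult)
  qed (use Y in auto)
  moreover from this have "Y * adj Y = 1\<^sub>m l"
    by (rule mat_mult_left_right_inverse[of _ l, rotated 2]) (use Y in auto)
  ultimately have uY: "unitary_mat Y" by (simp add: unitary_mat_iff[OF Y])
  let ?X = "adj V * A * V"
  have "four_block_mat ?X (0\<^sub>m k l) (0\<^sub>m l k) Y = diag_block_mat [?X, Y]"
    unfolding diag_block_Cons[of ?X] diag_block_mat_singleton using DV dY by simp
  with sim have "unitarily_similar A (diag_block_mat [?X, Y])" by simp
  moreover have "square_mat ?X" "square_mat Y" using DV dY by auto
  ultimately have "has_unitary_part A"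
    unfolding has_unitary_part_def using uY \<open>l \<noteq> 0\<close> dY
    by (intro exI[of _ "[?X, Y]"]) auto
  with no show False by simp
qed

section \<open>Powers of direct sums of Jordan blocks\<close>

lemma unitarily_similar_nsq:
  assumes "U \<in> carrier_mat n n" "adj U * U = 1\<^sub>m n" "x \<in> carrier_vec n"
  shows "nsq (U *\<^sub>v x) = nsq x"
  by (rule isom_mat_nsq[of n n]) (use assms in \<open>auto simp: isom_mat_def\<close>)

lemma partial_isometry_unitarily_similar:
  assumes A: "A \<in> carrier_mat n n" and sim: "unitarily_similar A B"
    and PI: "partial_isometry (B ^\<^sub>m j)"
  shows "partial_isometry (A ^\<^sub>m j)"
proof -
  obtain U where U: "U \<in> carrier_mat n n" "B \<in> carrier_mat n n" "adj U * U = 1\<^sub>m n" "U * adj U = 1\<^sub>m n"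
    "similar_mat_wit A B U (adj U)"
    by (rule unitarily_similarD[OF sim A])
  have dU: "dim_row U = n" "dim_col U = n" using U(1) by auto
  have Bj: "B ^\<^sub>m j \<in> carrier_mat n n" "dim_row (B ^\<^sub>m j) = n" "dim_col (B ^\<^sub>m j) = n"
    using U(2) by (auto simp: pow_mat_dim)
  have Aj: "A ^\<^sub>m j *\<^sub>v x = U *\<^sub>v (B ^\<^sub>m j *\<^sub>v (adj U *\<^sub>v x))" if "x \<in> carrier_vec n" for x
    unfolding similar_mat_wit_pow_id[OF U(5)] using dU Bj that by (simp add: mv_mult)
  have aU: "adj U *\<^sub>v (U *\<^sub>v x) = x" if "x \<in> carrier_vec n" for x
    by (rule isom_matD(4)[of n n]) (use U that in \<open>auto simp: isom_mat_def\<close>)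
  show ?thesis
  proof (rule partial_isometryI)
    show "A ^\<^sub>m j \<in> carrier_mat n n" using A by simp
    fix x assume x: "x \<in> orth_complement n (mat_kernel (A ^\<^sub>m j))"
    have xc: "x \<in> carrier_vec n" by (rule orth_complementD[OF x])
    have "adj U *\<^sub>v x \<in> orth_complement n (mat_kernel (B ^\<^sub>m j))"
    proof (rule orth_complementI)
      fix k assume k: "k \<in> mat_kernel (B ^\<^sub>m j)"
      then have k': "k \<in> carrier_vec n" "B ^\<^sub>m j *\<^sub>v k = 0\<^sub>v n" by (auto simp: pow_kernel_iff[OF U(2)])
      have Uk: "U *\<^sub>v k \<in> carrier_vec n" using dU by simp
      have "A ^\<^sub>m j *\<^sub>v (U *\<^sub>v k) = 0\<^sub>v n" unfolding Aj[OF Uk] aU[OF k'(1)] k'(2) using dU by simp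
      then have "U *\<^sub>v k \<in> mat_kernel (A ^\<^sub>m j)" using Uk by (simp add: pow_kernel_iff[OF A])
      from orth_complementD(2)[OF x this] show "(adj U *\<^sub>v x) \<bullet>c k = 0"
        using dU xc k'(1) by (simp add: ip_adj')
    qed (use dU in simp)
    then have "nsq (B ^\<^sub>m j *\<^sub>v (adj U *\<^sub>v x)) = nsq (adj U *\<^sub>v x)"
      by (rule partial_isometryD[OF PI Bj(1)])
    then show "nsq (A ^\<^sub>m j *\<^sub>v x) = nsq x"
      unfolding Aj[OF xc]
      using unitarily_similar_nsq[OF U(1,3), of "B ^\<^sub>m j *\<^sub>v (adj U *\<^sub>v x)"] Bj
        unitarily_similar_nsq[of "adj U" n x] U xc by simp
  qed
qed

lemma ip_append:
  assumes "a \<in> carrier_vec n" "c \<in> carrier_vec n" "b \<in> carrier_vec m" "d \<in> carrier_vec m"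
  shows "(a @\<^sub>v b) \<bullet>c (c @\<^sub>v d) = a \<bullet>c c + b \<bullet>c (d :: complex vec)"
proof -
  have "conjugate (c @\<^sub>v d) = conjugate c @\<^sub>v conjugate d"
    by (rule eq_vecI) auto
  then show ?thesis
    using assms by (simp add: scalar_prod_append[of _ n _ m])
qed

lemma nsq_append: "nsq (a @\<^sub>v b) = nsq a + nsq b"
proof -
  have "(a @\<^sub>v b) \<bullet>c (a @\<^sub>v b) = a \<bullet>c a + b \<bullet>c b"
    by (rule ip_append) (rule carrier_vec_dim_vec)+
  then show ?thesis unfolding ip_self of_real_add[symmetric] of_real_eq_iff .
qed

lemma diag_block_mv:
  fixes P Q :: "complex mat"
  assumes "P \<in> carrier_mat n n" "Q \<in> carrier_mat m m" "a \<in> carrier_vec n" "b \<in> carrier_vec m"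
  shows "four_block_mat P (0\<^sub>m n m) (0\<^sub>m m n) Q *\<^sub>v (a @\<^sub>v b) = (P *\<^sub>v a) @\<^sub>v (Q *\<^sub>v b)"
  using four_block_mat_mult_vec[OF assms(1) zero_carrier_mat zero_carrier_mat assms(2-4)] assms
  by simp

lemma vec_split:
  assumes "x \<in> carrier_vec (n + m)"
  obtains a b where "a \<in> carrier_vec n" "b \<in> carrier_vec m" "x = a @\<^sub>v b"
  using vec_first_last_append[OF assms] that[of "vec_first x n" "vec_last x m"] by simp

lemma append_zero_vec: "0\<^sub>v n @\<^sub>v 0\<^sub>v m = 0\<^sub>v (n + m)"
  by (rule eq_vecI) auto

lemma partial_isometry_four_block:
  assumes P: "P \<in> carrier_mat n n" "partial_isometry P" and Q: "Q \<in> carrier_mat m m" "partial_isometry Q"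
  shows "partial_isometry (four_block_mat P (0\<^sub>m n m) (0\<^sub>m m n) Q)"
proof (rule partial_isometryI)
  let ?F = "four_block_mat P (0\<^sub>m n m) (0\<^sub>m m n) Q"
  have dP: "dim_row P = n" "dim_col P = n" "dim_row Q = m" "dim_col Q = m" using P Q by auto
  show F: "?F \<in> carrier_mat (n + m) (n + m)" using P Q by auto
  fix x assume x: "x \<in> orth_complement (n + m) (mat_kernel ?F)"
  obtain a b where ab: "a \<in> carrier_vec n" "b \<in> carrier_vec m" "x = a @\<^sub>v b"
    by (rule vec_split[OF orth_complementD(1)[OF x]])
  have "a \<in> orth_complement n (mat_kernel P)"
  proof (rule orth_complementI[OF ab(1)])
    fix k assume k: "k \<in> mat_kernel P"
    note k' = mat_kernelD[OF P(1) k]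
    have "k @\<^sub>v 0\<^sub>v m \<in> mat_kernel ?F"
      by (rule mat_kernelI[OF F]) (use k' dP in \<open>auto simp: diag_block_mv[OF P(1) Q(1)] append_zero_vec\<close>)
    from orth_complementD(2)[OF x this] show "a \<bullet>c k = 0"
      using ip_append[OF ab(1) k'(1) ab(2) zero_carrier_vec] ab by simp
  qed
  moreover have "b \<in> orth_complement m (mat_kernel Q)"
  proof (rule orth_complementI[OF ab(2)])
    fix k assume k: "k \<in> mat_kernel Q"
    note k' = mat_kernelD[OF Q(1) k]
    have "0\<^sub>v n @\<^sub>v k \<in> mat_kernel ?F"
      by (rule mat_kernelI[OF F]) (use k' dP in \<open>auto simp: diag_block_mv[OF P(1) Q(1)] append_zero_vec\<close>)
    from orth_complementD(2)[OF x this] show "b \<bullet>c k = 0"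
      using ip_append[OF ab(1) zero_carrier_vec ab(2) k'(1)] ab by simp
  qed
  ultimately have "nsq (P *\<^sub>v a) = nsq a" "nsq (Q *\<^sub>v b) = nsq b"
    using partial_isometryD[OF P(2,1)] partial_isometryD[OF Q(2,1)] by auto
  then show "nsq (?F *\<^sub>v x) = nsq x"
    unfolding ab(3) diag_block_mv[OF P(1) Q(1) ab(1,2)] nsq_append by simp
qed

lemma diag_block_square:
  assumes "\<forall>B\<in>set Bs. square_mat B"
  shows "diag_block_mat Bs \<in> carrier_mat (dim_row (diag_block_mat Bs)) (dim_row (diag_block_mat Bs))"
  using diag_block_mat_square[of Bs] assms by (intro carrier_matI) auto

lemma partial_isometry_diag_block:
  assumes "\<forall>B\<in>set Bs. square_mat B \<and> partial_isometry B"
  shows "partial_isometry (diag_block_mat Bs)"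
  using assms
proof (induction Bs)
  case Nil
  show ?case unfolding partial_isometry_def vec_norm_eq_iff by (auto simp: nsq_def orth_complement_def)
next
  case (Cons B Bs)
  have B: "B \<in> carrier_mat (dim_row B) (dim_row B)" "partial_isometry B" using Cons by (auto intro: carrier_matI)
  have D: "diag_block_mat Bs \<in> carrier_mat (dim_row (diag_block_mat Bs)) (dim_row (diag_block_mat Bs))"
    by (rule diag_block_square) (use Cons in auto)
  show ?case
    unfolding diag_block_Cons
    using partial_isometry_four_block[OF B D Cons.IH] Cons.prems carrier_matD[OF B(1)] carrier_matD[OF D]
    by simp
qed

lemma jordan_pow_mv:
  assumes "i < k" "x \<in> carrier_vec k"
  shows "(jordan_block k (0 :: complex) ^\<^sub>m j *\<^sub>v x) $ i = (if i + j < k then x $ (i + j) else 0)"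
proof -
  have "(jordan_block k (0 :: complex) ^\<^sub>m j *\<^sub>v x) $ i
    = (\<Sum>l = 0..<k. (if i \<le> l \<and> l - i = j then 1 else 0) * x $ l)"
    using assms unfolding jordan_block_zero_pow by (simp add: scalar_prod_def)
  also have "\<dots> = (\<Sum>l = 0..<k. if l = i + j then x $ l else 0)"
    by (intro sum.cong) auto
  finally show ?thesis by simp
qed

text \<open>The power J^j drops the first j coordinates and shifts the others; orthogonality to the
  kernel says that the dropped coordinates of x are already zero.\<close>

lemma partial_isometry_jordan_pow: "partial_isometry (jordan_block k (0 :: complex) ^\<^sub>m j)"
proof (rule partial_isometryI)
  let ?J = "jordan_block k (0 :: complex) ^\<^sub>m j"
  show J: "?J \<in> carrier_mat k k" by simp
  fix x assume x: "x \<in> orth_complement k (mat_kernel ?J)"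
  have xc: "x \<in> carrier_vec k" by (rule orth_complementD[OF x])
  have zero: "x $ l = 0" if l: "l < j" "l < k" for l
  proof -
    have "unit_vec k l \<in> mat_kernel ?J"
    proof (rule mat_kernelI[OF J unit_vec_carrier], rule eq_vecI)
      fix i assume "i < dim_vec (0\<^sub>v k :: complex vec)"
      then show "(?J *\<^sub>v unit_vec k l) $ i = 0\<^sub>v k $ i"
        using l by (simp add: jordan_pow_mv unit_vec_def del: index_mult_mat_vec)
    qed simp
    moreover have "x \<bullet>c unit_vec k l = x $ l"
    proof -
      have "conjugate (unit_vec k l) = (unit_vec k l :: complex vec)"
        by (rule eq_vecI) (auto simp: unit_vec_def)
      then show ?thesis using xc l by simp
    qed
    ultimately show ?thesis using orth_complementD(2)[OF x] by metis
  qed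
  show "nsq (?J *\<^sub>v x) = nsq x"
  proof (cases "j \<le> k")
    case True
    have "nsq (?J *\<^sub>v x) = (\<Sum>i<k. if i + j < k then (cmod (x $ (i + j)))\<^sup>2 else 0)"
      unfolding nsq_def using xc by (intro sum.cong) (auto simp: jordan_pow_mv simp del: index_mult_mat_vec)
    also have "\<dots> = (\<Sum>i\<in>{i. i < k \<and> i + j < k}. (cmod (x $ (i + j)))\<^sup>2)"
      by (subst sum.inter_filter[symmetric]) (auto intro!: sum.cong)
    also have "\<dots> = (\<Sum>l\<in>{j..<k}. (cmod (x $ l))\<^sup>2)"
      by (rule sum.reindex_bij_witness[of _ "\<lambda>l. l - j" "\<lambda>i. i + j"]) auto
    also have "\<dots> = (\<Sum>l<k. (cmod (x $ l))\<^sup>2)"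
      by (rule sum.mono_neutral_left) (use zero in auto)
    also have "\<dots> = nsq x" unfolding nsq_def using xc by simp
    finally show ?thesis .
  next
    case False
    then have "x = 0\<^sub>v k" using zero xc by (intro eq_vecI) auto
    then show ?thesis by (simp add: nsq_def)
  qed
qed

text \<open>Serves to pass nilpotency from a direct sum to a single summand.\<close>

lemma diag_block_zero:
  assumes "\<forall>B\<in>set Bs. square_mat B" "diag_block_mat Bs = 0\<^sub>m r s" "B \<in> set Bs"
  shows "B = 0\<^sub>m (dim_row B) (dim_row B)"
  using assms
proof (induction Bs arbitrary: r s)
  case (Cons C Cs)
  let ?D = "diag_block_mat Cs"
  have D: "?D \<in> carrier_mat (dim_row ?D) (dim_row ?D)"
    by (rule diag_block_square) (use Cons.prems(1) in simp)
  then have D': "dim_col ?D = dim_row ?D" by (rule carrier_matD(2))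
  have C: "dim_col C = dim_row C" using Cons.prems(1) by simp
  have z: "diag_block_mat (C # Cs) $$ (i, j) = 0" if "i < dim_row C + dim_row ?D" "j < dim_row C + dim_row ?D" for i j
  proof -
    have "diag_block_mat (C # Cs) \<in> carrier_mat (dim_row C + dim_row ?D) (dim_row C + dim_row ?D)"
      unfolding diag_block_Cons using C D' by auto
    then have "r = dim_row C + dim_row ?D" "s = dim_row C + dim_row ?D"
      unfolding Cons.prems(2) by auto
    then show ?thesis unfolding Cons.prems(2) using that by simp
  qed
  have "C $$ (i, j) = 0" if "i < dim_row C" "j < dim_row C" for i j
    using z[of i j] that C D' unfolding diag_block_Cons by simp
  then have C0: "C = 0\<^sub>m (dim_row C) (dim_row C)" using C by (intro eq_matI) auto
  have "?D $$ (i, j) = 0" if "i < dim_row ?D" "j < dim_row ?D" for i j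
    using z[of "i + dim_row C" "j + dim_row C"] that C D' unfolding diag_block_Cons by simp
  then have D0: "?D = 0\<^sub>m (dim_row ?D) (dim_row ?D)" using D' by (intro eq_matI) auto
  have "B = C \<or> B \<in> set Cs" using Cons.prems(3) by simp
  then show ?case
  proof
    assume "B = C"
    show ?thesis unfolding \<open>B = C\<close> by (rule C0)
  next
    assume "B \<in> set Cs"
    show ?thesis by (rule Cons.IH[OF _ D0 \<open>B \<in> set Cs\<close>]) (use Cons.prems(1) in simp)
  qed
qed simp

text \<open>All powers of a nonempty unitary summand keep the norm of a unit vector, so none of them
  is zero.\<close>

lemma nilpotent_no_unitary_part:
  assumes A: "A \<in> carrier_mat n n" and nil: "A ^\<^sub>m N = 0\<^sub>m n n"
  shows "\<not> has_unitary_part A"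
proof
  assume "has_unitary_part A"
  then obtain Bs Y where sq: "\<forall>B\<in>set Bs. square_mat B" and Y: "Y \<in> set Bs" "unitary_mat Y" "dim_row Y \<ge> 1"
    and sim: "unitarily_similar A (diag_block_mat Bs)"
    unfolding has_unitary_part_def by blast
  let ?D = "diag_block_mat Bs"
  obtain U where U: "U \<in> carrier_mat n n" "similar_mat_wit A ?D U (adj U)"
    using unitarily_similarD[OF sim A] by blast
  have "?D ^\<^sub>m N = adj U * A ^\<^sub>m N * U"
    by (rule similar_mat_wit_pow_id[OF similar_mat_wit_sym[OF U(2)]])
  also have "\<dots> = 0\<^sub>m n n" unfolding nil using U(1) by auto
  finally have "diag_block_mat (map (\<lambda>B. B ^\<^sub>m N) Bs) = 0\<^sub>m n n"
    using diag_block_pow_mat[of Bs N] sq by simp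
  from diag_block_zero[OF _ this, of "Y ^\<^sub>m N"]
  have YN: "Y ^\<^sub>m N = 0\<^sub>m (dim_row (Y ^\<^sub>m N)) (dim_row (Y ^\<^sub>m N))" using sq Y(1) by auto
  define q where "q = dim_row Y"
  have Yc: "Y \<in> carrier_mat q q" using sq Y(1) by (auto simp: q_def)
  have Yi: "adj Y * Y = 1\<^sub>m q" using Y(2) by (simp add: unitary_mat_iff[OF Yc])
  let ?u = "unit_vec q 0 :: complex vec"
  have nk: "nsq (Y ^\<^sub>m k *\<^sub>v ?u) = nsq ?u" for k
  proof (induction k)
    case (Suc k)
    have "Y ^\<^sub>m k *\<^sub>v ?u \<in> carrier_vec q" using Yc by simp
    from unitarily_similar_nsq[OF Yc Yi this] show ?case
      unfolding pow_mat_mult_vec_Suc[OF Yc unit_vec_carrier] Suc .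
  qed (use Yc in simp)
  have "Y ^\<^sub>m N *\<^sub>v ?u = 0\<^sub>v q"
    by (subst YN) (use Yc in simp)
  then have "nsq ?u = 0" using nk[of N] by (simp add: nsq_def)
  then have "?u = 0\<^sub>v q" using nsq_eq_0_iff[of ?u q] by simp
  from arg_cong[OF this, of "\<lambda>v. v $ 0"] show False using Y(3) by (simp add: q_def)
qed

lemma diag_jordan_pow_zero:
  "diag_block_mat (map (\<lambda>k. jordan_block k (0 :: complex)) ks) ^\<^sub>m sum_list ks
    = 0\<^sub>m (sum_list ks) (sum_list ks)"
proof -
  \<comment> \<open>The exponent N is decoupled from the list, since the sum of the block sizes
    changes along the induction.\<close>
  have "\<forall>k\<in>set ks. k \<le> N \<Longrightarrow> diag_block_mat (map (\<lambda>k. jordan_block k (0 :: complex) ^\<^sub>m N) ks)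
    = 0\<^sub>m (sum_list ks) (sum_list ks)" for N
  proof (induction ks)
    case (Cons k ks)
    have "jordan_block k (0 :: complex) ^\<^sub>m N = 0\<^sub>m k k"
      unfolding jordan_block_zero_pow using Cons.prems by (intro eq_matI) auto
    then show ?case using Cons unfolding list.map diag_block_Cons by simp
  qed simp
  moreover have "\<forall>k\<in>set ks. k \<le> sum_list ks" using member_le_sum_list by auto
  ultimately show ?thesis
    by (subst diag_block_pow_mat) (auto simp: comp_def)
qed

theorem jordan_sum_pi:
  assumes A: "A \<in> carrier_mat n n"
    and sim: "unitarily_similar A (diag_block_mat (map (\<lambda>k. jordan_block k 0) ks))"
  shows "\<not> has_unitary_part A" "partial_isometry (A ^\<^sub>m j)"
proof -
  let ?D = "diag_block_mat (map (\<lambda>k. jordan_block k 0) ks) :: complex mat"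
  obtain U where U: "U \<in> carrier_mat n n" "?D \<in> carrier_mat n n" "similar_mat_wit A ?D U (adj U)"
    using unitarily_similarD[OF sim A] by blast
  have "n = sum_list ks" using carrier_matD(1)[OF U(2)] by (simp add: dim_diag_block_mat comp_def)
  then have "A ^\<^sub>m n = U * 0\<^sub>m n n * adj U"
    using similar_mat_wit_pow_id[OF U(3), of n] diag_jordan_pow_zero[of ks] by simp
  also have "\<dots> = 0\<^sub>m n n" using U(1) by auto
  finally show "\<not> has_unitary_part A" by (rule nilpotent_no_unitary_part[OF A])
  have "partial_isometry (?D ^\<^sub>m j)"
    by (subst diag_block_pow_mat) (auto intro!: partial_isometry_diag_block partial_isometry_jordan_pow)
  then show "partial_isometry (A ^\<^sub>m j)" by (rule partial_isometry_unitarily_similar[OF A sim])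
qed

section \<open>The numerical range of a Jordan block\<close>

text \<open>Squares are completed edge by edge. The coefficient of the last square is the part of 2
  cos theta already spent; the rest, sin((m+2) theta) / sin((m+1) theta), pays for the next
  edge.\<close>

lemma weighted_path_bound:
  fixes y :: "nat \<Rightarrow> real"
  assumes s: "\<And>i. i \<le> m \<Longrightarrow> sin (real (Suc i) * \<theta>) > 0"
  shows "2 * (\<Sum>i<m. y i * y (Suc i)) \<le> 2 * cos \<theta> * (\<Sum>i<m. (y i)\<^sup>2)
    + sin (real m * \<theta>) / sin (real (Suc m) * \<theta>) * (y m)\<^sup>2"
  using s
proof (induction m)
  case (Suc m)
  define p q u where "p = sin (real m * \<theta>)" and "q = sin (real (Suc m) * \<theta>)"
    and "u = sin (real (Suc (Suc m)) * \<theta>)"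
  have qu: "q > 0" "u > 0" unfolding q_def u_def using Suc.prems[of m] Suc.prems[of "Suc m"] by auto
  have pu: "p + u = 2 * cos \<theta> * q"
    using sin_add[of "real (Suc m) * \<theta>" \<theta>] sin_diff[of "real (Suc m) * \<theta>" \<theta>]
    unfolding p_def q_def u_def by (simp add: algebra_simps)
  have IH: "2 * (\<Sum>i<m. y i * y (Suc i)) \<le> 2 * cos \<theta> * (\<Sum>i<m. (y i)\<^sup>2) + p / q * (y m)\<^sup>2"
    unfolding p_def q_def using Suc by simp
  \<comment> \<open>AM-GM, weighted by the components of the Perron eigenvector of the path\<close>
  have "0 \<le> (u * y m - q * y (Suc m))\<^sup>2 / (u * q)" using qu by simp
  also have "\<dots> = u / q * (y m)\<^sup>2 + q / u * (y (Suc m))\<^sup>2 - 2 * (y m * y (Suc m))"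
    using qu by (simp add: field_simps power2_eq_square)
  finally have "2 * (y m * y (Suc m)) \<le> u / q * (y m)\<^sup>2 + q / u * (y (Suc m))\<^sup>2" by simp
  moreover have "p / q * (y m)\<^sup>2 + u / q * (y m)\<^sup>2 = 2 * cos \<theta> * (y m)\<^sup>2"
  proof -
    have "p / q * (y m)\<^sup>2 + u / q * (y m)\<^sup>2 = (p + u) / q * (y m)\<^sup>2"
      by (simp add: add_divide_distrib distrib_right)
    then show ?thesis unfolding pu using qu by simp
  qed
  ultimately have "2 * (\<Sum>i<m. y i * y (Suc i)) + 2 * (y m * y (Suc m))
    \<le> 2 * cos \<theta> * (\<Sum>i<m. (y i)\<^sup>2) + 2 * cos \<theta> * (y m)\<^sup>2 + q / u * (y (Suc m))\<^sup>2"
    using IH by linarith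
  then show ?case unfolding sum.lessThan_Suc distrib_left q_def u_def .
qed simp

text \<open>The case of equality in the weighted bound: y i = sin((i+1) theta).\<close>

lemma sin_path_sum:
  "2 * (\<Sum>i<m. sin (real (Suc i) * \<theta>) * sin (real (Suc (Suc i)) * \<theta>))
    = 2 * cos \<theta> * (\<Sum>i<m. (sin (real (Suc i) * \<theta>))\<^sup>2) + sin (real m * \<theta>) * sin (real (Suc m) * \<theta>)"
proof (induction m)
  case (Suc m)
  define p q u where "p = sin (real m * \<theta>)" and "q = sin (real (Suc m) * \<theta>)"
    and "u = sin (real (Suc (Suc m)) * \<theta>)"
  have "p + u = 2 * cos \<theta> * q"
    using sin_add[of "real (Suc m) * \<theta>" \<theta>] sin_diff[of "real (Suc m) * \<theta>" \<theta>]
    unfolding p_def q_def u_def by (simp add: algebra_simps)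
  then have "p * q + q * u = 2 * cos \<theta> * q\<^sup>2"
    by (metis distrib_left mult.commute mult.left_commute power2_eq_square)
  then have "p * q + 2 * (q * u) = 2 * cos \<theta> * q\<^sup>2 + q * u" by simp
  then show ?case
    using Suc.IH unfolding sum.lessThan_Suc distrib_left p_def q_def u_def by linarith
qed simp

context
  fixes k :: nat and \<theta> :: real
  assumes k: "k \<ge> 1" and \<theta>: "\<theta> = pi / (real k + 1)"
begin

lemma path_angle: "0 < \<theta>" "real (Suc k) * \<theta> = pi" "i < k \<Longrightarrow> sin (real (Suc i) * \<theta>) > 0"
proof -
  show p: "0 < \<theta>" by (simp add: \<theta> add_nonneg_pos)
  show e: "real (Suc k) * \<theta> = pi" unfolding \<theta> by (simp add: add.commute)
  assume "i < k"
  then have "real (Suc i) * \<theta> < real (Suc k) * \<theta>" using p by (intro mult_strict_right_mono) auto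
  then show "sin (real (Suc i) * \<theta>) > 0" unfolding e using p by (intro sin_gt_zero) auto
qed

lemma cos_path_angle_nonneg: "cos \<theta> \<ge> 0"
proof (rule cos_ge_zero)
  show "- (pi / 2) \<le> \<theta>" using path_angle(1) pi_gt_zero by linarith
  show "\<theta> \<le> pi / 2" unfolding \<theta> using k by (intro divide_left_mono) auto
qed

lemma path_bound:
  fixes y :: "nat \<Rightarrow> real"
  shows "(\<Sum>i<k - 1. y i * y (Suc i)) \<le> cos \<theta> * (\<Sum>i<k. (y i)\<^sup>2)"
proof -
  define m where "m = k - 1"
  have km: "k = Suc m" using k by (simp add: m_def)
  define q where "q = sin (real (Suc m) * \<theta>)"
  have q: "q > 0" unfolding q_def using path_angle(3)[of m] km by simp
  \<comment> \<open>For theta = pi/(k+1) the next sine vanishes, so the coefficient of the last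
    square becomes the full 2 cos theta.\<close>
  have "sin (real m * \<theta>) = 2 * cos \<theta> * q"
  proof -
    have "sin (real (Suc (Suc m)) * \<theta>) = 0" using path_angle(2) km by simp
    then show ?thesis
      using sin_add[of "real (Suc m) * \<theta>" \<theta>] sin_diff[of "real (Suc m) * \<theta>" \<theta>]
      unfolding q_def by (simp add: algebra_simps)
  qed
  then have e: "sin (real m * \<theta>) / q = 2 * cos \<theta>" using q by simp
  have "2 * (\<Sum>i<m. y i * y (Suc i)) \<le> 2 * cos \<theta> * (\<Sum>i<m. (y i)\<^sup>2)
    + sin (real m * \<theta>) / sin (real (Suc m) * \<theta>) * (y m)\<^sup>2"
    by (rule weighted_path_bound) (use path_angle(3) km in auto)
  then have "2 * (\<Sum>i<m. y i * y (Suc i)) \<le> 2 * (cos \<theta> * (\<Sum>i<Suc m. (y i)\<^sup>2))"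
    unfolding q_def[symmetric] e sum.lessThan_Suc by (simp add: algebra_simps)
  then show ?thesis unfolding m_def[symmetric] unfolding km by simp
qed

lemma jordan_ip:
  assumes x: "x \<in> carrier_vec k"
  shows "(jordan_block k 0 *\<^sub>v x) \<bullet>c x = (\<Sum>i<k - 1. x $ Suc i * cnj (x $ i))"
proof -
  have 1: "(jordan_block k (0 :: complex) *\<^sub>v x) $ i = (if Suc i < k then x $ Suc i else 0)" if "i < k" for i
    using jordan_pow_mv[OF that x, of 1] by (simp add: left_mult_one_mat[OF jordan_block_carrier])
  have "(jordan_block k 0 *\<^sub>v x) \<bullet>c x = (\<Sum>i<k. (if Suc i < k then x $ Suc i else 0) * cnj (x $ i))"
    using x unfolding scalar_prod_def by (auto simp: 1 lessThan_atLeast0 simp del: index_mult_mat_vec intro!: sum.cong)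
  also have "\<dots> = (\<Sum>i<k - 1. x $ Suc i * cnj (x $ i))"
    by (rule sum.mono_neutral_cong_right) auto
  finally show ?thesis .
qed

lemma jordan_bound:
  assumes x: "x \<in> carrier_vec k"
  shows "cmod ((jordan_block k 0 *\<^sub>v x) \<bullet>c x) \<le> cos \<theta> * nsq x"
proof -
  have "cmod ((jordan_block k 0 *\<^sub>v x) \<bullet>c x) \<le> (\<Sum>i<k - 1. cmod (x $ Suc i * cnj (x $ i)))"
    unfolding jordan_ip[OF x] by (rule norm_sum)
  also have "\<dots> = (\<Sum>i<k - 1. cmod (x $ i) * cmod (x $ Suc i))"
    by (simp add: norm_mult mult.commute)
  also have "\<dots> \<le> cos \<theta> * (\<Sum>i<k. (cmod (x $ i))\<^sup>2)" by (rule path_bound)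
  finally show ?thesis using x by (simp add: nsq_def)
qed

text \<open>Intermediate values between a coordinate vector, whose path sum is 0, and the sine
  vector, whose quotient is cos theta.\<close>

lemma path_attained:
  assumes \<rho>: "0 \<le> \<rho>" "\<rho> \<le> cos \<theta>"
  obtains c :: "nat \<Rightarrow> real" where "c 0 > 0" "(\<Sum>i<k - 1. c i * c (Suc i)) = \<rho> * (\<Sum>i<k. (c i)\<^sup>2)"
proof -
  define s where "s i = sin (real (Suc i) * \<theta>)" for i
  \<comment> \<open>All weights except the first are scaled by t. The first stays fixed, so the
    vector is nonzero for every t.\<close>
  define c where "c t i = (if i = 0 then s 0 else t * s i)" for t i
  define g where "g t = (\<Sum>i<k - 1. c t i * c t (Suc i)) - \<rho> * (\<Sum>i<k. (c t i)\<^sup>2)" for t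
  have s0: "s 0 > 0" using path_angle(3)[of 0] k by (simp add: s_def)
  have "g 0 \<le> 0"
  proof -
    have "(\<Sum>i<k - 1. c 0 i * c 0 (Suc i)) = 0" by (simp add: c_def)
    moreover have "\<rho> * (\<Sum>i<k. (c 0 i)\<^sup>2) \<ge> 0" using \<rho>(1) by (intro mult_nonneg_nonneg sum_nonneg) auto
    ultimately show ?thesis by (simp add: g_def)
  qed
  have "g 1 \<ge> 0"
  proof -
    define m where "m = k - 1"
    have km: "k = Suc m" using k by (simp add: m_def)
    have c1: "c 1 i = s i" for i by (simp add: c_def)
    have "s k = 0" unfolding s_def using path_angle(2) by simp
    then have sm: "s (Suc m) = 0" using km by simp
    have "2 * (\<Sum>i<Suc m. s i * s (Suc i)) = 2 * cos \<theta> * (\<Sum>i<Suc m. (s i)\<^sup>2) + s m * s (Suc m)"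
      unfolding s_def by (rule sin_path_sum)
    then have "(\<Sum>i<m. s i * s (Suc i)) = cos \<theta> * (\<Sum>i<Suc m. (s i)\<^sup>2)"
      unfolding sm sum.lessThan_Suc[of "\<lambda>i. s i * s (Suc i)"] by simp
    then have "g 1 = (cos \<theta> - \<rho>) * (\<Sum>i<Suc m. (s i)\<^sup>2)"
      unfolding g_def m_def[symmetric] c1 unfolding km by (simp add: left_diff_distrib)
    then show ?thesis using \<rho>(2) by (simp add: sum_nonneg)
  qed
  have "continuous_on {0..1} (\<lambda>t. c t i)" for i
    by (cases "i = 0") (auto simp: c_def intro!: continuous_intros)
  then have "continuous_on {0..1} g"
    unfolding g_def by (intro continuous_intros)
  with \<open>g 0 \<le> 0\<close> \<open>g 1 \<ge> 0\<close> obtain t where "g t = 0"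
    using IVT'[of g 0 0 1] by auto
  then show thesis using that[of "c t"] s0 by (simp add: g_def c_def)
qed

text \<open>Multiplying coordinate i by zeta^i multiplies the form of the block by zeta, so a real
  solution for |w| can be rotated to one for w.\<close>

lemma jordan_attained:
  assumes w: "cmod w \<le> cos \<theta>"
  obtains x where "x \<in> carrier_vec k" "x \<noteq> 0\<^sub>v k" "(jordan_block k 0 *\<^sub>v x) \<bullet>c x = w * of_real (nsq x)"
proof -
  obtain c :: "nat \<Rightarrow> real" where c: "c 0 > 0"
    "(\<Sum>i<k - 1. c i * c (Suc i)) = cmod w * (\<Sum>i<k. (c i)\<^sup>2)"
    by (rule path_attained[OF norm_ge_zero w])
  define \<zeta> where "\<zeta> = (if w = 0 then 1 else w / of_real (cmod w))"
  have \<zeta>: "cmod \<zeta> = 1" "w = of_real (cmod w) * \<zeta>" by (auto simp: \<zeta>_def norm_divide)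
  define x where "x = vec k (\<lambda>i. of_real (c i) * \<zeta> ^ i)"
  have x: "x \<in> carrier_vec k" by (simp add: x_def)
  have nx: "nsq x = (\<Sum>i<k. (c i)\<^sup>2)"
    unfolding nsq_def by (simp add: x_def norm_mult norm_power \<zeta>(1))
  have "x $ 0 \<noteq> 0" using c(1) k by (simp add: x_def)
  then have x0: "x \<noteq> 0\<^sub>v k" using k by auto
  have "x $ Suc i * cnj (x $ i) = \<zeta> * of_real (c i * c (Suc i))" if "i < k - 1" for i
  proof -
    have "\<zeta> ^ i * cnj (\<zeta> ^ i) = 1"
      using complex_norm_square[of "\<zeta> ^ i"] \<zeta>(1) by (simp add: norm_power)
    moreover have "x $ Suc i * cnj (x $ i) = \<zeta> * of_real (c i * c (Suc i)) * (\<zeta> ^ i * cnj (\<zeta> ^ i))"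
      using that by (simp add: x_def)
    ultimately show ?thesis by simp
  qed
  then have "(jordan_block k 0 *\<^sub>v x) \<bullet>c x = (\<Sum>i<k - 1. \<zeta> * of_real (c i * c (Suc i)))"
    unfolding jordan_ip[OF x] by (intro sum.cong) auto
  also have "\<dots> = \<zeta> * of_real (\<Sum>i<k - 1. c i * c (Suc i))"
    by (simp add: sum_distrib_left)
  also have "\<dots> = (of_real (cmod w) * \<zeta>) * of_real (nsq x)"
    unfolding c(2) nx by (simp only: of_real_mult mult_ac)
  finally have "(jordan_block k 0 *\<^sub>v x) \<bullet>c x = w * of_real (nsq x)"
    unfolding \<zeta>(2)[symmetric] .
  then show thesis by (rule that[OF x x0])
qed

end

section \<open>Numerical ranges of block diagonal matrices and the equivalence\<close>

lemma diag_block_bound: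
  assumes "\<forall>B\<in>set Bs. square_mat B \<and> (\<forall>x\<in>carrier_vec (dim_row B). cmod ((B *\<^sub>v x) \<bullet>c x) \<le> r * nsq x)"
    and "x \<in> carrier_vec (dim_row (diag_block_mat Bs))"
  shows "cmod ((diag_block_mat Bs *\<^sub>v x) \<bullet>c x) \<le> r * nsq x"
  using assms
proof (induction Bs arbitrary: x)
  case Nil
  then show ?case by (auto simp: scalar_prod_def nsq_def)
next
  case (Cons B Bs)
  let ?D = "diag_block_mat Bs"
  have D: "?D \<in> carrier_mat (dim_row ?D) (dim_row ?D)"
    by (rule diag_block_square) (use Cons.prems(1) in simp)
  have B: "B \<in> carrier_mat (dim_row B) (dim_row B)" using Cons.prems(1) by (intro carrier_matI) auto
  have e: "diag_block_mat (B # Bs) = four_block_mat B (0\<^sub>m (dim_row B) (dim_row ?D)) (0\<^sub>m (dim_row ?D) (dim_row B)) ?D"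
    unfolding diag_block_Cons using carrier_matD(2)[OF B] carrier_matD(2)[OF D] by simp
  have "x \<in> carrier_vec (dim_row B + dim_row ?D)" using Cons.prems(2) unfolding e by simp
  then obtain a b where ab: "a \<in> carrier_vec (dim_row B)" "b \<in> carrier_vec (dim_row ?D)" "x = a @\<^sub>v b"
    by (rule vec_split)
  have "(diag_block_mat (B # Bs) *\<^sub>v x) \<bullet>c x = (B *\<^sub>v a) \<bullet>c a + (?D *\<^sub>v b) \<bullet>c b"
    unfolding e ab(3) diag_block_mv[OF B D ab(1,2)]
    by (rule ip_append[OF _ ab(1) _ ab(2)]) simp_all
  also have "cmod \<dots> \<le> cmod ((B *\<^sub>v a) \<bullet>c a) + cmod ((?D *\<^sub>v b) \<bullet>c b)" by (rule norm_triangle_ineq)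
  also have "\<dots> \<le> r * nsq a + r * nsq b"
    using Cons.prems(1) ab(1) Cons.IH[OF _ ab(2)] by (intro add_mono) auto
  finally show ?case unfolding ab(3) nsq_append distrib_left .
qed

lemma diag_block_attained:
  assumes "\<forall>B\<in>set Bs. square_mat B" "B \<in> set Bs"
    and "a \<in> carrier_vec (dim_row B)"
  shows "\<exists>x. x \<in> carrier_vec (dim_row (diag_block_mat Bs)) \<and> nsq x = nsq a \<and>
    (diag_block_mat Bs *\<^sub>v x) \<bullet>c x = (B *\<^sub>v a) \<bullet>c a"
  using assms
proof (induction Bs)
  case (Cons C Cs)
  let ?D = "diag_block_mat Cs"
  have D: "?D \<in> carrier_mat (dim_row ?D) (dim_row ?D)"
    by (rule diag_block_square) (use Cons.prems(1) in simp)
  have C: "C \<in> carrier_mat (dim_row C) (dim_row C)" using Cons.prems(1) by (intro carrier_matI) auto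
  have e: "diag_block_mat (C # Cs) = four_block_mat C (0\<^sub>m (dim_row C) (dim_row ?D)) (0\<^sub>m (dim_row ?D) (dim_row C)) ?D"
    unfolding diag_block_Cons using carrier_matD(2)[OF C] carrier_matD(2)[OF D] by simp
  have ip: "(diag_block_mat (C # Cs) *\<^sub>v (u @\<^sub>v v)) \<bullet>c (u @\<^sub>v v) = (C *\<^sub>v u) \<bullet>c u + (?D *\<^sub>v v) \<bullet>c v"
    if "u \<in> carrier_vec (dim_row C)" "v \<in> carrier_vec (dim_row ?D)" for u v
    unfolding e diag_block_mv[OF C D that]
    by (rule ip_append[OF _ that(1) _ that(2)]) simp_all
  have car: "u @\<^sub>v v \<in> carrier_vec (dim_row (diag_block_mat (C # Cs)))"
    if "u \<in> carrier_vec (dim_row C)" "v \<in> carrier_vec (dim_row ?D)" for u v :: "complex vec"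
    unfolding e using that by simp
  have nz: "nsq (0\<^sub>v q) = 0" for q by (simp add: nsq_def)
  have "B = C \<or> B \<in> set Cs" using Cons.prems(2) by simp
  then show ?case
  proof
    assume "B = C"
    then have a: "a \<in> carrier_vec (dim_row C)" using Cons.prems(3) by simp
    show ?thesis
      unfolding \<open>B = C\<close>
      by (intro exI[of _ "a @\<^sub>v 0\<^sub>v (dim_row ?D)"] conjI car a zero_carrier_vec)
        (use ip[OF a zero_carrier_vec] in \<open>simp_all add: nsq_append nz\<close>)
  next
    assume "B \<in> set Cs"
    from Cons.IH[OF _ this Cons.prems(3)] Cons.prems(1) obtain v where
      v: "v \<in> carrier_vec (dim_row ?D)" "nsq v = nsq a" "(?D *\<^sub>v v) \<bullet>c v = (B *\<^sub>v a) \<bullet>c a"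
      by auto
    show ?thesis
      by (intro exI[of _ "0\<^sub>v (dim_row C) @\<^sub>v v"] conjI car v(1) zero_carrier_vec)
        (use ip[OF zero_carrier_vec v(1)] v in \<open>simp_all add: nsq_append nz\<close>)
  qed
qed simp

text \<open>Only some radius is claimed, that of the largest block. Its expression through
  \<open>ascent A\<close> comes from \<open>radius_eq\<close>, once the range is known to be a
  disc.\<close>

theorem jordan_sum_range:
  assumes n: "n \<ge> 1" and A: "A \<in> carrier_mat n n" and pos: "\<forall>k\<in>set ks. k \<ge> 1"
    and sim: "unitarily_similar A (diag_block_mat (map (\<lambda>k. jordan_block k 0) ks))"
  shows "\<exists>r\<ge>0. numerical_range A = cball 0 r"
proof -
  let ?Bs = "map (\<lambda>k. jordan_block k 0) ks :: complex mat list"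
  let ?D = "diag_block_mat ?Bs"
  obtain U where U: "U \<in> carrier_mat n n" "?D \<in> carrier_mat n n" "adj U * U = 1\<^sub>m n" "U * adj U = 1\<^sub>m n"
    "A = U * ?D * adj U"
    using unitarily_similarD[OF sim A] by metis
  have dU: "dim_row U = n" "dim_col U = n" and dD: "dim_row ?D = n" "dim_col ?D = n" using U(1,2) by auto
  have ks: "ks \<noteq> []" using n dD by auto
  define K where "K = Max (set ks)"
  \<comment> \<open>A larger block has a smaller angle and a larger cosine, so the block of size K
    both bounds the form and attains every value of the disc.\<close>
  have K: "K \<in> set ks" "\<And>k. k \<in> set ks \<Longrightarrow> k \<le> K" using ks by (auto simp: K_def)
  have K1: "K \<ge> 1" using pos K(1) by blast
  define r where "r = cos (pi / (real K + 1))"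
  have r: "r \<ge> 0" unfolding r_def by (rule cos_path_angle_nonneg[OF K1 refl])
  have ipA: "(A *\<^sub>v x) \<bullet>c x = (?D *\<^sub>v (adj U *\<^sub>v x)) \<bullet>c (adj U *\<^sub>v x)" if "x \<in> carrier_vec n" for x
  proof -
    have "A *\<^sub>v x = U *\<^sub>v (?D *\<^sub>v (adj U *\<^sub>v x))"
      unfolding U(5) using dU dD that by (simp add: mv_mult)
    then show ?thesis using dU dD that by (simp add: ip_adj)
  qed
  have bound: "cmod ((?D *\<^sub>v x) \<bullet>c x) \<le> r * nsq x" if "x \<in> carrier_vec n" for x
  proof (rule diag_block_bound)
    show "\<forall>B\<in>set ?Bs. square_mat B \<and> (\<forall>x\<in>carrier_vec (dim_row B). cmod ((B *\<^sub>v x) \<bullet>c x) \<le> r * nsq x)"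
    proof (intro ballI conjI)
      fix B assume "B \<in> set ?Bs"
      then obtain k where k: "k \<in> set ks" "B = jordan_block k 0" by auto
      then have k1: "k \<ge> 1" using pos by blast
      show "square_mat B" using k by simp
      fix x :: "complex vec" assume "x \<in> carrier_vec (dim_row B)"
      then have x: "x \<in> carrier_vec k" using k by simp
      have "cmod ((B *\<^sub>v x) \<bullet>c x) \<le> cos (pi / (real k + 1)) * nsq x"
        unfolding k(2) by (rule jordan_bound[OF k1 refl x])
      also have "cos (pi / (real k + 1)) \<le> r"
        unfolding r_def
      proof (rule cos_monotone_0_pi_le)
        show "pi / (real K + 1) \<le> pi / (real k + 1)"
          using K(2)[OF k(1)] by (intro divide_left_mono) auto
        show "pi / (real k + 1) \<le> pi" by (simp add: divide_simps)
      qed simp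
      finally show "cmod ((B *\<^sub>v x) \<bullet>c x) \<le> r * nsq x" using mult_right_mono nsq_nonneg by blast
    qed
  qed (use that dD in simp)
  have "numerical_range A = cball 0 r"
  proof (intro equalityI subsetI)
    fix w assume "w \<in> numerical_range A"
    then obtain x where x: "x \<in> carrier_vec n" "nsq x = 1" "w = (A *\<^sub>v x) \<bullet>c x"
      unfolding numerical_range_def vec_norm_eq_1_iff using A by auto
    have "adj U *\<^sub>v x \<in> carrier_vec n" using dU by simp
    from bound[OF this] show "w \<in> cball 0 r"
      unfolding x(3) ipA[OF x(1)]
      using unitarily_similar_nsq[of "adj U" n x] U x by simp
  next
    fix w :: complex assume "w \<in> cball 0 r"
    then have "cmod w \<le> cos (pi / (real K + 1))" by (simp add: r_def)
    then obtain a where a: "a \<in> carrier_vec K" "a \<noteq> 0\<^sub>v K" "(jordan_block K 0 *\<^sub>v a) \<bullet>c a = w * of_real (nsq a)"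
      by (rule jordan_attained[OF K1 refl])
    obtain c where c: "c > 0" "nsq (complex_of_real c \<cdot>\<^sub>v a) = 1" by (rule nsq_normalize[OF a(1,2)])
    define u where "u = complex_of_real c \<cdot>\<^sub>v a"
    have u: "u \<in> carrier_vec K" "nsq u = 1" using a(1) c by (auto simp: u_def)
    have "(jordan_block K 0 *\<^sub>v u) \<bullet>c u = of_real (c\<^sup>2) * ((jordan_block K 0 *\<^sub>v a) \<bullet>c a)"
      using a(1) by (simp add: u_def mv_vec_smult ip_linear power2_eq_square)
    also have "\<dots> = w * of_real (c\<^sup>2 * nsq a)" unfolding a(3) by simp
    also have "c\<^sup>2 * nsq a = 1" using c(2) by (simp add: nsq_smult)
    finally have uw: "(jordan_block K 0 *\<^sub>v u) \<bullet>c u = w" by simp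
    have "\<exists>x. x \<in> carrier_vec (dim_row ?D) \<and> nsq x = nsq u \<and> (?D *\<^sub>v x) \<bullet>c x = (jordan_block K 0 *\<^sub>v u) \<bullet>c u"
      by (rule diag_block_attained) (use K(1) u in auto)
    then obtain x where x: "x \<in> carrier_vec n" "nsq x = 1" "(?D *\<^sub>v x) \<bullet>c x = w"
      unfolding dD uw u(2) by blast
    have Ux: "U *\<^sub>v x \<in> carrier_vec n" using dU by simp
    have aU: "adj U *\<^sub>v (U *\<^sub>v x) = x"
      by (rule isom_matD(4)[of n n]) (use U x in \<open>auto simp: isom_mat_def\<close>)
    have "(A *\<^sub>v (U *\<^sub>v x)) \<bullet>c (U *\<^sub>v x) = w" unfolding ipA[OF Ux] aU by (rule x(3))
    moreover have "nsq (U *\<^sub>v x) = 1" using unitarily_similar_nsq[OF U(1,3) x(1)] x(2) by simp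
    ultimately show "w \<in> numerical_range A"
      unfolding numerical_range_def vec_norm_eq_1_iff using Ux carrier_matD(2)[OF A] by blast
  qed
  with r show ?thesis by blast
qed

theorem theorem2p6:
  fixes A :: "complex mat" and n :: nat
  assumes n: "n \<ge> 1"
    and A: "A \<in> carrier_mat n n"
    and p: "ppi_index A + 1 \<ge> enat (ascent A)"
  defines "a \<equiv> (\<exists>r\<ge>0. numerical_range A = cball 0 r)"
    and "b \<equiv> (\<exists>ks. (\<forall>k\<in>set ks. k \<ge> 1) \<and>
                unitarily_similar A (diag_block_mat (map (\<lambda>k. jordan_block k 0) ks)))"
    and "c \<equiv> (\<not> has_unitary_part A \<and> (\<forall>j\<ge>1. partial_isometry (A ^\<^sub>m j)))"
    and "d \<equiv> (\<not> has_unitary_part A \<and>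
                (\<exists>l>ascent A. \<forall>j\<in>{1..l}. partial_isometry (A ^\<^sub>m j)))"
  shows "(a \<longleftrightarrow> b) \<and> (b \<longleftrightarrow> c) \<and> (c \<longleftrightarrow> d) \<and>
         (a \<longrightarrow> numerical_range A = {z. cmod z \<le> cos (pi / (real (ascent A) + 1))} \<and>
              ppi_index A = \<infinity>)"
proof -
  have PI0: "partial_isometry (A ^\<^sub>m 0)"
    by (rule partial_isometryI[of _ n]) (use A in \<open>auto simp: orth_complement_def\<close>)
  \<comment> \<open>A power failing at j would cap the index at j - 1, and the hypothesis would then
    give a <= j.\<close>
  have PI: "partial_isometry (A ^\<^sub>m j)" if "j < ascent A" for j
  proof (rule ccontr)
    assume no: "\<not> partial_isometry (A ^\<^sub>m j)"
    with PI0 have "j \<noteq> 0" by metis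
    have "ppi_index A \<le> enat (j - 1)"
      unfolding ppi_index_def
    proof (rule Sup_least)
      fix e assume "e \<in> {enat k | k. \<forall>i\<le>k. partial_isometry (A ^\<^sub>m i)}"
      then obtain k where k: "e = enat k" "\<forall>i\<le>k. partial_isometry (A ^\<^sub>m i)" by blast
      then have "k < j" using no by (meson not_le)
      then show "e \<le> enat (j - 1)" using k by simp
    qed
    then have "ppi_index A + 1 \<le> enat (j - 1) + 1" by (rule add_right_mono)
    also have "\<dots> = enat j" using \<open>j \<noteq> 0\<close> by (simp add: one_enat_def)
    finally have "enat (ascent A) \<le> enat j" using p by (rule order_trans[rotated])
    then show False using that by simp
  qed
  \<comment> \<open>If A^a = 0, the powers from a on have full kernel and are trivially partial
    isometries; this extends the range j < a to all exponents.\<close>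
  have nil_b: b if full: "mat_kernel (A ^\<^sub>m ascent A) = carrier_vec n"
  proof -
    have "partial_isometry (A ^\<^sub>m j)" for j
    proof (cases "j < ascent A")
      case False
      then have k: "mat_kernel (A ^\<^sub>m j) = carrier_vec n" using ascent_kernel_eq[OF A, of j] full by simp
      show ?thesis
      proof (rule partial_isometryI[of _ n])
        fix x assume x: "x \<in> orth_complement n (mat_kernel (A ^\<^sub>m j))"
        have xc: "x \<in> carrier_vec n" by (rule orth_complementD[OF x])
        have "x \<bullet>c x = 0" by (rule orth_complementD(2)[OF x]) (simp add: k xc)
        then have "nsq x = 0" by (simp add: ip_self)
        moreover have "A ^\<^sub>m j *\<^sub>v x = 0\<^sub>v n" using k xc pow_kernel_iff[OF A] by blast
        ultimately show "nsq (A ^\<^sub>m j *\<^sub>v x) = nsq x" by (simp add: nsq_def)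
      qed (use A in simp)
    qed (rule PI)
    from nilpotent_pi_jordan[OF A this full] show b unfolding b_def .
  qed
  have ab: b "numerical_range A = {z. cmod z \<le> cos (pi / (real (ascent A) + 1))}" if a
  proof -
    obtain r where rr: "r \<ge> 0" "numerical_range A = cball 0 r" using \<open>a\<close> unfolding a_def by blast
    interpret disc_range_pi n A r using A rr PI by unfold_locales
    show b by (rule nil_b[OF nilpotent])
    show "numerical_range A = {z. cmod z \<le> cos (pi / (real (ascent A) + 1))}"
      unfolding rr(2) radius_eq \<theta>_def by auto
  qed
  have ba: a if b using that jordan_sum_range[OF n A] unfolding a_def b_def by blast
  have bPI: "\<not> has_unitary_part A" "partial_isometry (A ^\<^sub>m j)" if b for j
    using that jordan_sum_pi[OF A] unfolding b_def by blast+
  have bc: c if b unfolding c_def using bPI[OF that] by blast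
  have cd: d if c using that unfolding c_def d_def by (intro conjI exI[of _ "Suc (ascent A)"]) auto
  have db: b if d
  proof -
    obtain l where no: "\<not> has_unitary_part A" and l: "l > ascent A" "\<forall>j\<in>{1..l}. partial_isometry (A ^\<^sub>m j)"
      using \<open>d\<close> unfolding d_def by blast
    have "partial_isometry (A ^\<^sub>m j)" if "j \<le> Suc (ascent A)" for j
    proof (cases "j = 0")
      case True then show ?thesis using PI0 by simp
    next
      case False then show ?thesis using l that by simp
    qed
    from nilpotent_if_no_unitary_part[OF A no this] show b by (rule nil_b)
  qed
  have "ppi_index A = \<infinity>" if b
  proof -
    have "\<forall>j\<le>k. partial_isometry (A ^\<^sub>m j)" for k using bPI(2)[OF that] by blast
    then have le: "enat k \<le> ppi_index A" for k unfolding ppi_index_def by (intro Sup_upper) blast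
    show ?thesis
    proof (cases "ppi_index A")
      case (enat k)
      then show ?thesis using le[of "Suc k"] by simp
    qed simp
  qed
  then show ?thesis using ab ba bc cd db by blast
qed

end
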